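(* Let $0<t<T$ and let $g:[0,T]\to\mathbb{R}$ be a Borel function such that $\mathbb{E}[|g(\nu)|]<+\infty$. Then, $\mathbb{P}$-a.s., $$\mathbb{E}[g(\nu)\mid \mathcal{F}_t^{\zeta^T}]=g(\nu)\,\mathbb{I}_{\{\nu\le t\}}+\sum_{i=1}^{l}\frac{\displaystyle\int_{t}^{T}g(r)\,\varphi_{t}^{r,z_i}(\zeta^T_t)f(r,z_i)\,\mathrm{d}r+F(T,z_i)\,g(T)\,\varphi_{t}^{T,z_i}(\zeta^T_t)}{\displaystyle\sum_{j=1}^{l}\Big[\int_{t}^{T}\varphi_{t}^{r,z_j}(\zeta^T_t)f(r,z_j)\,\mathrm{d}r+F(T,z_j)\,\varphi_{t}^{T,z_j}(\zeta^T_t)\Big]p_j}\,p_i\,\mathbb{I}_{\{t<\nu\}}.$$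
   Context: Let $T>0$ and $\sigma>0$ be constants. On a complete probability space $(\Omega,\mathcal{F},\mathbb{P})$ let $W=(W_t)_{t\ge 0}$ be a standard Brownian motion, $\tau$ a strictly positive random time and $Z_T$ a real random variable, such that $W$ is independent of the pair $(\tau,Z_T)$ ($\tau$ and $Z_T$ need not be independent of each other). $Z_T$ takes values in a finite set $\{z_1,\dots,z_l\}$ of distinct reals, with $\mathbb{P}(Z_T=z_i)=p_i>0$, $\sum_i p_i=1$. Assume $\mathbb{P}(\tau\le T)<1$ and that for each $i$ the conditional law of $\tau$ given $Z_T=z_i$ has a continuous density $f(\cdot,z_i)$ with respect to Lebesgue measure on $\mathbb{R}_+$. Put $F(T,z_i)=\int_T^{+\infty}f(r,z_i)\,\mathrm{d}r$ and $\nu=\tau\wedge T$. The market information process is $$\zeta^T_t=W_{t\wedge \nu}-\frac{t\wedge \nu}{\nu}W_{\nu}+\sigma\frac{t\wedge \nu}{\nu}Z_T,\qquad t\in[0,T],$$ and $\mathbb{F}^{\zeta^T}=(\mathcal{F}^{\zeta^T}_t)_{0\le t\le T}$ is its natural filtration completed by the $\mathbb{P}$-null sets. $p(t,x,y)=\frac{1}{\sqrt{2\pi t}}e^{-(x-y)^2/(2t)}$ is the Gaussian density in $x$ with variance $t$ and mean $y$, and $\varphi_{t}^{r,z}(x)=p\big(\frac{t(r-t)}{r},x,\frac{t}{r}\sigma z\big)$ for $0<t<r$. *)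

theory Defs
  imports "HOL-Probability.Probability"
begin

(* W is only looked at for times t \<ge> 0. Path continuity and W 0 = 0 are required
   almost surely; the increments are independent and centred Gaussian, with variance t - s
   (the second parameter of normal_density is the standard deviation). *)
definition std_brownian_motion :: "'a measure \<Rightarrow> (real \<Rightarrow> 'a \<Rightarrow> real) \<Rightarrow> bool" where
  "std_brownian_motion M W \<longleftrightarrow>
     (\<forall>t\<ge>0. W t \<in> borel_measurable M) \<and>
     (AE \<omega> in M. W 0 \<omega> = 0) \<and>
     (\<forall>(n::nat) s. 0 \<le> s 0 \<and> (\<forall>k<n. s k < s (Suc k)) \<longrightarrow>
        prob_space.indep_vars M (\<lambda>_. borel)
          (\<lambda>k \<omega>. W (s (Suc k)) \<omega> - W (s k) \<omega>) {..<n}) \<and>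
     (\<forall>s t. 0 \<le> s \<and> s < t \<longrightarrow>
        distributed M lborel (\<lambda>\<omega>. W t \<omega> - W s \<omega>) (normal_density 0 (sqrt (t - s)))) \<and>
     (AE \<omega> in M. continuous_on {0..} (\<lambda>t. W t \<omega>))"

definition market_information ::
  "real \<Rightarrow> (real \<Rightarrow> 'a \<Rightarrow> real) \<Rightarrow> ('a \<Rightarrow> real) \<Rightarrow> ('a \<Rightarrow> real) \<Rightarrow> real \<Rightarrow> 'a \<Rightarrow> real" where
  "market_information \<sigma> W \<nu> Z t \<omega> =
     W (min t (\<nu> \<omega>)) \<omega> - min t (\<nu> \<omega>) / \<nu> \<omega> * W (\<nu> \<omega>) \<omega>
       + \<sigma> * (min t (\<nu> \<omega>) / \<nu> \<omega>) * Z \<omega>"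

definition completed_natural_filtration ::
  "'a measure \<Rightarrow> (real \<Rightarrow> 'a \<Rightarrow> real) \<Rightarrow> real \<Rightarrow> 'a measure" where
  "completed_natural_filtration M X t =
     sigma (space M)
       ({X s -` B \<inter> space M | s B. 0 \<le> s \<and> s \<le> t \<and> B \<in> sets borel} \<union> null_sets M)"

definition gauss_kernel :: "real \<Rightarrow> real \<Rightarrow> real \<Rightarrow> real" where
  "gauss_kernel t x y = 1 / sqrt (2 * pi * t) * exp (- (x - y)\<^sup>2 / (2 * t))"

(* Meaningful for 0 < t < r. The value at r = t, where the variance degenerates,
   is irrelevant to the Lebesgue integrals over r in which it occurs. *)
definition bridge_density :: "real \<Rightarrow> real \<Rightarrow> real \<Rightarrow> real \<Rightarrow> real \<Rightarrow> real" where
  "bridge_density \<sigma> t r z x = gauss_kernel (t * (r - t) / r) x (t / r * \<sigma> * z)"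

definition tail_mass :: "(real \<Rightarrow> real \<Rightarrow> real) \<Rightarrow> real \<Rightarrow> real \<Rightarrow> real" where
  "tail_mass f T z = (LBINT r:{T..}. f r z)"

(* uniform_measure M {Z = c} is the conditional probability P( . | Z = c). *)
definition has_cond_density ::
  "'a measure \<Rightarrow> ('a \<Rightarrow> real) \<Rightarrow> ('a \<Rightarrow> real) \<Rightarrow> real \<Rightarrow> (real \<Rightarrow> real) \<Rightarrow> bool" where
  "has_cond_density M X Z c h \<longleftrightarrow>
     (\<forall>r\<ge>0. 0 \<le> h r) \<and>
     distributed (uniform_measure M {\<omega> \<in> space M. Z \<omega> = c}) lborel X
       (\<lambda>r. ennreal (h r) * indicator {0..} r)"

end

(* On {t < nu} write, for s \<le> t, zeta_s = B_s + (s / t) zeta_t with B_s = W_s - (s / t) W_t.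
   The Brownian bridge B on [0, t] is independent of zeta_t, tau and Z together, so on {t < nu} the
   past of zeta carries no more information about nu than zeta_t alone, and the conditional
   expectation reduces to Bayes' formula for the joint law of (tau, Z, zeta_t). On {nu \<le> t} the
   value of nu is already known at time t: zeta_s lies in the finite set {sigma z_1, ..., sigma z_l}
   for nu \<le> s, whereas the law of zeta_s on {s < nu} has no atoms. *)

theory Submission
  imports Defs
begin

text \<open>The independence of bridge and information has to hold at the random time nu, while only
  the law of \<open>W\<close> at fixed times is given. For fixed \<open>r > t\<close> the variable
  \<open>(W_t - (t/r) W_r) / sqrt (t (r - t) / r)\<close> is standard normal and independent of the
  bridge on [0, t], with a law free of \<open>r\<close>. This is why a discretised random time may
  be inserted for \<open>r\<close>, and path continuity removes the discretisation. The scale and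
  the mean are put back afterwards, by an affine change of variables given tau, and this is where
  the kernel phi comes from. A second obstacle is that the Bayes quotient is controlled only for
  Lebesgue-almost every x, while zeta_t has atoms on {nu \<le> t}. All computations therefore use a
  substitute \<open>info t\<close> that agrees with zeta_t on {t < nu} almost surely and has an
  absolutely continuous law on the whole space. Finally g(nu) is merely integrable; the
  integrability of the quotient comes from comparing each term of its denominator with the whole
  denominator.\<close>

section \<open>Gaussian variables: the regression of a summand on the sum\<close>

abbreviation centred_normal :: "real \<Rightarrow> real \<Rightarrow> real" where
  "centred_normal v \<equiv> normal_density 0 (sqrt v)"

text \<open>With \<open>x = v + a / (a + b) * w\<close> and \<open>y = w - x\<close>,
  \<open>w\<close> is the sum \<open>x + y\<close> and \<open>v\<close> the residual of the linear
  regression of \<open>x\<close> on \<open>w\<close>. Residual and regressor are uncorrelated, so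
  the quadratic form in the exponent has no mixed term; \<open>a * b / (a + b)\<close> is the
  residual variance.\<close>

lemma centred_normal_bridge_factor:
  assumes "0 < a" "0 < b"
  shows "centred_normal a (v + a / (a + b) * w) * centred_normal b (w - (v + a / (a + b) * w)) =
    centred_normal (a * b / (a + b)) v * centred_normal (a + b) w"
proof -
  have e: "(v + a / (a + b) * w)\<^sup>2 / (2 * a) + (w - (v + a / (a + b) * w))\<^sup>2 / (2 * b)
    = v\<^sup>2 / (2 * (a * b / (a + b))) + w\<^sup>2 / (2 * (a + b))"
  proof -
    define s where "s = a + b"
    \<comment> \<open>Eliminating \<open>b\<close> in favour of the sum \<open>s\<close> leaves a
      polynomial identity in \<open>a\<close>, \<open>s\<close>, \<open>v\<close>,
      \<open>w\<close>.\<close>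
    have s: "s > 0" "b = s - a" using assms by (auto simp: s_def)
    have "s * (v + a / s * w) = s * v + a * w" using s by (simp add: field_simps)
    have "a * b * 2 * s * ((v + a / s * w)\<^sup>2 / (2 * a) + (w - (v + a / s * w))\<^sup>2 / (2 * b)) =
       b * s * (v + a / s * w)\<^sup>2 + a * s * (w - (v + a / s * w))\<^sup>2"
      using assms s by (simp add: field_simps)
    also have "\<dots> = (b * (s * (v + a / s * w))\<^sup>2 + a * (s * w - s * (v + a / s * w))\<^sup>2) / s"
      using s(1) by (simp add: power2_eq_square field_simps)
    also have "\<dots> = (b * (s * v + a * w)\<^sup>2 + a * (s * w - (s * v + a * w))\<^sup>2) / s"
      using \<open>s * (v + a / s * w) = s * v + a * w\<close> by simp
    also have "\<dots> = s\<^sup>2 * v\<^sup>2 + a * b * w\<^sup>2"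
    proof -
      have "b * (s * v + a * w)\<^sup>2 + a * (s * w - (s * v + a * w))\<^sup>2 = s * (s\<^sup>2 * v\<^sup>2 + a * b * w\<^sup>2)"
        unfolding s(2) by algebra
      then show ?thesis using s(1) by simp
    qed
    also have "\<dots> = a * b * 2 * s * (v\<^sup>2 / (2 * (a * b / s)) + w\<^sup>2 / (2 * s))"
      using assms s(1) by (simp add: field_simps power2_eq_square)
    finally have "(v + a / s * w)\<^sup>2 / (2 * a) + (w - (v + a / s * w))\<^sup>2 / (2 * b) = v\<^sup>2 / (2 * (a * b / s)) + w\<^sup>2 / (2 * s)"
      using assms s by simp
    then show ?thesis by (simp add: s_def)
  qed
  have c: "sqrt (2 * pi * a) * sqrt (2 * pi * b) = sqrt (2 * pi * (a * b / (a + b))) * sqrt (2 * pi * (a + b))"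
    using assms by (simp add: real_sqrt_mult[symmetric])
  have n: "centred_normal u x * centred_normal u' y = 1 / (sqrt (2 * pi * u) * sqrt (2 * pi * u')) * exp (- (x\<^sup>2 / (2 * u) + y\<^sup>2 / (2 * u')))"
    if "0 < u" "0 < u'" for u u' x y
    using that by (simp add: normal_density_def mult_exp_exp)
  show ?thesis
    using assms by (subst (1 2) n) (simp_all only: e c, simp_all)
qed

text \<open>The passage from \<open>(x, y)\<close> to \<open>(v, w)\<close> is split into two
  translations, \<open>y\<close> to \<open>w\<close> at fixed \<open>x\<close> and then
  \<open>x\<close> to \<open>v\<close> at fixed \<open>w\<close>, so that no Jacobian
  appears.\<close>

lemma nn_integral_centred_normal_bridge:
  assumes ab: "0 < a" "0 < b" and [measurable]: "h \<in> borel_measurable (lborel \<Otimes>\<^sub>M lborel)"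
  shows "(\<integral>\<^sup>+x. \<integral>\<^sup>+y. ennreal (centred_normal a x * centred_normal b y) * h (x - a / (a + b) * (x + y), x + y) \<partial>lborel \<partial>lborel) =
    (\<integral>\<^sup>+v. \<integral>\<^sup>+w. ennreal (centred_normal (a * b / (a + b)) v * centred_normal (a + b) w) * h (v, w) \<partial>lborel \<partial>lborel)"
proof -
  let ?k = "\<lambda>x w. ennreal (centred_normal a x * centred_normal b (w - x)) * h (x - a / (a + b) * w, w)"
  have "(\<integral>\<^sup>+x. \<integral>\<^sup>+y. ennreal (centred_normal a x * centred_normal b y) * h (x - a / (a + b) * (x + y), x + y) \<partial>lborel \<partial>lborel) =
     (\<integral>\<^sup>+x. \<integral>\<^sup>+w. ?k x w \<partial>lborel \<partial>lborel)"
  proof (rule nn_integral_cong)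
    fix x :: real
    show "(\<integral>\<^sup>+y. ennreal (centred_normal a x * centred_normal b y) * h (x - a / (a + b) * (x + y), x + y) \<partial>lborel) = (\<integral>\<^sup>+w. ?k x w \<partial>lborel)"
      by (subst nn_integral_real_affine[where c=1 and t="-x"]) (auto simp: add.commute)
  qed
  also have "\<dots> = (\<integral>\<^sup>+w. \<integral>\<^sup>+x. ?k x w \<partial>lborel \<partial>lborel)"
    by (intro lborel_pair.Fubini') measurable
  also have "\<dots> = (\<integral>\<^sup>+w. \<integral>\<^sup>+v. ennreal (centred_normal (a * b / (a + b)) v * centred_normal (a + b) w) * h (v, w) \<partial>lborel \<partial>lborel)"
  proof (rule nn_integral_cong)
    fix w :: real
    have "(\<integral>\<^sup>+x. ?k x w \<partial>lborel) = (\<integral>\<^sup>+v. ?k (v + a / (a + b) * w) w \<partial>lborel)"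
      by (subst nn_integral_real_affine[where c=1 and t="a / (a + b) * w"]) (auto simp: add.commute)
    then show "(\<integral>\<^sup>+x. ?k x w \<partial>lborel) = (\<integral>\<^sup>+v. ennreal (centred_normal (a * b / (a + b)) v * centred_normal (a + b) w) * h (v, w) \<partial>lborel)"
      by (simp only: centred_normal_bridge_factor[OF ab] add_diff_cancel_right')
  qed
  also have "\<dots> = (\<integral>\<^sup>+v. \<integral>\<^sup>+w. ennreal (centred_normal (a * b / (a + b)) v * centred_normal (a + b) w) * h (v, w) \<partial>lborel \<partial>lborel)"
    by (intro lborel_pair.Fubini') measurable
  finally show ?thesis .
qed

abbreviation gaussian :: "real \<Rightarrow> real measure" where
  "gaussian v \<equiv> density lborel (\<lambda>x. ennreal (centred_normal v x))"

lemma prob_space_gaussian: "0 < v \<Longrightarrow> prob_space (gaussian v)"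
  by (simp add: prob_space_normal_density)

lemma (in prob_space) prob_centred_normal_bridge:
  assumes ab: "0 < a" "0 < b"
    and X: "distributed M lborel X (centred_normal a)"
    and Y: "distributed M lborel Y (centred_normal b)"
    and ind: "indep_var borel X borel Y"
    and A: "A \<in> sets borel" and B: "B \<in> sets borel"
  shows "prob {\<omega> \<in> space M. X \<omega> - a / (a + b) * (X \<omega> + Y \<omega>) \<in> A \<and> X \<omega> + Y \<omega> \<in> B} =
    measure (gaussian (a * b / (a + b))) A * measure (gaussian (a + b)) B"
proof -
  have "indep_var lborel X lborel Y"
    using indep_var_compose[OF ind, of id lborel id lborel] by simp
  from distributed_joint_indep[OF sigma_finite_lborel sigma_finite_lborel X Y this]
  have D: "distributed M (lborel \<Otimes>\<^sub>M lborel) (\<lambda>x. (X x, Y x)) (\<lambda>(x, y). ennreal (centred_normal a x * centred_normal b y))"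
    by (simp add: ennreal_mult case_prod_beta')
  note [measurable] = distributed_measurable[OF X, simplified] distributed_measurable[OF Y, simplified] A B
  let ?g = "\<lambda>(x, y). indicator A (x - a / (a + b) * (x + y)) * indicator B (x + y) :: ennreal"
  have "emeasure M {\<omega> \<in> space M. X \<omega> - a / (a + b) * (X \<omega> + Y \<omega>) \<in> A \<and> X \<omega> + Y \<omega> \<in> B} = (\<integral>\<^sup>+\<omega>. ?g (X \<omega>, Y \<omega>) \<partial>M)"
    by (subst nn_integral_indicator[symmetric])
      (measurable, auto simp del: nn_integral_indicator intro!: nn_integral_cong split: split_indicator)
  also have "\<dots> = (\<integral>\<^sup>+p. (case p of (x, y) \<Rightarrow> ennreal (centred_normal a x * centred_normal b y)) * ?g p \<partial>(lborel \<Otimes>\<^sub>M lborel))"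
    by (intro distributed_nn_integral[OF D, symmetric]) measurable
  also have "\<dots> = (\<integral>\<^sup>+x. \<integral>\<^sup>+y. ennreal (centred_normal a x * centred_normal b y) * (indicator A (x - a / (a + b) * (x + y)) * indicator B (x + y)) \<partial>lborel \<partial>lborel)"
    by (subst lborel.nn_integral_fst[symmetric]) auto
  also have "\<dots> = (\<integral>\<^sup>+v. \<integral>\<^sup>+w. ennreal (centred_normal (a * b / (a + b)) v * centred_normal (a + b) w) * (indicator A v * indicator B w) \<partial>lborel \<partial>lborel)"
    using nn_integral_centred_normal_bridge[OF ab, of "\<lambda>(v, w). indicator A v * indicator B w"] by simp
  also have "\<dots> = (\<integral>\<^sup>+v. ennreal (centred_normal (a * b / (a + b)) v) * indicator A v * (\<integral>\<^sup>+w. ennreal (centred_normal (a + b) w) * indicator B w \<partial>lborel) \<partial>lborel)"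
    by (subst nn_integral_cmult[symmetric]) (auto simp: ennreal_mult ac_simps intro!: nn_integral_cong)
  also have "\<dots> = emeasure (gaussian (a * b / (a + b))) A * emeasure (gaussian (a + b)) B"
    by (subst nn_integral_multc) (auto simp: emeasure_density)
  finally show ?thesis
    by (simp add: measure_def enn2real_mult)
qed

lemma distributed_gaussianI:
  assumes "0 < v" and [measurable]: "X \<in> borel_measurable M" "prob_space M"
    and "\<And>A. A \<in> sets borel \<Longrightarrow> measure M {\<omega> \<in> space M. X \<omega> \<in> A} = measure (gaussian v) A"
  shows "distributed M lborel X (centred_normal v)"
proof -
  interpret prob_space M by fact
  interpret g: prob_space "gaussian v" using assms by (intro prob_space_gaussian)
  have "distr M lborel X = gaussian v"
    using assms(4)
    by (intro measure_eqI) (auto simp: emeasure_distr emeasure_eq_measure g.emeasure_eq_measure vimage_def Int_def conj_commute)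
  then show ?thesis unfolding distributed_def by simp
qed

lemma distributed_gaussianD:
  assumes "distributed M lborel X (centred_normal v)" "A \<in> sets borel"
  shows "measure M {\<omega> \<in> space M. X \<omega> \<in> A} = measure (gaussian v) A"
proof -
  have "gaussian v = distr M lborel X" using assms unfolding distributed_def by simp
  then show ?thesis using assms distributed_measurable[OF assms(1)]
    by (simp add: measure_distr vimage_def Int_def conj_commute)
qed

text \<open>Under the conditional probability given \<open>E\<close> the hypothesis
  \<open>XY\<close> says exactly that \<open>X\<close> and \<open>Y\<close> are independent
  Gaussians, so the unconditional result applies there. In the induction below \<open>E\<close>
  collects the constraints on the earlier increments.\<close>

lemma (in prob_space) prob_Int_centred_normal_bridge:
  assumes ab: "0 < a" "0 < b" and E: "E \<in> events"
    and [measurable]: "X \<in> borel_measurable M" "Y \<in> borel_measurable M"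
    and XY: "\<And>A B. A \<in> sets borel \<Longrightarrow> B \<in> sets borel \<Longrightarrow>
      prob {\<omega> \<in> E. X \<omega> \<in> A \<and> Y \<omega> \<in> B} = prob E * measure (gaussian a) A * measure (gaussian b) B"
    and A: "A \<in> sets borel" and B: "B \<in> sets borel"
  shows "prob {\<omega> \<in> E. X \<omega> - a / (a + b) * (X \<omega> + Y \<omega>) \<in> A \<and> X \<omega> + Y \<omega> \<in> B} =
    prob E * measure (gaussian (a * b / (a + b))) A * measure (gaussian (a + b)) B"
proof (cases "prob E = 0")
  case True
  have "prob {\<omega> \<in> E. X \<omega> - a / (a + b) * (X \<omega> + Y \<omega>) \<in> A \<and> X \<omega> + Y \<omega> \<in> B} \<le> prob E"
    using E by (intro finite_measure_mono) auto
  with True show ?thesis by (simp add: measure_le_0_iff)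
next
  case False
  let ?Q = "uniform_measure M E"
  have E0: "emeasure M E \<noteq> 0" using False by (simp add: emeasure_eq_measure)
  interpret Q: prob_space ?Q
    using E0 by (intro prob_space_uniform_measure) auto
  interpret ga: prob_space "gaussian a" using ab by (intro prob_space_gaussian)
  interpret gb: prob_space "gaussian b" using ab by (intro prob_space_gaussian)
  have Q: "Q.prob {\<omega> \<in> space ?Q. P \<omega>} = prob {\<omega> \<in> E. P \<omega>} / prob E" if "Measurable.pred M P" for P
  proof -
    have "E \<inter> {\<omega> \<in> space M. P \<omega>} = {\<omega> \<in> E. P \<omega>}" using sets.sets_into_space[OF E] by auto
    then show ?thesis using that E0 E by (subst measure_uniform_measure) auto
  qed
  have g1: "measure (gaussian a) UNIV = 1" "measure (gaussian b) UNIV = 1"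
    using ga.prob_space gb.prob_space by auto
  have [measurable]: "X \<in> borel_measurable ?Q" "Y \<in> borel_measurable ?Q" by simp_all
  have dX: "distributed ?Q lborel X (centred_normal a)"
  proof (rule distributed_gaussianI)
    fix A :: "real set" assume [measurable]: "A \<in> sets borel"
    show "Q.prob {\<omega> \<in> space ?Q. X \<omega> \<in> A} = measure (gaussian a) A"
      using XY[of A UNIV] False g1 by (subst Q) auto
  qed (use ab Q.prob_space_axioms in auto)
  have dY: "distributed ?Q lborel Y (centred_normal b)"
  proof (rule distributed_gaussianI)
    fix B :: "real set" assume [measurable]: "B \<in> sets borel"
    show "Q.prob {\<omega> \<in> space ?Q. Y \<omega> \<in> B} = measure (gaussian b) B"
      using XY[of UNIV B] False g1 by (subst Q) auto
  qed (use ab Q.prob_space_axioms in auto)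
  have "Q.indep_var borel X borel Y"
    unfolding Q.indep_var_eq
  proof (intro conjI Q.indep_set_sigma_sets Q.indep_setI)
    fix U V assume "U \<in> {X -` A \<inter> space ?Q |A. A \<in> sets borel}" "V \<in> {Y -` A \<inter> space ?Q |A. A \<in> sets borel}"
    then obtain A B where [measurable]: "A \<in> sets borel" "B \<in> sets borel"
      and UV: "U = {\<omega> \<in> space ?Q. X \<omega> \<in> A}" "V = {\<omega> \<in> space ?Q. Y \<omega> \<in> B}" by auto
    have "U \<inter> V = {\<omega> \<in> space ?Q. X \<omega> \<in> A \<and> Y \<omega> \<in> B}" using UV by auto
    then have "Q.prob (U \<inter> V) = measure (gaussian a) A * measure (gaussian b) B"
      using XY[of A B] False by (subst \<open>U \<inter> V = _\<close>, subst Q) auto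
    then show "Q.prob (U \<inter> V) = Q.prob U * Q.prob V"
      using distributed_gaussianD[OF dX] distributed_gaussianD[OF dY] UV by simp
  qed (auto simp: Int_stable_def; (metis Int_assoc Int_left_commute inf.idem sets.Int vimage_Int))+
  from Q.prob_centred_normal_bridge[OF ab dX dY this A B]
  show ?thesis using False A B by (subst (asm) Q) (auto simp: field_simps)
qed

section \<open>Brownian bridges\<close>

text \<open>Up to the factors \<open>v k\<close>, the variables \<open>D k\<close> are the increments of the walk \<open>S\<close>
  after time inversion, which are again independent.\<close>

lemma (in prob_space) prob_normal_bridge_increments:
  fixes X :: "nat \<Rightarrow> 'a \<Rightarrow> real" and d :: "nat \<Rightarrow> real"
  defines "S \<equiv> \<lambda>k \<omega>. \<Sum>j\<le>k. X j \<omega>" and "v \<equiv> \<lambda>k. \<Sum>j\<le>k. d j"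
  defines "D \<equiv> \<lambda>k \<omega>. S k \<omega> - v k / v (Suc k) * S (Suc k) \<omega>"
  assumes "indep_vars (\<lambda>_. borel) X {..n}" and "\<And>k. k \<le> n \<Longrightarrow> 0 < d k"
    and "\<And>k. k \<le> n \<Longrightarrow> distributed M lborel (X k) (centred_normal (d k))"
    and "\<And>k. A k \<in> sets borel" and "B \<in> sets borel"
  shows "prob {\<omega> \<in> space M. (\<forall>k<n. D k \<omega> \<in> A k) \<and> S n \<omega> \<in> B} =
    (\<Prod>k<n. measure (gaussian (v k * d (Suc k) / v (Suc k))) (A k)) * measure (gaussian (v n)) B"
  using assms(4-)
proof (induction n arbitrary: B)
  case 0
  then show ?case
    using distributed_gaussianD[of M "X 0" "d 0" B] by (simp add: S_def v_def)
next
  case (Suc n)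
  have ind: "indep_vars (\<lambda>_. borel) X {..n}"
    using Suc.prems(1) by (rule indep_vars_subset) auto
  have v: "0 < v n" unfolding v_def using Suc.prems(2) by (intro sum_pos) auto
  have d: "0 < d (Suc n)" using Suc.prems(2) by simp
  have vS: "v (Suc n) = v n + d (Suc n)" by (simp add: v_def)
  have SS: "S (Suc n) \<omega> = S n \<omega> + X (Suc n) \<omega>" for \<omega> by (simp add: S_def)
  have [measurable]: "A k \<in> sets borel" "B \<in> sets borel" for k using Suc.prems by auto
  have X[measurable]: "X k \<in> borel_measurable M" if "k \<le> Suc n" for k
    using distributed_measurable[OF Suc.prems(3)[OF that]] by simp
  have S[measurable]: "S k \<in> borel_measurable M" if "k \<le> Suc n" for k
    unfolding S_def using that by (intro borel_measurable_sum X) auto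
  have D: "D k \<in> borel_measurable M" if "k \<le> n" for k
    unfolding D_def using that by (intro borel_measurable_diff borel_measurable_times S) auto
  define E where "E = {\<omega> \<in> space M. \<forall>k<n. D k \<omega> \<in> A k}"
  have Dn: "{\<omega> \<in> space M. D k \<omega> \<in> A k} \<in> events" if "k < n" for k
    using measurable_sets_Collect[OF D[of k], of "\<lambda>x. x \<in> A k"] that by simp
  have E[measurable]: "E \<in> events"
  proof -
    \<comment> \<open>For \<open>n = 0\<close> the intersection over an empty index set is
      \<open>UNIV\<close>, which need not be an event; hence the separate case and the intersection
      with \<open>space M\<close>.\<close>
    have "E = (\<Inter>k\<in>{..<n}. {\<omega> \<in> space M. D k \<omega> \<in> A k}) \<inter> space M" unfolding E_def by auto
    then show ?thesis
      by (cases "n = 0") (auto intro!: sets.Int sets.finite_INT Dn)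
  qed
  interpret gn: prob_space "gaussian (v n)" using v by (intro prob_space_gaussian)
  have IH: "prob {\<omega> \<in> E. S n \<omega> \<in> B'} = (\<Prod>k<n. measure (gaussian (v k * d (Suc k) / v (Suc k))) (A k)) * measure (gaussian (v n)) B'"
    if "B' \<in> sets borel" for B'
    using Suc.IH[OF ind _ _ Suc.prems(4) that] Suc.prems(2,3) by (simp add: E_def conj_assoc)
  have pE: "prob E = (\<Prod>k<n. measure (gaussian (v k * d (Suc k) / v (Suc k))) (A k))"
    using IH[of UNIV] gn.prob_space by simp
  \<comment> \<open>\<open>E\<close> and \<open>S n\<close> depend on \<open>X 0, ..., X n\<close>
    only. To use the independence of \<open>X (Suc n)\<close> from this block, the event is
    rewritten as a set \<open>F\<close> of coordinate vectors, with \<open>S'\<close> and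
    \<open>D'\<close> the coordinate versions of \<open>S\<close> and \<open>D\<close>.\<close>
  have XY: "prob {\<omega> \<in> E. S n \<omega> \<in> A' \<and> X (Suc n) \<omega> \<in> B'} =
      prob E * measure (gaussian (v n)) A' * measure (gaussian (d (Suc n))) B'"
    if [measurable]: "A' \<in> sets borel" "B' \<in> sets borel" for A' B'
  proof -
    define S' where "S' = (\<lambda>k (x :: nat \<Rightarrow> real). \<Sum>j\<le>k. x j)"
    define D' where "D' = (\<lambda>k x. S' k x - v k / v (Suc k) * S' (Suc k) x)"
    have S'[measurable]: "S' k \<in> borel_measurable (PiM {..n} (\<lambda>_. borel))" if "k \<le> n" for k
      unfolding S'_def using that by (intro borel_measurable_sum) auto
    have D'[measurable]: "D' k \<in> borel_measurable (PiM {..n} (\<lambda>_. borel))" if "k < n" for k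
      unfolding D'_def using that by (intro borel_measurable_diff borel_measurable_times S') auto
    define F where "F = {x \<in> space (PiM {..n} (\<lambda>_. borel :: real measure)). (\<forall>k<n. D' k x \<in> A k) \<and> S' n x \<in> A'}"
    have F[measurable]: "F \<in> sets (PiM {..n} (\<lambda>_. borel))"
    proof -
      have "F = (\<Inter>k\<in>{..<n}. D' k -` A k \<inter> space (PiM {..n} (\<lambda>_. borel))) \<inter> (S' n -` A' \<inter> space (PiM {..n} (\<lambda>_. borel)))" (is "_ = ?I \<inter> ?J")
        unfolding F_def by auto
      moreover have "?J \<in> sets (PiM {..n} (\<lambda>_. borel))" by (rule measurable_sets[OF S']) auto
      moreover have "?I \<inter> ?J \<in> sets (PiM {..n} (\<lambda>_. borel))" if "?J \<in> sets (PiM {..n} (\<lambda>_. borel))"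
        using that by (cases "n = 0") (auto intro!: sets.Int sets.finite_INT measurable_sets[OF D'])
      ultimately show ?thesis by simp
    qed
    have G: "{x \<in> space (PiM {Suc n} (\<lambda>_. borel)). x (Suc n) \<in> B'} \<in> sets (PiM {Suc n} (\<lambda>_. borel :: real measure))" (is "?G \<in> _")
      by measurable
    have SX: "S' k (restrict (\<lambda>i. X i \<omega>) {..n}) = S k \<omega>" if "k \<le> n" for k \<omega>
      unfolding S'_def S_def using that by (intro sum.cong) auto
    have DX: "D' k (restrict (\<lambda>i. X i \<omega>) {..n}) = D k \<omega>" if "k < n" for k \<omega>
      unfolding D'_def D_def using that by (simp add: SX)
    have rs: "(restrict (\<lambda>i. X i \<omega>) K) \<in> space (PiM K (\<lambda>_. borel))" for K \<omega>
      by (auto simp: space_PiM)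
    have "prob ((\<lambda>x. (restrict (\<lambda>i. X i x) {..n}, restrict (\<lambda>i. X i x) {Suc n})) -` (F \<times> ?G) \<inter> space M) =
        prob ((\<lambda>x. restrict (\<lambda>i. X i x) {..n}) -` F \<inter> space M) * prob ((\<lambda>x. restrict (\<lambda>i. X i x) {Suc n}) -` ?G \<inter> space M)"
      by (intro indep_varD[OF indep_var_restrict[OF Suc.prems(1)] F G]) auto
    also have "(\<lambda>x. (restrict (\<lambda>i. X i x) {..n}, restrict (\<lambda>i. X i x) {Suc n})) -` (F \<times> ?G) \<inter> space M = {\<omega> \<in> E. S n \<omega> \<in> A' \<and> X (Suc n) \<omega> \<in> B'}"
      using rs by (auto simp: F_def E_def SX DX)
    also have "(\<lambda>x. restrict (\<lambda>i. X i x) {..n}) -` F \<inter> space M = {\<omega> \<in> E. S n \<omega> \<in> A'}"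
      using rs by (auto simp: F_def E_def SX DX)
    also have "(\<lambda>x. restrict (\<lambda>i. X i x) {Suc n}) -` ?G \<inter> space M = {\<omega> \<in> space M. X (Suc n) \<omega> \<in> B'}"
      using rs by auto
    finally show ?thesis
      using IH[of A'] pE distributed_gaussianD[OF Suc.prems(3)[of "Suc n"], of B'] by simp
  qed
  \<comment> \<open>Regressing \<open>S n\<close> on \<open>S (Suc n) = S n + X (Suc n)\<close>
    splits off \<open>D n\<close> as the residual and leaves \<open>S (Suc n)\<close> as the new
    independent endpoint.\<close>
  have "prob {\<omega> \<in> E. S n \<omega> - v n / (v n + d (Suc n)) * (S n \<omega> + X (Suc n) \<omega>) \<in> A n \<and> S n \<omega> + X (Suc n) \<omega> \<in> B} =
    prob E * measure (gaussian (v n * d (Suc n) / (v n + d (Suc n)))) (A n) * measure (gaussian (v n + d (Suc n))) B"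
    by (intro prob_Int_centred_normal_bridge v d XY) auto
  also have "{\<omega> \<in> E. S n \<omega> - v n / (v n + d (Suc n)) * (S n \<omega> + X (Suc n) \<omega>) \<in> A n \<and> S n \<omega> + X (Suc n) \<omega> \<in> B} =
      {\<omega> \<in> space M. (\<forall>k<Suc n. D k \<omega> \<in> A k) \<and> S (Suc n) \<omega> \<in> B}"
    unfolding E_def by (auto simp: less_Suc_eq D_def SS vS)
  finally show ?case by (simp add: pE vS)
qed

text \<open>Choosing the whole space in every coordinate but one turns the product formula into the
  marginal laws; the product formula then is the definition of independence.\<close>

lemma (in prob_space) indep_vars_of_product_law:
  fixes D :: "'i \<Rightarrow> 'a \<Rightarrow> 'b"
  assumes I: "finite I" and D: "\<And>k. k \<in> I \<Longrightarrow> D k \<in> measurable M (N k)"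
    and \<mu>: "\<And>k. k \<in> I \<Longrightarrow> prob_space (\<mu> k)" "\<And>k. k \<in> I \<Longrightarrow> sets (\<mu> k) = sets (N k)"
    and law: "\<And>A. (\<And>k. k \<in> I \<Longrightarrow> A k \<in> sets (N k)) \<Longrightarrow>
      prob {\<omega> \<in> space M. \<forall>k\<in>I. D k \<omega> \<in> A k} = (\<Prod>k\<in>I. measure (\<mu> k) (A k))"
  shows "indep_vars N D I"
    and "\<And>k A. k \<in> I \<Longrightarrow> A \<in> sets (N k) \<Longrightarrow> prob {\<omega> \<in> space M. D k \<omega> \<in> A} = measure (\<mu> k) A"
proof -
  have m1: "measure (\<mu> k) (space (N k)) = 1" if "k \<in> I" for k
    using prob_space.prob_space[OF \<mu>(1)[OF that]] sets_eq_imp_space_eq[OF \<mu>(2)[OF that]] by simp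
  show marg: "prob {\<omega> \<in> space M. D k \<omega> \<in> A} = measure (\<mu> k) A" if "k \<in> I" "A \<in> sets (N k)" for k A
  proof -
    have "{\<omega> \<in> space M. D k \<omega> \<in> A} = {\<omega> \<in> space M. \<forall>j\<in>I. D j \<omega> \<in> (if j = k then A else space (N j))}"
      using that(1) measurable_space[OF D] by fastforce
    also have "prob \<dots> = (\<Prod>j\<in>I. measure (\<mu> j) (if j = k then A else space (N j)))"
      using that by (intro law) auto
    also have "\<dots> = (\<Prod>j\<in>I. if j = k then measure (\<mu> k) A else 1)"
      by (intro prod.cong) (auto simp: m1)
    also have "\<dots> = measure (\<mu> k) A"
      using I that by simp
    finally show ?thesis .
  qed
  show "indep_vars N D I"
  proof (cases "I = {}")
    case True then show ?thesis by (simp add: indep_vars_def indep_sets_def)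
  next
    case False
    show ?thesis
    proof (subst indep_vars_finite[where E = "\<lambda>k. sets (N k)"])
      show "\<forall>A\<in>Pi I (\<lambda>k. sets (N k)). prob (\<Inter>j\<in>I. D j -` A j \<inter> space M) = (\<Prod>j\<in>I. prob (D j -` A j \<inter> space M))"
      proof
        fix A assume A: "A \<in> Pi I (\<lambda>k. sets (N k))"
        have "(\<Inter>j\<in>I. D j -` A j \<inter> space M) = {\<omega> \<in> space M. \<forall>k\<in>I. D k \<omega> \<in> A k}" using False by auto
        moreover have "D j -` A j \<inter> space M = {\<omega> \<in> space M. D j \<omega> \<in> A j}" for j by auto
        ultimately show "prob (\<Inter>j\<in>I. D j -` A j \<inter> space M) = (\<Prod>j\<in>I. prob (D j -` A j \<inter> space M))"
          using law[of A] marg[of _ "A _"] A by (auto intro!: prod.cong simp: Pi_iff)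
      qed
    qed (use I False D in \<open>auto simp: sets.sigma_sets_eq sets.Int_stable dest: sets.sets_into_space[THEN subsetD]\<close>)
  qed
qed

text \<open>\<open>std_brownian_motion\<close> speaks of increments along strictly increasing grids,
  so an arbitrary finite set of times has to be embedded in such a grid through 0, \<open>t\<close>
  and \<open>r\<close>.\<close>

lemma strictly_increasing_grid_exists:
  fixes t r :: real
  assumes "finite J" "J \<subseteq> {0..t}" "0 < t" "t < r"
  obtains s :: "nat \<Rightarrow> real" and q where "s 0 = 0" "s (Suc q) = t" "s (Suc (Suc q)) = r"
    "\<And>k. k \<le> Suc q \<Longrightarrow> s k < s (Suc k)" "J \<subseteq> s ` {..Suc q}"
proof -
  \<comment> \<open>The possible members 0 and \<open>t\<close> of \<open>J\<close> are left out
    here, since both are placed in the list anyway and must not occur twice.\<close>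
  define xs where "xs = sorted_list_of_set (J \<inter> {0<..<t})"
  have xs: "set xs = J \<inter> {0<..<t}" "sorted_wrt (<) xs" using assms by (auto simp: xs_def)
  define L where "L = 0 # xs @ [t, r]"
  have L: "sorted_wrt (<) L" unfolding L_def using xs assms by (auto simp: sorted_wrt_append)
  have len: "length L = length xs + 3" by (simp add: L_def)
  show ?thesis
  proof (rule that[of "\<lambda>k. L ! k" "length xs"])
    show "L ! k < L ! Suc k" if "k \<le> Suc (length xs)" for k
      using L that len by (auto simp: sorted_wrt_iff_nth_less)
    show "J \<subseteq> (!) L ` {..Suc (length xs)}"
    proof
      fix x assume "x \<in> J"
      then have "x = 0 \<or> x = t \<or> x \<in> set xs" using assms xs by force
      then consider "x = 0" | "x = t" | k where "k < length xs" "x = xs ! k" by (auto simp: in_set_conv_nth)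
      then show "x \<in> (!) L ` {..Suc (length xs)}"
      proof cases
        case 1 then show ?thesis by (intro image_eqI[of _ _ 0]) (auto simp: L_def)
      next
        case 2 then show ?thesis by (intro image_eqI[of _ _ "Suc (length xs)"]) (auto simp: L_def nth_append)
      next
        case 3 then show ?thesis by (intro image_eqI[of _ _ "Suc k"]) (auto simp: L_def nth_append)
      qed
    qed
  qed (auto simp: L_def nth_append)
qed

text \<open>Along a grid, the variables \<open>V u - u / u' * V u'\<close> for neighbouring times
  \<open>u < u'\<close> are independent. Those with \<open>u' \<le> t\<close> determine the bridge
  on [0, \<open>t\<close>] at the grid points, and the one for the last pair \<open>t\<close>,
  \<open>r\<close> is the second variable of the statement.\<close>

lemma (in prob_space) prob_brownian_bridge_Int:
  fixes W :: "real \<Rightarrow> 'a \<Rightarrow> real"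
  defines "V \<equiv> \<lambda>s \<omega>. W s \<omega> - W 0 \<omega>"
  assumes bm: "std_brownian_motion M W"
    and J: "finite J" "J \<subseteq> {0..t}" and t: "0 < t" "t < r"
    and A: "\<And>s. A s \<in> sets borel" and B: "B \<in> sets borel"
  shows "prob {\<omega> \<in> space M. (\<forall>s\<in>J. V s \<omega> - s / t * V t \<omega> \<in> A s) \<and> V t \<omega> - t / r * V r \<omega> \<in> B} =
    prob {\<omega> \<in> space M. \<forall>s\<in>J. V s \<omega> - s / t * V t \<omega> \<in> A s} * measure (gaussian (t * (r - t) / r)) B"
proof -
  obtain s q where s: "s 0 = 0" "s (Suc q) = t" "s (Suc (Suc q)) = r"
    and smono: "\<And>k. k \<le> Suc q \<Longrightarrow> s k < s (Suc k)" and Js: "J \<subseteq> s ` {..Suc q}"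
    using strictly_increasing_grid_exists[OF J t] by metis
  have s_pos: "0 < s (Suc k)" if "k \<le> Suc q" for k
    using that
  proof (induction k)
    case 0 then show ?case using smono[of 0] s by simp
  next
    case (Suc k) then show ?case using smono[of "Suc k"] by simp
  qed
  have s_ge0: "0 \<le> s k" if "k \<le> Suc (Suc q)" for k
    using s_pos[of "k - 1"] s(1) that by (cases k) auto
  define X where "X = (\<lambda>k \<omega>. W (s (Suc k)) \<omega> - W (s k) \<omega>)"
  define d where "d = (\<lambda>k. s (Suc k) - s k)"
  \<comment> \<open>The sums include their upper index, so index \<open>k\<close> belongs to the
    time \<open>s (Suc k)\<close>. Subtracting \<open>W 0\<close> in \<open>V\<close> makes the
    telescoped sum exact at every point.\<close>
  have S: "(\<Sum>j\<le>k. X j \<omega>) = V (s (Suc k)) \<omega>" for k \<omega>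
    by (induction k) (auto simp: X_def V_def s)
  have v: "(\<Sum>j\<le>k. d j) = s (Suc k)" for k
    by (induction k) (auto simp: d_def s)
  have "indep_vars (\<lambda>_. borel) (\<lambda>k \<omega>. W (s (Suc k)) \<omega> - W (s k) \<omega>) {..<Suc (Suc q)}"
    using bm s smono unfolding std_brownian_motion_def by auto
  then have ind: "indep_vars (\<lambda>_. borel) X {..Suc q}"
    by (simp add: X_def lessThan_Suc_atMost)
  have dist: "distributed M lborel (X k) (centred_normal (d k))" if "k \<le> Suc q" for k
    using bm smono[OF that] s_ge0[of k] that unfolding std_brownian_motion_def X_def d_def by auto
  have W[measurable]: "W u \<in> borel_measurable M" if "0 \<le> u" for u
    using bm that unfolding std_brownian_motion_def by auto
  have V[measurable]: "V u \<in> borel_measurable M" if "0 \<le> u" for u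
    unfolding V_def using that by (intro borel_measurable_diff W) auto
  define D where "D = (\<lambda>k \<omega>. V (s (Suc k)) \<omega> - s (Suc k) / s (Suc (Suc k)) * V (s (Suc (Suc k))) \<omega>)"
  define \<mu> where "\<mu> = (\<lambda>k. gaussian (s (Suc k) * d (Suc k) / s (Suc (Suc k))))"
  have D: "D k \<in> borel_measurable M" if "k \<le> q" for k
    unfolding D_def using that s_ge0[of "Suc k"] s_ge0[of "Suc (Suc k)"] by (intro borel_measurable_diff borel_measurable_times V) auto
  have law: "prob {\<omega> \<in> space M. \<forall>k\<in>{..q}. D k \<omega> \<in> C k} = (\<Prod>k\<in>{..q}. measure (\<mu> k) (C k))"
    if C: "\<And>k. k \<in> {..q} \<Longrightarrow> C k \<in> sets borel" for C
  proof -
    \<comment> \<open>The increment lemma asks for Borel sets at all indices; the value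
      \<open>{}\<close> beyond \<open>q\<close> is a filler.\<close>
    define C' where "C' = (\<lambda>k. if k \<le> q then C k else {})"
    have "0 < s (Suc (Suc q))" using s t by simp
    then interpret g: prob_space "gaussian (s (Suc (Suc q)))" by (rule prob_space_gaussian)
    have "prob {\<omega> \<in> space M. (\<forall>k<Suc q. D k \<omega> \<in> C' k) \<and> V (s (Suc (Suc q))) \<omega> \<in> UNIV} =
      (\<Prod>k<Suc q. measure (\<mu> k) (C' k)) * measure (gaussian (s (Suc (Suc q)))) UNIV"
      using prob_normal_bridge_increments[OF ind _ dist, of C' UNIV] C smono
      unfolding S v D_def \<mu>_def by (auto simp: d_def C'_def)
    also have "\<dots> = (\<Prod>k\<in>{..q}. measure (\<mu> k) (C k))"
      using g.prob_space by (simp add: C'_def lessThan_Suc_atMost)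
    finally show ?thesis by (simp add: C'_def less_Suc_eq_le Ball_def)
  qed
  have \<mu>: "prob_space (\<mu> k)" if "k \<in> {..q}" for k
    unfolding \<mu>_def d_def using that smono[of "Suc k"] s_pos[of k] s_pos[of "Suc k"] by (intro prob_space_gaussian) auto
  have indD: "indep_vars (\<lambda>_. borel) D {..q}"
    and Dq: "prob {\<omega> \<in> space M. D q \<omega> \<in> B} = measure (\<mu> q) B"
    using indep_vars_of_product_law[of "{..q}" D "\<lambda>_. borel" \<mu>] D \<mu> law B by (auto simp: \<mu>_def)
  \<comment> \<open>Division by \<open>s (Suc k)\<close> turns \<open>D k\<close> into a difference
    of consecutive values of \<open>V u / u\<close>, so the sum telescopes to
    \<open>V (s j) / s j - V t / t\<close>. For \<open>j = 0\<close> the factor \<open>s j\<close>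
    vanishes, which makes the truncated \<open>j - 1\<close> harmless.\<close>
  define b where "b = (\<lambda>j (x :: nat \<Rightarrow> real). s j * (\<Sum>k\<in>{j - 1..<q}. x k / s (Suc k)))"
  have b: "b j \<in> borel_measurable (PiM {..<q} (\<lambda>_. borel))" for j
    unfolding b_def by (intro borel_measurable_times borel_measurable_sum) auto
  have bD: "V (s j) \<omega> - s j / t * V t \<omega> = b j (restrict (\<lambda>k. D k \<omega>) {..<q})" if j: "j \<le> Suc q" for j \<omega>
  proof (cases j)
    case 0 then show ?thesis by (simp add: s b_def V_def)
  next
    case (Suc i)
    have "(\<Sum>k\<in>{i..<q}. D k \<omega> / s (Suc k)) = (\<Sum>k\<in>{i..<q}. V (s (Suc k)) \<omega> / s (Suc k) - V (s (Suc (Suc k))) \<omega> / s (Suc (Suc k)))"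
    proof (intro sum.cong refl)
      fix k assume "k \<in> {i..<q}"
      then have "0 < s (Suc k)" using s_pos[of k] by auto
      then show "D k \<omega> / s (Suc k) = V (s (Suc k)) \<omega> / s (Suc k) - V (s (Suc (Suc k))) \<omega> / s (Suc (Suc k))"
        by (simp add: D_def diff_divide_distrib)
    qed
    also have "\<dots> = V (s (Suc i)) \<omega> / s (Suc i) - V (s (Suc q)) \<omega> / s (Suc q)"
      using sum_Suc_diff'[of i q "\<lambda>k. - (V (s (Suc k)) \<omega> / s (Suc k))"] j Suc by simp
    finally have "(\<Sum>k\<in>{i..<q}. D k \<omega> / s (Suc k)) = V (s (Suc i)) \<omega> / s (Suc i) - V t \<omega> / t" by (simp add: s)
    moreover have "b j (restrict (\<lambda>k. D k \<omega>) {..<q}) = s j * (\<Sum>k\<in>{i..<q}. D k \<omega> / s (Suc k))"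
      unfolding b_def Suc by (intro arg_cong2[where f="(*)"] sum.cong) auto
    moreover have "0 < s (Suc i)" using s_pos[of i] j Suc by auto
    ultimately show ?thesis using Suc t by (simp add: field_simps)
  qed
  define F where "F = {x \<in> space (PiM {..<q} (\<lambda>_. borel :: real measure)). \<forall>j\<in>{j. j \<le> Suc q \<and> s j \<in> J}. b j x \<in> A (s j)}"
  have F: "F \<in> sets (PiM {..<q} (\<lambda>_. borel))"
    unfolding F_def by (intro sets.sets_Collect_finite_All measurable_sets_Collect[OF b]) (auto simp: A)
  have G: "{x \<in> space (PiM {q} (\<lambda>_. borel)). x q \<in> B} \<in> sets (PiM {q} (\<lambda>_. borel :: real measure))" (is "?G \<in> _")
    using B by measurable
  have rs: "(restrict (\<lambda>k. D k \<omega>) K) \<in> space (PiM K (\<lambda>_. borel))" for K \<omega>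
    by (auto simp: space_PiM)
  have F_iff: "restrict (\<lambda>k. D k \<omega>) {..<q} \<in> F \<longleftrightarrow> (\<forall>u\<in>J. V u \<omega> - u / t * V t \<omega> \<in> A u)" for \<omega>
    unfolding F_def using rs Js by (force simp: bD[symmetric])
  have Dq_eq: "D q \<omega> = V t \<omega> - t / r * V r \<omega>" for \<omega> by (simp add: D_def s)
  have \<mu>q: "\<mu> q = gaussian (t * (r - t) / r)" by (simp add: \<mu>_def d_def s)
  have "prob ((\<lambda>x. (restrict (\<lambda>i. D i x) {..<q}, restrict (\<lambda>i. D i x) {q})) -` (F \<times> ?G) \<inter> space M) =
      prob ((\<lambda>x. restrict (\<lambda>i. D i x) {..<q}) -` F \<inter> space M) * prob ((\<lambda>x. restrict (\<lambda>i. D i x) {q}) -` ?G \<inter> space M)"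
    by (intro indep_varD[OF indep_var_restrict[OF indD] F G]) auto
  also have "(\<lambda>x. (restrict (\<lambda>i. D i x) {..<q}, restrict (\<lambda>i. D i x) {q})) -` (F \<times> ?G) \<inter> space M =
      {\<omega> \<in> space M. (\<forall>s\<in>J. V s \<omega> - s / t * V t \<omega> \<in> A s) \<and> V t \<omega> - t / r * V r \<omega> \<in> B}"
    using rs by (auto simp: F_iff Dq_eq)
  also have "(\<lambda>x. restrict (\<lambda>i. D i x) {..<q}) -` F \<inter> space M = {\<omega> \<in> space M. \<forall>s\<in>J. V s \<omega> - s / t * V t \<omega> \<in> A s}"
    by (auto simp: F_iff)
  also have "(\<lambda>x. restrict (\<lambda>i. D i x) {q}) -` ?G \<inter> space M = {\<omega> \<in> space M. D q \<omega> \<in> B}"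
    using rs by auto
  finally show ?thesis by (simp add: Dq \<mu>q)
qed

text \<open>The preimages under \<open>f\<close> and \<open>g\<close> differ only inside a null set,
  and completeness makes every subset of a null set measurable.\<close>

lemma (in complete_measure) measurable_cong_AE_complete:
  assumes f: "f \<in> measurable M N" and ae: "AE x in M. f x = g x" and g: "\<And>x. x \<in> space M \<Longrightarrow> g x \<in> space N"
  shows "g \<in> measurable M N"
proof (rule measurableI)
  fix A assume A: "A \<in> sets N"
  obtain K where K: "{x \<in> space M. f x \<noteq> g x} \<subseteq> K" "K \<in> null_sets M"
    using ae unfolding eventually_ae_filter by auto
  have 1: "f -` A \<inter> space M \<in> sets M" using f A by (rule measurable_sets)
  have 2: "g -` A \<inter> space M \<inter> K \<in> sets M" using K(2) by (rule complete[rotated]) auto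
  have "(f -` A \<inter> space M - K) \<union> (g -` A \<inter> space M \<inter> K) \<in> sets M" using 1 2 K(2) by auto
  also have "(f -` A \<inter> space M - K) \<union> (g -` A \<inter> space M \<inter> K) = g -` A \<inter> space M" using K(1) by auto
  finally show "g -` A \<inter> space M \<in> sets M" .
qed (rule g)

section \<open>Brownian motion at random times\<close>

text \<open>Random times are approximated from above, so that the approximations of a time later than
  \<open>t\<close> are also later than \<open>t\<close>.\<close>

definition upper_approx :: "nat \<Rightarrow> real \<Rightarrow> real" where
  "upper_approx n x = of_int \<lceil>x * real (Suc n)\<rceil> / real (Suc n)"

lemma upper_approx_bounds: "x \<le> upper_approx n x" "upper_approx n x \<le> x + 1 / real (Suc n)"
proof -
  have "x * real (Suc n) \<le> of_int \<lceil>x * real (Suc n)\<rceil>" by simp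
  then show "x \<le> upper_approx n x" unfolding upper_approx_def by (simp add: pos_le_divide_eq del: of_nat_Suc)
  have "of_int \<lceil>x * real (Suc n)\<rceil> \<le> x * real (Suc n) + 1" by linarith
  then have "upper_approx n x \<le> (x * real (Suc n) + 1) / real (Suc n)"
    unfolding upper_approx_def by (intro divide_right_mono) auto
  also have "\<dots> = x + 1 / real (Suc n)" by (simp add: add_divide_distrib del: of_nat_Suc)
  finally show "upper_approx n x \<le> x + 1 / real (Suc n)" .
qed

lemma upper_approx_tendsto: "(\<lambda>n. upper_approx n x) \<longlonglongrightarrow> x"
proof (rule tendsto_sandwich[of "\<lambda>_. x" _ _ "\<lambda>n. x + 1 / real (Suc n)"])
  show "(\<lambda>n. x + 1 / real (Suc n)) \<longlonglongrightarrow> x"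
    using tendsto_add[OF tendsto_const[of x] LIMSEQ_Suc[OF lim_1_over_n]] by simp
  show "(\<lambda>_. x) \<longlonglongrightarrow> x" by simp
qed (auto simp: upper_approx_bounds simp del: of_nat_Suc)

lemma continuous_on_upper_approx_tendsto:
  fixes w :: "real \<Rightarrow> real"
  assumes "continuous_on {0..} w" "0 \<le> x"
  shows "(\<lambda>n. w (upper_approx n x)) \<longlonglongrightarrow> w x"
proof (rule continuous_on_tendsto_compose[OF assms(1) upper_approx_tendsto])
  show "\<forall>\<^sub>F n in sequentially. upper_approx n x \<in> {0..}"
    using order_trans[OF assms(2) upper_approx_bounds(1)] by simp
qed (use assms in auto)

text \<open>A discretised time takes countably many values, so measurability of \<open>W\<close> at
  fixed times is enough and no joint measurability in time and \<open>\<omega>\<close> is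
  required.\<close>

lemma borel_measurable_upper_approx_path:
  fixes W :: "real \<Rightarrow> 'a \<Rightarrow> real"
  assumes W: "\<And>t. 0 \<le> t \<Longrightarrow> W t \<in> borel_measurable M"
    and \<rho>[measurable]: "\<rho> \<in> borel_measurable M" and \<rho>0: "\<And>\<omega>. \<omega> \<in> space M \<Longrightarrow> 0 \<le> \<rho> \<omega>"
  shows "(\<lambda>\<omega>. W (upper_approx n (\<rho> \<omega>)) \<omega>) \<in> borel_measurable M"
proof -
  \<comment> \<open>The maximum with 0 keeps the time in the range where \<open>W\<close> is known
    to be measurable for every integer \<open>k\<close>, including those that the ceiling never
    takes.\<close>
  have "(\<lambda>\<omega>. (\<lambda>k. W (max 0 (of_int k / real (Suc n)))) \<lceil>\<rho> \<omega> * real (Suc n)\<rceil> \<omega>) \<in> borel_measurable M"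
    by (rule measurable_compose_countable) (auto intro!: W)
  moreover have "max 0 (of_int \<lceil>\<rho> \<omega> * real (Suc n)\<rceil> / real (Suc n)) = upper_approx n (\<rho> \<omega>)" if "\<omega> \<in> space M" for \<omega>
    using order_trans[OF \<rho>0[OF that] upper_approx_bounds(1)[of _ n]] by (simp add: upper_approx_def max_def)
  ultimately show ?thesis
    by (subst measurable_cong) (auto simp del: of_nat_Suc)
qed

text \<open>The pointwise limit of the discretised values is measurable, but continuity identifies
  it with the value at \<open>\<rho>\<close> only almost surely; completeness bridges the
  gap.\<close>

lemma borel_measurable_path_at_random_time:
  fixes W :: "real \<Rightarrow> 'a \<Rightarrow> real"
  assumes "complete_measure M" and W: "\<And>t. 0 \<le> t \<Longrightarrow> W t \<in> borel_measurable M"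
    and cont: "AE \<omega> in M. continuous_on {0..} (\<lambda>t. W t \<omega>)"
    and \<rho>: "\<rho> \<in> borel_measurable M" and \<rho>0: "\<And>\<omega>. \<omega> \<in> space M \<Longrightarrow> 0 \<le> \<rho> \<omega>"
  shows "(\<lambda>\<omega>. W (\<rho> \<omega>) \<omega>) \<in> borel_measurable M"
proof -
  interpret complete_measure M by fact
  note [measurable] = borel_measurable_upper_approx_path[OF W \<rho> \<rho>0]
  have "(\<lambda>\<omega>. lim (\<lambda>n. W (upper_approx n (\<rho> \<omega>)) \<omega>)) \<in> borel_measurable M"
    by (rule borel_measurable_lim_metric) measurable
  moreover have "AE \<omega> in M. lim (\<lambda>n. W (upper_approx n (\<rho> \<omega>)) \<omega>) = W (\<rho> \<omega>) \<omega>"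
    using cont AE_space by eventually_elim (auto intro!: limI continuous_on_upper_approx_tendsto \<rho>0)
  ultimately show ?thesis by (rule measurable_cong_AE_complete) simp
qed

text \<open>Characteristic functions converge by dominated convergence, here along a sequence where
  they are constant, and they determine the law.\<close>

lemma (in prob_space) distr_eq_of_AE_tendsto:
  fixes X :: "nat \<Rightarrow> 'a \<Rightarrow> real"
  assumes X[measurable]: "\<And>n. X n \<in> borel_measurable M" and Y[measurable]: "Y \<in> borel_measurable M"
    and lim: "AE \<omega> in M. (\<lambda>n. X n \<omega>) \<longlonglongrightarrow> Y \<omega>"
    and law: "\<And>n. distr M borel (X n) = \<mu>"
  shows "distr M borel Y = \<mu>"
proof (rule Levy_uniqueness)
  show "real_distribution (distr M borel Y)" by simp
  show "real_distribution \<mu>" using real_distribution_distr[OF X, of 0] by (simp add: law)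
  show "char (distr M borel Y) = char \<mu>"
  proof
    fix u
    have "(\<lambda>n. \<integral>\<omega>. iexp (u * X n \<omega>) \<partial>M) \<longlonglongrightarrow> (\<integral>\<omega>. iexp (u * Y \<omega>) \<partial>M)"
    proof (rule integral_dominated_convergence[where w = "\<lambda>_. 1"])
      show "AE \<omega> in M. (\<lambda>n. iexp (u * X n \<omega>)) \<longlonglongrightarrow> iexp (u * Y \<omega>)"
        using lim by eventually_elim (intro tendsto_intros)
    qed auto
    moreover have "(\<integral>\<omega>. iexp (u * X n \<omega>) \<partial>M) = char \<mu> u" for n
      unfolding law[of n, symmetric] char_def by (subst integral_distr) auto
    moreover have "(\<integral>\<omega>. iexp (u * Y \<omega>) \<partial>M) = char (distr M borel Y) u"
      unfolding char_def by (subst integral_distr) auto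
    ultimately show "char (distr M borel Y) u = char \<mu> u"
      by (simp add: LIMSEQ_const_iff)
  qed
qed

lemma (in prob_space) prob_uniform_measure_Collect:
  assumes E: "E \<in> events" "prob E \<noteq> 0" and P: "{\<omega> \<in> space M. P \<omega>} \<in> events"
  shows "measure (uniform_measure M E) {\<omega> \<in> space M. P \<omega>} = prob {\<omega> \<in> E. P \<omega>} / prob E"
proof -
  have "E \<inter> {\<omega> \<in> space M. P \<omega>} = {\<omega> \<in> E. P \<omega>}" using sets.sets_into_space[OF E(1)] by auto
  then show ?thesis using E P by (subst measure_uniform_measure) (auto simp: emeasure_eq_measure)
qed

lemma (in prob_space) prob_partition_finite:
  assumes "finite K" "A \<in> events" "\<And>\<omega>. \<omega> \<in> A \<Longrightarrow> X \<omega> \<in> K" "\<And>k. k \<in> K \<Longrightarrow> {\<omega> \<in> A. X \<omega> = k} \<in> events"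
  shows "prob A = (\<Sum>k\<in>K. prob {\<omega> \<in> A. X \<omega> = k})"
proof -
  have "A = (\<Union>k\<in>K. {\<omega> \<in> A. X \<omega> = k})" using assms by auto
  then have "prob A = prob (\<Union>k\<in>K. {\<omega> \<in> A. X \<omega> = k})" by simp
  also have "\<dots> = (\<Sum>k\<in>K. prob {\<omega> \<in> A. X \<omega> = k})"
    using assms by (intro finite_measure_finite_Union) (auto simp: disjoint_family_on_def)
  finally show ?thesis .
qed

text \<open>Standardising removes the variance from the law; this is what makes one statement valid
  for all values of a random time.\<close>

lemma measure_gaussian_scale:
  assumes v: "0 < v" and B: "B \<in> sets borel"
  shows "measure (gaussian v) {x. x / sqrt v \<in> B} = measure (gaussian 1) B"
proof -
  interpret prob_space "gaussian v" using v by (rule prob_space_gaussian)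
  have "distributed (gaussian v) lborel (\<lambda>x. x) (centred_normal v)"
    unfolding distributed_def by (auto intro!: measure_eqI simp: emeasure_distr)
  then have "distributed (gaussian v) lborel (\<lambda>x. (x - 0) / sqrt v) std_normal_density"
    using v by (subst normal_standard_normal_convert[symmetric]) auto
  then have "distributed (gaussian v) lborel (\<lambda>x. x / sqrt v) (centred_normal 1)"
    by simp
  from distributed_gaussianD[OF this B] show ?thesis by simp
qed

text \<open>For a fixed \<open>r > t\<close> the law of \<open>N r\<close> is standard normal whatever \<open>r\<close> is; hence so is the law of
  \<open>N \<rho>\<close> for every discrete random time \<open>\<rho>\<close>, and it survives the passage to the limit.\<close>

lemma (in prob_space) prob_bridge_at_random_time:
  fixes W :: "real \<Rightarrow> 'a \<Rightarrow> real" and \<rho> :: "'a \<Rightarrow> real" and t T :: real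
  defines "V \<equiv> \<lambda>s \<omega>. W s \<omega> - W 0 \<omega>"
  defines "N \<equiv> \<lambda>r \<omega>. (V t \<omega> - t / r * V r \<omega>) / sqrt (t * (r - t) / r)"
  assumes compl: "complete_measure M" and bm: "std_brownian_motion M W"
    and ind: "indep_set (sets (vimage_algebra (space M) (\<lambda>\<omega>. \<lambda>s\<in>{0..}. W s \<omega>) (Pi\<^sub>M {0..} (\<lambda>_. borel)))) (sets G)"
    and G: "space G = space M" and \<rho>: "\<rho> \<in> borel_measurable G" and \<rho>_range: "\<And>\<omega>. \<omega> \<in> space M \<Longrightarrow> t < \<rho> \<omega> \<and> \<rho> \<omega> \<le> T"
    and t: "0 < t" and C: "C \<in> sets G"
    and J: "finite J" "J \<subseteq> {0..t}" and A: "\<And>s. A s \<in> sets borel" and B: "B \<in> sets borel"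
  shows "prob {\<omega> \<in> C. (\<forall>s\<in>J. V s \<omega> - s / t * V t \<omega> \<in> A s) \<and> N (\<rho> \<omega>) \<omega> \<in> B} =
    prob C * prob {\<omega> \<in> space M. \<forall>s\<in>J. V s \<omega> - s / t * V t \<omega> \<in> A s} * measure (gaussian 1) B"
proof -
  let ?V = "vimage_algebra (space M) (\<lambda>\<omega>. \<lambda>s\<in>{0..}. W s \<omega>) (Pi\<^sub>M {0..} (\<lambda>_. borel))"
  define E where "E = {\<omega> \<in> space M. \<forall>s\<in>J. V s \<omega> - s / t * V t \<omega> \<in> A s}"
  have GM: "sets G \<subseteq> events" "sets ?V \<subseteq> events" using ind unfolding indep_sets2_eq by auto
  have [measurable]: "\<rho> \<in> borel_measurable M"
    using \<rho> GM G by (auto simp: measurable_def)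
  have W: "W u \<in> borel_measurable M" if "0 \<le> u" for u
    using bm that unfolding std_brownian_motion_def by auto
  have V: "V u \<in> borel_measurable M" if "0 \<le> u" for u
    unfolding V_def using that by (intro borel_measurable_diff W) auto
  have [measurable]: "V t \<in> borel_measurable M" using V[of t] t by simp
  have cont: "AE \<omega> in M. continuous_on {0..} (\<lambda>t. V t \<omega>)"
  proof -
    have "AE \<omega> in M. continuous_on {0..} (\<lambda>t. W t \<omega>)" using bm unfolding std_brownian_motion_def by blast
    then show ?thesis by eventually_elim (auto simp: V_def intro!: continuous_intros)
  qed
  have W': "W u \<in> borel_measurable ?V" if "0 \<le> u" for u
  proof -
    have "(\<lambda>\<omega>. \<lambda>s\<in>{0..}. W s \<omega>) \<in> space M \<rightarrow> space (Pi\<^sub>M {0..} (\<lambda>_. borel))"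
      by (simp add: space_PiM Pi_iff)
    from measurable_compose[OF measurable_vimage_algebra1[OF this] measurable_component_singleton[of u]]
    have "(\<lambda>\<omega>. (\<lambda>s\<in>{0..}. W s \<omega>) u) \<in> borel_measurable ?V" using that by simp
    then show ?thesis using that by simp
  qed
  have V': "V u \<in> borel_measurable ?V" if "0 \<le> u" for u
    unfolding V_def using that by (intro borel_measurable_diff W') auto
  have E': "E \<in> sets ?V"
    unfolding E_def using J A t
    by (subst space_vimage_algebra[symmetric, of _ "\<lambda>\<omega>. \<lambda>s\<in>{0..}. W s \<omega>" "Pi\<^sub>M {0..} (\<lambda>_. borel)"],
       intro sets.sets_Collect_finite_All measurable_sets_Collect[OF borel_measurable_diff[OF V' borel_measurable_times[OF borel_measurable_const V']]]) auto
  have E[measurable]: "E \<in> events" and C'[measurable]: "C \<in> events" using E' C GM by auto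
  have Nr': "N r \<in> borel_measurable ?V" if "0 \<le> r" for r
    unfolding N_def using that t by (intro borel_measurable_divide borel_measurable_diff borel_measurable_times V') auto
  \<comment> \<open>At a deterministic time \<open>r > t\<close> the bridge event and
    \<open>N r\<close> both belong to the sigma-algebra of \<open>W\<close>, so \<open>C'\<close>
    factors out by independence and the fixed-time bridge lemma does the rest.\<close>
  have fixed: "prob {\<omega> \<in> C'. \<omega> \<in> E \<and> N r \<omega> \<in> B} = prob C' * (prob E * measure (gaussian 1) B)"
    if "C' \<in> sets G" "t < r" and B: "B \<in> sets borel" for C' r B
  proof -
    have v: "0 < t * (r - t) / r" using that t by simp
    have "{\<omega> \<in> space M. N r \<omega> \<in> B} \<in> sets ?V"
      using measurable_sets_Collect[OF Nr'[of r], of "\<lambda>x. x \<in> B"] B that t by simp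
    then have D: "E \<inter> {\<omega> \<in> space M. N r \<omega> \<in> B} \<in> sets ?V" using E' by auto
    have "{\<omega> \<in> C'. \<omega> \<in> E \<and> N r \<omega> \<in> B} = (E \<inter> {\<omega> \<in> space M. N r \<omega> \<in> B}) \<inter> C'"
      using sets.sets_into_space[of C' M] GM that by auto
    then have "prob {\<omega> \<in> C'. \<omega> \<in> E \<and> N r \<omega> \<in> B} = prob (E \<inter> {\<omega> \<in> space M. N r \<omega> \<in> B}) * prob C'"
      using indep_setD[OF ind D that(1)] by simp
    also have "E \<inter> {\<omega> \<in> space M. N r \<omega> \<in> B} = {\<omega> \<in> space M. (\<forall>s\<in>J. V s \<omega> - s / t * V t \<omega> \<in> A s) \<and>
        V t \<omega> - t / r * V r \<omega> \<in> {x. x / sqrt (t * (r - t) / r) \<in> B}}"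
      by (auto simp: E_def N_def)
    also have "prob \<dots> = prob E * measure (gaussian (t * (r - t) / r)) {x. x / sqrt (t * (r - t) / r) \<in> B}"
      unfolding E_def V_def
      by (intro prob_brownian_bridge_Int bm J t that A) (use B in measurable)
    finally show ?thesis using measure_gaussian_scale[OF v B] by simp
  qed
  define X where "X = (\<lambda>n \<omega>. N (upper_approx n (\<rho> \<omega>)) \<omega>)"
  have \<rho>_pos: "0 < \<rho> \<omega>" if "\<omega> \<in> space M" for \<omega> using \<rho>_range[OF that] t by simp
  have [measurable]: "(\<lambda>\<omega>. V (upper_approx n (\<rho> \<omega>)) \<omega>) \<in> borel_measurable M" for n
    by (rule borel_measurable_upper_approx_path) (use \<rho>_pos in \<open>auto intro: V simp: less_imp_le\<close>)
  have [measurable]: "upper_approx n \<in> borel_measurable borel" for n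
    unfolding upper_approx_def by measurable
  have X[measurable]: "X n \<in> borel_measurable M" for n
    unfolding X_def N_def by measurable
  have [measurable]: "(\<lambda>\<omega>. V (\<rho> \<omega>) \<omega>) \<in> borel_measurable M"
    by (rule borel_measurable_path_at_random_time[OF compl]) (use \<rho>_pos cont in \<open>auto intro: V simp: less_imp_le\<close>)
  have Y[measurable]: "(\<lambda>\<omega>. N (\<rho> \<omega>) \<omega>) \<in> borel_measurable M"
    unfolding N_def by measurable
  have lim: "AE \<omega> in M. (\<lambda>n. X n \<omega>) \<longlonglongrightarrow> N (\<rho> \<omega>) \<omega>"
    using cont AE_space
  proof eventually_elim
    fix \<omega> assume \<omega>: "continuous_on {0..} (\<lambda>t. V t \<omega>)" "\<omega> \<in> space M"
    show "(\<lambda>n. X n \<omega>) \<longlonglongrightarrow> N (\<rho> \<omega>) \<omega>"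
      unfolding X_def N_def using \<rho>_range[OF \<omega>(2)] t
      by (intro tendsto_intros upper_approx_tendsto continuous_on_upper_approx_tendsto[OF \<omega>(1)]) auto
  qed
  have discrete: "prob {\<omega> \<in> C. \<omega> \<in> E \<and> X n \<omega> \<in> B} = prob C * (prob E * measure (gaussian 1) B)"
    if [measurable]: "B \<in> sets borel" for n B
  proof -
    \<comment> \<open>Since \<open>\<rho>\<close> stays between \<open>t\<close> and
      \<open>T\<close>, finitely many grid indices cover all its values and a finite partition
      suffices.\<close>
    define K where "K = {\<lceil>t * real (Suc n)\<rceil>..\<lceil>T * real (Suc n)\<rceil>}"
    define idx where "idx = (\<lambda>\<omega>. \<lceil>\<rho> \<omega> * real (Suc n)\<rceil>)"
    have idx_G: "{\<omega> \<in> C. idx \<omega> = k} \<in> sets G" for k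
    proof -
      have "{\<omega> \<in> space G. idx \<omega> = k} \<in> sets G" unfolding idx_def using \<rho> by measurable
      then have "C \<inter> {\<omega> \<in> space G. idx \<omega> = k} \<in> sets G" using C by auto
      moreover have "C \<inter> {\<omega> \<in> space G. idx \<omega> = k} = {\<omega> \<in> C. idx \<omega> = k}" using sets.sets_into_space[OF C] by auto
      ultimately show ?thesis by simp
    qed
    have idx_K: "idx \<omega> \<in> K" if "\<omega> \<in> space M" for \<omega>
      using \<rho>_range[OF that] by (auto simp: idx_def K_def less_imp_le intro!: ceiling_mono mult_right_mono)
    have [measurable]: "{\<omega> \<in> C. idx \<omega> = k} \<in> events" for k using idx_G GM by auto
    have CM: "C \<subseteq> space M" using C' by (rule sets.sets_into_space)
    have [measurable]: "{\<omega> \<in> C. \<omega> \<in> E \<and> X n \<omega> \<in> B} \<in> events"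
    proof -
      have "{\<omega> \<in> C. \<omega> \<in> E \<and> X n \<omega> \<in> B} = C \<inter> E \<inter> {\<omega> \<in> space M. X n \<omega> \<in> B}" using CM by auto
      then show ?thesis by simp
    qed
    have "prob {\<omega> \<in> C. \<omega> \<in> E \<and> X n \<omega> \<in> B} = (\<Sum>k\<in>K. prob {\<omega> \<in> {\<omega> \<in> C. \<omega> \<in> E \<and> X n \<omega> \<in> B}. idx \<omega> = k})"
    proof (rule prob_partition_finite)
      fix k
      have "{\<omega> \<in> {\<omega> \<in> C. \<omega> \<in> E \<and> X n \<omega> \<in> B}. idx \<omega> = k} = {\<omega> \<in> C. \<omega> \<in> E \<and> X n \<omega> \<in> B} \<inter> {\<omega> \<in> C. idx \<omega> = k}" by auto
      then show "{\<omega> \<in> {\<omega> \<in> C. \<omega> \<in> E \<and> X n \<omega> \<in> B}. idx \<omega> = k} \<in> events" by simp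
    qed (use CM idx_K in \<open>auto simp: K_def\<close>)
    also have "\<dots> = (\<Sum>k\<in>K. prob {\<omega> \<in> C. idx \<omega> = k} * (prob E * measure (gaussian 1) B))"
    proof (rule sum.cong)
      fix k
      show "prob {\<omega> \<in> {\<omega> \<in> C. \<omega> \<in> E \<and> X n \<omega> \<in> B}. idx \<omega> = k} = prob {\<omega> \<in> C. idx \<omega> = k} * (prob E * measure (gaussian 1) B)"
      proof (cases "{\<omega> \<in> C. idx \<omega> = k} = {}")
        case True
        then have "{\<omega> \<in> {\<omega> \<in> C. \<omega> \<in> E \<and> X n \<omega> \<in> B}. idx \<omega> = k} = {}" by auto
        with True show ?thesis by (simp only: measure_empty mult_zero_left)
      next
        case False
        have app: "upper_approx n (\<rho> \<omega>) = of_int k / real (Suc n)" if "idx \<omega> = k" for \<omega>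
          using that by (simp add: upper_approx_def idx_def)
        \<comment> \<open>A point of the cell certifies that its grid time exceeds \<open>t\<close>:
          rounding is upwards and \<open>\<rho>\<close> itself exceeds \<open>t\<close>. This is the
          condition for the fixed-time formula.\<close>
        obtain \<omega> where "\<omega> \<in> C" "idx \<omega> = k" using False by auto
        then have "t < of_int k / real (Suc n)"
          using app[of \<omega>] \<rho>_range[of \<omega>] upper_approx_bounds(1)[of "\<rho> \<omega>" n] CM by auto
        from fixed[OF idx_G this that] have "prob {\<omega> \<in> {\<omega> \<in> C. idx \<omega> = k}. \<omega> \<in> E \<and> N (of_int k / real (Suc n)) \<omega> \<in> B} =
          prob {\<omega> \<in> C. idx \<omega> = k} * (prob E * measure (gaussian 1) B)" .
        also have "{\<omega> \<in> {\<omega> \<in> C. idx \<omega> = k}. \<omega> \<in> E \<and> N (of_int k / real (Suc n)) \<omega> \<in> B} =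
           {\<omega> \<in> {\<omega> \<in> C. \<omega> \<in> E \<and> X n \<omega> \<in> B}. idx \<omega> = k}"
          by (auto simp: X_def app)
        finally show ?thesis .
      qed
    qed simp
    also have "\<dots> = (\<Sum>k\<in>K. prob {\<omega> \<in> C. idx \<omega> = k}) * (prob E * measure (gaussian 1) B)"
      by (simp add: sum_distrib_right)
    also have "(\<Sum>k\<in>K. prob {\<omega> \<in> C. idx \<omega> = k}) = prob C"
      by (rule prob_partition_finite[symmetric]) (use CM idx_K in \<open>auto simp: K_def\<close>)
    finally show ?thesis .
  qed
  interpret g: prob_space "gaussian 1" by (rule prob_space_gaussian) simp
  have g1: "measure (gaussian 1) UNIV = 1" using g.prob_space by simp
  have CE: "prob (C \<inter> E) = prob C * prob E"
    using indep_setD[OF ind E' C] by (simp add: Int_commute)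
  have CM: "C \<subseteq> space M" using C' by (rule sets.sets_into_space)
  have "prob {\<omega> \<in> C \<inter> E. N (\<rho> \<omega>) \<omega> \<in> B} = prob (C \<inter> E) * measure (gaussian 1) B"
  proof (cases "prob (C \<inter> E) = 0")
    case True
    have "prob {\<omega> \<in> C \<inter> E. N (\<rho> \<omega>) \<omega> \<in> B} \<le> prob (C \<inter> E)"
      by (intro finite_measure_mono) auto
    with True show ?thesis by (simp add: measure_le_0_iff)
  next
    case False
    \<comment> \<open>Conditioning on \<open>C \<inter> E\<close> turns the product formula for
      every \<open>n\<close> into the statement that \<open>X n\<close> is standard normal, to which
      the passage to the limit of laws applies.\<close>
    let ?Q = "uniform_measure M (C \<inter> E)"
    interpret Q: prob_space ?Q
      using False by (intro prob_space_uniform_measure) (auto simp: emeasure_eq_measure)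
    have "distr ?Q borel (\<lambda>\<omega>. N (\<rho> \<omega>) \<omega>) = distr (gaussian 1) borel (\<lambda>x. x)"
    proof (rule Q.distr_eq_of_AE_tendsto)
      show "AE \<omega> in ?Q. (\<lambda>n. X n \<omega>) \<longlonglongrightarrow> N (\<rho> \<omega>) \<omega>"
        using lim by (intro AE_uniform_measureI) auto
      fix n
      show "X n \<in> borel_measurable ?Q" by simp
      show "distr ?Q borel (X n) = distr (gaussian 1) borel (\<lambda>x. x)"
      proof (rule measure_eqI)
        fix B :: "real set" assume "B \<in> sets (distr ?Q borel (X n))"
        then have B[measurable]: "B \<in> sets borel" by simp
        have eq: "{\<omega> \<in> C \<inter> E. X n \<omega> \<in> B} = {\<omega> \<in> C. \<omega> \<in> E \<and> X n \<omega> \<in> B}" by auto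
        have eq2: "X n -` B \<inter> space ?Q = {\<omega> \<in> space M. X n \<omega> \<in> B}" by auto
        have "emeasure (distr ?Q borel (X n)) B = emeasure ?Q {\<omega> \<in> space M. X n \<omega> \<in> B}"
          by (subst emeasure_distr, simp, simp, simp only: eq2)
        also have "\<dots> = Q.prob {\<omega> \<in> space M. X n \<omega> \<in> B}" by (rule Q.emeasure_eq_measure)
        also have "Q.prob {\<omega> \<in> space M. X n \<omega> \<in> B} = measure (gaussian 1) B"
          using False discrete[OF B, of n] CE by (subst prob_uniform_measure_Collect) (auto simp: eq)
        also have "ennreal (measure (gaussian 1) B) = emeasure (gaussian 1) B"
          by (rule g.emeasure_eq_measure[symmetric])
        also have "\<dots> = emeasure (distr (gaussian 1) borel (\<lambda>x. x)) B"
          by (simp add: emeasure_distr)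
        finally show "emeasure (distr ?Q borel (X n)) B = emeasure (distr (gaussian 1) borel (\<lambda>x. x)) B" .
      qed simp
    qed simp
    then have "measure (distr ?Q borel (\<lambda>\<omega>. N (\<rho> \<omega>) \<omega>)) B = measure (distr (gaussian 1) borel (\<lambda>x. x)) B" by simp
    then have "Q.prob {\<omega> \<in> space M. N (\<rho> \<omega>) \<omega> \<in> B} = measure (gaussian 1) B"
      using B by (simp add: measure_distr vimage_def Int_def conj_commute)
    then show ?thesis
      using False B by (subst (asm) prob_uniform_measure_Collect) (auto simp: field_simps)
  qed
  moreover have "{\<omega> \<in> C \<inter> E. N (\<rho> \<omega>) \<omega> \<in> B} = {\<omega> \<in> C. (\<forall>s\<in>J. V s \<omega> - s / t * V t \<omega> \<in> A s) \<and> N (\<rho> \<omega>) \<omega> \<in> B}"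
    using CM by (auto simp: E_def)
  ultimately show ?thesis by (simp add: CE) (simp add: E_def)
qed

section \<open>Change of variables and conditioning on an event\<close>

text \<open>For each fixed \<open>r\<close> the map from \<open>y\<close> to
  \<open>c r * y + m r\<close> is an affine bijection of the line with Jacobian \<open>c r\<close>;
  Tonelli then assembles the fibres.\<close>

lemma distributed_pair_affine:
  fixes X N :: "'a \<Rightarrow> real" and F G :: "real \<Rightarrow> ennreal" and c m :: "real \<Rightarrow> real"
  assumes D: "distributed M (lborel \<Otimes>\<^sub>M lborel) (\<lambda>\<omega>. (X \<omega>, N \<omega>)) (\<lambda>(r, y). F r * G y)"
    and [measurable]: "F \<in> borel_measurable borel" "G \<in> borel_measurable borel"
      "c \<in> borel_measurable borel" "m \<in> borel_measurable borel"
    and c: "\<And>r. 0 < c r"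
  shows "distributed M (lborel \<Otimes>\<^sub>M lborel) (\<lambda>\<omega>. (X \<omega>, c (X \<omega>) * N \<omega> + m (X \<omega>)))
    (\<lambda>(r, x). F r * (G ((x - m r) / c r) / ennreal (c r)))"
proof -
  have XN: "(\<lambda>\<omega>. (X \<omega>, N \<omega>)) \<in> measurable M (lborel \<Otimes>\<^sub>M lborel)" using distributed_measurable[OF D] .
  have [measurable]: "X \<in> borel_measurable M" "N \<in> borel_measurable M"
    using measurable_compose[OF XN measurable_fst] measurable_compose[OF XN measurable_snd] by auto
  let ?h = "\<lambda>(r, x). F r * (G ((x - m r) / c r) / ennreal (c r))"
  show ?thesis
    unfolding distributed_def
  proof (intro conjI measure_eqI)
    fix A assume A: "A \<in> sets (distr M (lborel \<Otimes>\<^sub>M lborel) (\<lambda>\<omega>. (X \<omega>, c (X \<omega>) * N \<omega> + m (X \<omega>))))"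
    then have [measurable]: "A \<in> sets (lborel \<Otimes>\<^sub>M lborel)" by simp
    have [measurable]: "A \<in> sets (borel \<Otimes>\<^sub>M borel)" using A by (simp cong: sets_pair_measure_cong)
    have "emeasure (distr M (lborel \<Otimes>\<^sub>M lborel) (\<lambda>\<omega>. (X \<omega>, c (X \<omega>) * N \<omega> + m (X \<omega>)))) A =
       (\<integral>\<^sup>+\<omega>. indicator A (X \<omega>, c (X \<omega>) * N \<omega> + m (X \<omega>)) \<partial>M)"
    proof -
      have "(\<integral>\<^sup>+q. indicator A q \<partial>distr M (lborel \<Otimes>\<^sub>M lborel) (\<lambda>\<omega>. (X \<omega>, c (X \<omega>) * N \<omega> + m (X \<omega>)))) =
          (\<integral>\<^sup>+\<omega>. indicator A (X \<omega>, c (X \<omega>) * N \<omega> + m (X \<omega>)) \<partial>M)"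
        by (rule nn_integral_distr) auto
      then show ?thesis unfolding nn_integral_indicator[OF A] .
    qed
    also have "\<dots> = (\<integral>\<^sup>+\<omega>. (\<lambda>(r, y). indicator A (r, c r * y + m r)) (X \<omega>, N \<omega>) \<partial>M)" by simp
    also have "\<dots> = (\<integral>\<^sup>+q. (\<lambda>(r, y). F r * G y) q * (\<lambda>(r, y). indicator A (r, c r * y + m r)) q \<partial>(lborel \<Otimes>\<^sub>M lborel))"
      by (rule distributed_nn_integral[OF D, symmetric]) measurable
    also have "\<dots> = (\<integral>\<^sup>+r. \<integral>\<^sup>+y. F r * G y * indicator A (r, c r * y + m r) \<partial>lborel \<partial>lborel)"
      by (subst lborel.nn_integral_fst[symmetric]) auto
    also have "\<dots> = (\<integral>\<^sup>+r. \<integral>\<^sup>+x. ?h (r, x) * indicator A (r, x) \<partial>lborel \<partial>lborel)"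
    proof (rule nn_integral_cong)
      fix r :: real
      have [measurable]: "(\<lambda>x. ?h (r, x) * indicator A (r, x)) \<in> borel_measurable borel" by simp
      have [measurable]: "(\<lambda>y. ?h (r, m r + c r * y) * indicator A (r, m r + c r * y)) \<in> borel_measurable borel" by simp
      have "(\<integral>\<^sup>+x. ?h (r, x) * indicator A (r, x) \<partial>lborel) = ennreal \<bar>c r\<bar> * (\<integral>\<^sup>+y. ?h (r, m r + c r * y) * indicator A (r, m r + c r * y) \<partial>lborel)"
        using c[of r] by (intro nn_integral_real_affine) auto
      also have "\<dots> = (\<integral>\<^sup>+y. ennreal (c r) * (?h (r, m r + c r * y) * indicator A (r, m r + c r * y)) \<partial>lborel)"
        using c[of r] by (subst nn_integral_cmult) auto
      also have "\<dots> = (\<integral>\<^sup>+y. F r * G y * indicator A (r, c r * y + m r) \<partial>lborel)"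
      proof (rule nn_integral_cong)
        fix y
        have "ennreal (c r) * (g / ennreal (c r)) = g" for g
          using c[of r] by (simp add: ennreal_times_divide ennreal_mult_divide_eq mult.commute)
        then show "ennreal (c r) * (?h (r, m r + c r * y) * indicator A (r, m r + c r * y)) = F r * G y * indicator A (r, c r * y + m r)"
          using c[of r] by (simp add: add.commute ac_simps) (metis mult.assoc mult.commute)
      qed
      finally show "(\<integral>\<^sup>+y. F r * G y * indicator A (r, c r * y + m r) \<partial>lborel) = (\<integral>\<^sup>+x. ?h (r, x) * indicator A (r, x) \<partial>lborel)" by simp
    qed
    also have "\<dots> = (\<integral>\<^sup>+q. ?h q * indicator A q \<partial>(lborel \<Otimes>\<^sub>M lborel))"
      by (subst lborel.nn_integral_fst[symmetric]) auto
    also have "\<dots> = emeasure (density (lborel \<Otimes>\<^sub>M lborel) ?h) A"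
      by (subst emeasure_density) auto
    finally show "emeasure (distr M (lborel \<Otimes>\<^sub>M lborel) (\<lambda>\<omega>. (X \<omega>, c (X \<omega>) * N \<omega> + m (X \<omega>)))) A =
      emeasure (density (lborel \<Otimes>\<^sub>M lborel) ?h) A" .
  qed (auto simp: space_pair_measure)
qed

lemma normal_density_standardize:
  "0 < c \<Longrightarrow> normal_density m c x = centred_normal 1 ((x - m) / c) / c"
  by (simp add: normal_density_def power_divide real_sqrt_mult)

lemma gauss_kernel_eq_normal_density:
  "0 < v \<Longrightarrow> gauss_kernel v x y = normal_density y (sqrt v) x"
  by (simp add: gauss_kernel_def normal_density_def)

lemma (in prob_space)
  fixes F :: "'a \<Rightarrow> real"
  assumes E: "E \<in> events" "prob E \<noteq> 0" and [measurable]: "F \<in> borel_measurable M"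
  shows integral_uniform_measure: "(\<integral>\<omega>. F \<omega> \<partial>uniform_measure M E) = (\<integral>\<omega>. indicator E \<omega> * F \<omega> \<partial>M) / prob E"
    and integrable_uniform_measure: "integrable (uniform_measure M E) F \<longleftrightarrow> integrable M (\<lambda>\<omega>. indicator E \<omega> * F \<omega>)"
proof -
  note [measurable] = E(1)
  have "indicator E \<omega> / emeasure M E = ennreal (indicator E \<omega> / prob E)" for \<omega>
    using E(2) divide_ennreal[of "indicator E \<omega>" "prob E"]
    by (simp add: emeasure_eq_measure ennreal_indicator zero_less_measure_iff)
  then have u: "uniform_measure M E = density M (\<lambda>\<omega>. ennreal (indicator E \<omega> / prob E))"
    by (simp add: uniform_measure_def)
  have "(\<integral>\<omega>. F \<omega> \<partial>uniform_measure M E) = (\<integral>\<omega>. (indicator E \<omega> / prob E) * F \<omega> \<partial>M)"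
    unfolding u by (subst integral_real_density) auto
  then show "(\<integral>\<omega>. F \<omega> \<partial>uniform_measure M E) = (\<integral>\<omega>. indicator E \<omega> * F \<omega> \<partial>M) / prob E"
    by simp
  have "integrable (uniform_measure M E) F \<longleftrightarrow> integrable M (\<lambda>\<omega>. (indicator E \<omega> / prob E) * F \<omega>)"
    unfolding u by (subst integrable_real_density) auto
  also have "(\<lambda>\<omega>. (indicator E \<omega> / prob E) * F \<omega>) = (\<lambda>\<omega>. (1 / prob E) * (indicator E \<omega> * F \<omega>))"
    by auto
  also have "integrable M \<dots> \<longleftrightarrow> integrable M (\<lambda>\<omega>. indicator E \<omega> * F \<omega>)"
    using E(2) by (subst integrable_mult_left_iff) auto
  finally show "integrable (uniform_measure M E) F \<longleftrightarrow> integrable M (\<lambda>\<omega>. indicator E \<omega> * F \<omega>)" .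
qed

lemma gauss_kernel_nonneg: "0 \<le> v \<Longrightarrow> 0 \<le> gauss_kernel v x y"
  by (simp add: gauss_kernel_def)

section \<open>The market information process\<close>

locale market_model = prob_space M for M :: "'a measure" +
  fixes T \<sigma> :: real and W :: "real \<Rightarrow> 'a \<Rightarrow> real" and \<tau> Z :: "'a \<Rightarrow> real"
    and l :: nat and z p :: "nat \<Rightarrow> real" and f :: "real \<Rightarrow> real \<Rightarrow> real"
  assumes complete: "complete_measure M"
    and T_pos: "0 < T"
    and brownian: "std_brownian_motion M W"
    and \<tau>[measurable]: "\<tau> \<in> borel_measurable M"
    and \<tau>_pos: "\<And>\<omega>. \<omega> \<in> space M \<Longrightarrow> 0 < \<tau> \<omega>"
    and Z[measurable]: "Z \<in> borel_measurable M"
    and indep: "indep_set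
        (sets (vimage_algebra (space M) (\<lambda>\<omega>. \<lambda>s\<in>{0..}. W s \<omega>) (Pi\<^sub>M {0..} (\<lambda>_. borel))))
        (sets (vimage_algebra (space M) (\<lambda>\<omega>. (\<tau> \<omega>, Z \<omega>)) (borel \<Otimes>\<^sub>M borel)))"
    and inj_z: "inj_on z {1..l}"
    and Z_range: "\<And>\<omega>. \<omega> \<in> space M \<Longrightarrow> Z \<omega> \<in> z ` {1..l}"
    and Z_prob: "\<And>i. i \<in> {1..l} \<Longrightarrow> prob {\<omega> \<in> space M. Z \<omega> = z i} = p i"
    and p_pos: "\<And>i. i \<in> {1..l} \<Longrightarrow> 0 < p i"
    and \<tau>_gt_T: "prob {\<omega> \<in> space M. \<tau> \<omega> \<le> T} < 1"
    and f_cont: "\<And>i. i \<in> {1..l} \<Longrightarrow> continuous_on {0..} (\<lambda>r. f r (z i))"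
    and f_density: "\<And>i. i \<in> {1..l} \<Longrightarrow> has_cond_density M \<tau> Z (z i) (\<lambda>r. f r (z i))"
begin

text \<open>\<open>W 0 = 0\<close> is assumed only almost surely. The shifted motion starts at 0 at
  every point, so identities between its bridges need no exceptional set.\<close>

definition V :: "real \<Rightarrow> 'a \<Rightarrow> real" where "V s \<omega> = W s \<omega> - W 0 \<omega>"

definition bridge :: "real \<Rightarrow> real \<Rightarrow> 'a \<Rightarrow> real" where
  "bridge t s \<omega> = V s \<omega> - s / t * V t \<omega>"

text \<open>Equals \<open>\<nu>\<close> on \<open>{t < \<nu>}\<close>; the value \<open>T\<close> elsewhere is arbitrary but makes the time always exceed \<open>t\<close>,
  so that \<open>info t\<close>, which agrees with the market information at time \<open>t\<close> on \<open>{t < \<nu>}\<close>, has a density.\<close>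

definition late :: "real \<Rightarrow> real \<Rightarrow> real" where
  "late t r = (if t < r then min r T else T)"

text \<open>The bridge from time 0 to the random time, read at \<open>t\<close> and divided by its
  conditional standard deviation given tau. The scaling makes its law standard normal independently
  of (tau, Z).\<close>

definition noise :: "real \<Rightarrow> 'a \<Rightarrow> real" where
  "noise t \<omega> = (let r = late t (\<tau> \<omega>) in (V t \<omega> - t / r * V r \<omega>) / sqrt (t * (r - t) / r))"

definition info :: "real \<Rightarrow> 'a \<Rightarrow> real" where
  "info t \<omega> = (let r = late t (\<tau> \<omega>) in V t \<omega> - t / r * V r \<omega> + \<sigma> * (t / r) * Z \<omega>)"

text \<open>The indicator gives a Borel function on the whole line, as \<open>f\<close> is
  controlled on the half-line only.\<close>

definition cond_density :: "nat \<Rightarrow> real \<Rightarrow> real" where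
  "cond_density i r = f r (z i) * indicator {0..} r"

text \<open>Serves as the joint density of \<open>(\<tau>, info t)\<close> at \<open>(r, x)\<close>
  under the conditional probability given \<open>Z = z i\<close>.\<close>

definition joint_density :: "real \<Rightarrow> nat \<Rightarrow> real \<Rightarrow> real \<Rightarrow> real" where
  "joint_density t i r x = cond_density i r * bridge_density \<sigma> t (late t r) (z i) x"

abbreviation (input) side_algebra :: "'a measure" where
  "side_algebra \<equiv> vimage_algebra (space M) (\<lambda>\<omega>. (\<tau> \<omega>, Z \<omega>)) (borel \<Otimes>\<^sub>M borel)"

definition bridge_event :: "real \<Rightarrow> real set \<Rightarrow> (real \<Rightarrow> real set) \<Rightarrow> 'a set" where
  "bridge_event t J A = {\<omega> \<in> space M. \<forall>s\<in>J. bridge t s \<omega> \<in> A s}"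

lemma side_measurable: "\<tau> \<in> borel_measurable side_algebra" "Z \<in> borel_measurable side_algebra"
proof -
  have 1: "(\<lambda>\<omega>. (\<tau> \<omega>, Z \<omega>)) \<in> measurable side_algebra (borel \<Otimes>\<^sub>M borel)"
    by (rule measurable_vimage_algebra1) (simp add: space_pair_measure)
  show "\<tau> \<in> borel_measurable side_algebra" "Z \<in> borel_measurable side_algebra"
    using measurable_compose[OF 1 measurable_fst] measurable_compose[OF 1 measurable_snd] by auto
qed

lemma V_measurable: "0 \<le> s \<Longrightarrow> V s \<in> borel_measurable M"
  unfolding V_def using brownian by (intro borel_measurable_diff) (auto simp: std_brownian_motion_def)

lemma bridge_measurable: "0 \<le> s \<Longrightarrow> 0 \<le> t \<Longrightarrow> bridge t s \<in> borel_measurable M"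
  unfolding bridge_def using V_measurable by measurable

lemma V_continuous: "AE \<omega> in M. continuous_on {0..} (\<lambda>t. V t \<omega>)"
proof -
  have "AE \<omega> in M. continuous_on {0..} (\<lambda>t. W t \<omega>)" using brownian unfolding std_brownian_motion_def by blast
  then show ?thesis by eventually_elim (auto simp: V_def intro!: continuous_intros)
qed

lemma late_measurable[measurable]: "late t \<in> borel_measurable borel"
  unfolding late_def by measurable

lemma late_bounds: "t < T \<Longrightarrow> t < late t r" "late t r \<le> T"
  by (auto simp: late_def)

lemma V_random_time: "\<rho> \<in> borel_measurable M \<Longrightarrow> (\<And>\<omega>. \<omega> \<in> space M \<Longrightarrow> 0 \<le> \<rho> \<omega>) \<Longrightarrow> (\<lambda>\<omega>. V (\<rho> \<omega>) \<omega>) \<in> borel_measurable M"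
  by (rule borel_measurable_path_at_random_time[OF complete V_measurable V_continuous])

lemma cond_density_measurable: "i \<in> {1..l} \<Longrightarrow> cond_density i \<in> borel_measurable borel"
  unfolding cond_density_def using borel_measurable_continuous_on_indicator[OF _ f_cont, of i] by (simp add: mult.commute)

lemma cond_density_nonneg: "i \<in> {1..l} \<Longrightarrow> 0 \<le> cond_density i r"
  using f_density[of i] by (auto simp: cond_density_def has_cond_density_def split: split_indicator)

lemma cond_density_distributed: "i \<in> {1..l} \<Longrightarrow> distributed (uniform_measure M {\<omega> \<in> space M. Z \<omega> = z i}) lborel \<tau> (\<lambda>r. ennreal (cond_density i r))"
proof -
  assume i: "i \<in> {1..l}"
  have "(\<lambda>r. ennreal (cond_density i r)) = (\<lambda>r. ennreal (f r (z i)) * indicator {0..} r)"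
    by (auto simp: cond_density_def split: split_indicator)
  then show ?thesis using f_density[OF i] by (simp add: has_cond_density_def)
qed

lemma joint_density_measurable:
  assumes "i \<in> {1..l}" and [measurable]: "g \<in> borel_measurable K" "h \<in> borel_measurable K"
  shows "(\<lambda>x. joint_density t i (g x) (h x)) \<in> borel_measurable K"
  using cond_density_measurable[OF assms(1)]
  unfolding joint_density_def bridge_density_def gauss_kernel_def by measurable

lemma bridge_event_empty: "bridge_event t {} A = space M"
  by (simp add: bridge_event_def)

lemma prob_Z_nonzero: "i \<in> {1..l} \<Longrightarrow> prob {\<omega> \<in> space M. Z \<omega> = z i} \<noteq> 0"
  using Z_prob p_pos by fastforce

section \<open>Joint law of tau, Z and the substitute information\<close>

context
  fixes t :: real
  assumes t: "0 < t" "t < T"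
begin

lemma V_late_measurable[measurable]: "(\<lambda>\<omega>. V (late t (\<tau> \<omega>)) \<omega>) \<in> borel_measurable M"
  by (rule V_random_time) (use late_bounds[of t] t in \<open>auto simp: late_def\<close>)

lemma V_t_measurable[measurable]: "V t \<in> borel_measurable M"
  using t V_measurable by simp

lemma noise_measurable[measurable]: "noise t \<in> borel_measurable M"
  unfolding noise_def Let_def by measurable

lemma info_measurable[measurable]: "info t \<in> borel_measurable M"
  unfolding info_def Let_def by measurable

lemma info_eq_noise:
  "info t \<omega> = sqrt (t * (late t (\<tau> \<omega>) - t) / late t (\<tau> \<omega>)) * noise t \<omega> + t / late t (\<tau> \<omega>) * \<sigma> * Z \<omega>"
proof -
  have "sqrt (t * (late t (\<tau> \<omega>) - t) / late t (\<tau> \<omega>)) \<noteq> 0" using late_bounds(1)[OF t(2), of "\<tau> \<omega>"] t by simp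
  then show ?thesis
    by (simp only: info_def noise_def Let_def times_divide_eq_right nonzero_mult_div_cancel_left) simp
qed

text \<open>The random time \<open>late t \<tau>\<close> is a function of tau and lies in (t, T], so
  the result on bridges at random times gives the joint independence of the side information, the
  bridge on [0, t] and the noise.\<close>

lemma prob_noise:
  assumes C: "C \<in> sets side_algebra" and J: "finite J" "J \<subseteq> {0..t}"
    and A: "\<And>s. A s \<in> sets borel" and B: "B \<in> sets borel"
  shows "prob {\<omega> \<in> C. \<omega> \<in> bridge_event t J A \<and> noise t \<omega> \<in> B} = prob C * prob (bridge_event t J A) * measure (gaussian 1) B"
proof -
  have "C \<subseteq> space M" using sets.sets_into_space[OF C] by simp
  then have "{\<omega> \<in> C. \<omega> \<in> bridge_event t J A \<and> noise t \<omega> \<in> B} =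
    {\<omega> \<in> C. (\<forall>s\<in>J. bridge t s \<omega> \<in> A s) \<and> noise t \<omega> \<in> B}"
    by (auto simp: bridge_event_def)
  moreover have "prob {\<omega> \<in> C. (\<forall>s\<in>J. bridge t s \<omega> \<in> A s) \<and> noise t \<omega> \<in> B} = prob C * prob (bridge_event t J A) * measure (gaussian 1) B"
    unfolding bridge_event_def bridge_def noise_def Let_def V_def
  proof (rule prob_bridge_at_random_time[OF complete brownian indep, where T=T])
    show "(\<lambda>\<omega>. late t (\<tau> \<omega>)) \<in> borel_measurable side_algebra"
      using side_measurable by measurable
  qed (use late_bounds t C J A B in auto)
  ultimately show ?thesis by simp
qed

lemma bridge_event_measurable:
  assumes "finite J" "J \<subseteq> {0..t}" "\<And>s. A s \<in> sets borel"
  shows "bridge_event t J A \<in> events"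
  unfolding bridge_event_def
  by (intro sets.sets_Collect_finite_All measurable_sets_Collect[OF bridge_measurable]) (use assms t in auto)

text \<open>The density does not depend on \<open>J\<close> and \<open>A\<close>: the bridge event
  is independent of all that enters. Given \<open>Z = z i\<close>, the pair of tau and noise has a
  product density, and \<open>info t\<close> is affine in the noise with coefficients depending on
  tau, which produces the bridge kernel.\<close>

lemma distributed_tau_info:
  assumes i: "i \<in> {1..l}" and J: "finite J" "J \<subseteq> {0..t}" and A: "\<And>s. A s \<in> sets borel"
    and E: "prob (bridge_event t J A) \<noteq> 0"
  shows "prob (bridge_event t J A \<inter> {\<omega> \<in> space M. Z \<omega> = z i}) = prob (bridge_event t J A) * p i"
    and "distributed (uniform_measure M (bridge_event t J A \<inter> {\<omega> \<in> space M. Z \<omega> = z i})) (lborel \<Otimes>\<^sub>M lborel)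
      (\<lambda>\<omega>. (\<tau> \<omega>, info t \<omega>)) (\<lambda>(r, x). ennreal (joint_density t i r x))"
proof -
  let ?E = "bridge_event t J A" and ?Z = "{\<omega> \<in> space M. Z \<omega> = z i}"
  let ?Q = "uniform_measure M (?E \<inter> ?Z)" and ?Qi = "uniform_measure M ?Z"
  note [measurable] = bridge_event_measurable[OF J A] cond_density_measurable[OF i]
  have side: "{\<omega> \<in> space M. \<tau> \<omega> \<in> B \<and> Z \<omega> = z i} \<in> sets side_algebra" if "B \<in> sets borel" for B
  proof -
    have "{\<omega> \<in> space side_algebra. \<tau> \<omega> \<in> B \<and> Z \<omega> = z i} \<in> sets side_algebra"
      using side_measurable that by measurable
    then show ?thesis by simp
  qed
  interpret g: prob_space "gaussian 1" by (rule prob_space_gaussian) simp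
  have g1: "measure (gaussian 1) UNIV = 1" using g.prob_space by simp
  show pEZ: "prob (?E \<inter> ?Z) = prob ?E * p i"
  proof -
    have "{\<omega> \<in> ?Z. \<omega> \<in> ?E \<and> noise t \<omega> \<in> UNIV} = ?E \<inter> ?Z" by auto
    moreover have "prob {\<omega> \<in> ?Z. \<omega> \<in> ?E \<and> noise t \<omega> \<in> UNIV} = prob ?Z * prob ?E * measure (gaussian 1) UNIV"
      by (rule prob_noise[OF _ J A]) (use side[of UNIV] in auto)
    ultimately show ?thesis unfolding g1 Z_prob[OF i] by simp
  qed
  have pEZ0: "prob (?E \<inter> ?Z) \<noteq> 0" using pEZ E p_pos[OF i] by simp
  interpret Q: prob_space ?Q using pEZ0 by (intro prob_space_uniform_measure) (auto simp: emeasure_eq_measure)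
  \<comment> \<open>The bridge event cancels from the conditional probability. A product formula on
    rectangles suffices to identify the joint law of tau and the noise.\<close>
  have law: "emeasure ?Q {\<omega> \<in> space ?Q. \<tau> \<omega> \<in> C \<and> noise t \<omega> \<in> B} = emeasure ?Qi (\<tau> -` C \<inter> space ?Qi) * emeasure (gaussian 1) B"
    if [measurable]: "C \<in> sets borel" "B \<in> sets borel" for C B
  proof -
    have "emeasure ?Q {\<omega> \<in> space ?Q. \<tau> \<omega> \<in> C \<and> noise t \<omega> \<in> B} = Q.prob {\<omega> \<in> space M. \<tau> \<omega> \<in> C \<and> noise t \<omega> \<in> B}"
      unfolding space_uniform_measure by (rule Q.emeasure_eq_measure)
    also have "Q.prob {\<omega> \<in> space M. \<tau> \<omega> \<in> C \<and> noise t \<omega> \<in> B} = prob {\<omega> \<in> ?E \<inter> ?Z. \<tau> \<omega> \<in> C \<and> noise t \<omega> \<in> B} / prob (?E \<inter> ?Z)"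
      by (rule prob_uniform_measure_Collect) (use pEZ0 in auto)
    also have "{\<omega> \<in> ?E \<inter> ?Z. \<tau> \<omega> \<in> C \<and> noise t \<omega> \<in> B} = {\<omega> \<in> {\<omega> \<in> space M. \<tau> \<omega> \<in> C \<and> Z \<omega> = z i}. \<omega> \<in> ?E \<and> noise t \<omega> \<in> B}"
      by auto
    also have "prob \<dots> = prob {\<omega> \<in> space M. \<tau> \<omega> \<in> C \<and> Z \<omega> = z i} * prob ?E * measure (gaussian 1) B"
      by (rule prob_noise[OF side J A]) auto
    also have "\<dots> / prob (?E \<inter> ?Z) = prob {\<omega> \<in> ?Z. \<tau> \<omega> \<in> C} / prob ?Z * measure (gaussian 1) B"
    proof -
      have "{\<omega> \<in> space M. \<tau> \<omega> \<in> C \<and> Z \<omega> = z i} = {\<omega> \<in> ?Z. \<tau> \<omega> \<in> C}" by auto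
      then show ?thesis using E unfolding pEZ Z_prob[OF i] by simp
    qed
    also have "prob {\<omega> \<in> ?Z. \<tau> \<omega> \<in> C} / prob ?Z = measure ?Qi {\<omega> \<in> space M. \<tau> \<omega> \<in> C}"
      by (rule prob_uniform_measure_Collect[symmetric]) (use Z_prob[OF i] p_pos[OF i] in auto)
    also have "ennreal (measure ?Qi {\<omega> \<in> space M. \<tau> \<omega> \<in> C} * measure (gaussian 1) B) = emeasure ?Qi {\<omega> \<in> space M. \<tau> \<omega> \<in> C} * emeasure (gaussian 1) B"
    proof -
      interpret Qi: prob_space ?Qi
        using Z_prob[OF i] p_pos[OF i] by (intro prob_space_uniform_measure) (auto simp: emeasure_eq_measure)
      show ?thesis unfolding Qi.emeasure_eq_measure g.emeasure_eq_measure by (simp add: ennreal_mult)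
    qed
    also have "{\<omega> \<in> space M. \<tau> \<omega> \<in> C} = \<tau> -` C \<inter> space ?Qi" by auto
    finally show ?thesis .
  qed
  let ?n = "\<lambda>y. ennreal (centred_normal 1 y)"
  have D: "distributed ?Q (lborel \<Otimes>\<^sub>M lborel) (\<lambda>\<omega>. (\<tau> \<omega>, noise t \<omega>)) (\<lambda>(r, y). ennreal (cond_density i r) * ?n y)"
  proof (rule Q.distributed_jointI[OF sigma_finite_lborel sigma_finite_lborel])
    fix C B :: "real set" assume "C \<in> sets lborel" "B \<in> sets lborel"
    then have [measurable]: "C \<in> sets borel" "B \<in> sets borel" by auto
    have "emeasure ?Qi (\<tau> -` C \<inter> space ?Qi) = (\<integral>\<^sup>+r. ennreal (cond_density i r) * indicator C r \<partial>lborel)"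
      by (rule distributed_emeasure[OF cond_density_distributed[OF i]]) simp
    moreover have "emeasure (gaussian 1) B = (\<integral>\<^sup>+y. ?n y * indicator B y \<partial>lborel)"
      by (subst emeasure_density) auto
    moreover have "(\<integral>\<^sup>+r. (\<integral>\<^sup>+y. (case (r, y) of (r, y) \<Rightarrow> ennreal (cond_density i r) * ?n y) * indicator B y \<partial>lborel) * indicator C r \<partial>lborel) =
        (\<integral>\<^sup>+r. ennreal (cond_density i r) * indicator C r * (\<integral>\<^sup>+y. ?n y * indicator B y \<partial>lborel) \<partial>lborel)"
      by (subst nn_integral_cmult[symmetric]) (auto simp: ac_simps intro!: nn_integral_cong nn_integral_multc[symmetric] split: split_indicator)
    ultimately show "emeasure ?Q {\<omega> \<in> space ?Q. \<tau> \<omega> \<in> C \<and> noise t \<omega> \<in> B} =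
      (\<integral>\<^sup>+r. (\<integral>\<^sup>+y. (case (r, y) of (r, y) \<Rightarrow> ennreal (cond_density i r) * ?n y) * indicator B y \<partial>lborel) * indicator C r \<partial>lborel)"
      by (subst law) (auto simp: nn_integral_multc)
  qed auto
  let ?c = "\<lambda>r. sqrt (t * (late t r - t) / late t r)" and ?m = "\<lambda>r. t / late t r * \<sigma> * z i"
  have v: "0 < t * (late t r - t) / late t r" for r
    using late_bounds(1)[OF t(2), of r] t by simp
  have "distributed ?Q (lborel \<Otimes>\<^sub>M lborel) (\<lambda>\<omega>. (\<tau> \<omega>, ?c (\<tau> \<omega>) * noise t \<omega> + ?m (\<tau> \<omega>)))
    (\<lambda>(r, x). ennreal (cond_density i r) * (?n ((x - ?m r) / ?c r) / ennreal (?c r)))"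
    by (rule distributed_pair_affine[OF D]) (use v in \<open>measurable, auto\<close>)
  moreover have "(\<lambda>(r, x). ennreal (cond_density i r) * (?n ((x - ?m r) / ?c r) / ennreal (?c r))) = (\<lambda>(r, x). ennreal (joint_density t i r x))"
  proof -
    have "?n ((x - ?m r) / ?c r) / ennreal (?c r) = ennreal (bridge_density \<sigma> t (late t r) (z i) x)" for r x
    proof -
      have "normal_density (?m r) (?c r) x = centred_normal 1 ((x - ?m r) / ?c r) / ?c r"
        using v[of r] by (intro normal_density_standardize) simp
      then have "bridge_density \<sigma> t (late t r) (z i) x = centred_normal 1 ((x - ?m r) / ?c r) / ?c r"
        unfolding bridge_density_def gauss_kernel_eq_normal_density[OF v] .
      then show ?thesis using v[of r] by (simp add: divide_ennreal)
    qed
    then show ?thesis by (auto simp: joint_density_def cond_density_nonneg[OF i] ennreal_mult')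
  qed
  \<comment> \<open>The affine expression contains the constant \<open>z i\<close> where
    \<open>info t\<close> contains \<open>Z\<close>; they agree almost surely under the conditional
    probability.\<close>
  moreover have "distr ?Q (lborel \<Otimes>\<^sub>M lborel) (\<lambda>\<omega>. (\<tau> \<omega>, ?c (\<tau> \<omega>) * noise t \<omega> + ?m (\<tau> \<omega>))) =
      distr ?Q (lborel \<Otimes>\<^sub>M lborel) (\<lambda>\<omega>. (\<tau> \<omega>, info t \<omega>))"
  proof (rule distr_cong_AE)
    have "AE \<omega> in ?Q. Z \<omega> = z i"
      by (intro AE_uniform_measureI) auto
    then show "AE \<omega> in ?Q. (\<tau> \<omega>, ?c (\<tau> \<omega>) * noise t \<omega> + ?m (\<tau> \<omega>)) = (\<tau> \<omega>, info t \<omega>)"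
      by eventually_elim (simp add: info_eq_noise)
  qed auto
  moreover have J: "(\<lambda>(r, x). ennreal (joint_density t i r x)) \<in> borel_measurable (lborel \<Otimes>\<^sub>M lborel)"
    unfolding case_prod_beta' by (intro measurable_compose[OF joint_density_measurable[OF i] measurable_ennreal]) measurable
  ultimately show "distributed ?Q (lborel \<Otimes>\<^sub>M lborel) (\<lambda>\<omega>. (\<tau> \<omega>, info t \<omega>)) (\<lambda>(r, x). ennreal (joint_density t i r x))"
    unfolding distributed_def by auto
qed

end

text \<open>The events \<open>Z = z i\<close> partition the space; injectivity of \<open>z\<close>
  ensures that exactly one summand is active.\<close>

lemma indicator_sum_Z:
  assumes "\<omega> \<in> space M"
  shows "(\<Sum>i=1..l. indicator (E \<inter> {\<omega> \<in> space M. Z \<omega> = z i}) \<omega>) = (indicator E \<omega> :: real)"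
proof -
  obtain k where k: "k \<in> {1..l}" "Z \<omega> = z k" using Z_range[OF assms] by auto
  have "(\<Sum>i=1..l. indicator (E \<inter> {\<omega> \<in> space M. Z \<omega> = z i}) \<omega>) = (\<Sum>i=1..l. if i = k then indicator E \<omega> else (0::real))"
    using assms k inj_onD[OF inj_z, of _ k] by (intro sum.cong) (auto split: split_indicator)
  also have "\<dots> = indicator E \<omega>" using k by simp
  finally show ?thesis .
qed

lemma AE_Z_cases:
  assumes "\<And>i. i \<in> {1..l} \<Longrightarrow> AE \<omega> in M. Z \<omega> = z i \<longrightarrow> P \<omega>"
  shows "AE \<omega> in M. P \<omega>"
proof -
  have "AE \<omega> in M. \<forall>i\<in>{1..l}. Z \<omega> = z i \<longrightarrow> P \<omega>"
    using assms by (intro AE_finite_allI) auto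
  then show ?thesis using AE_space by eventually_elim (use Z_range in auto)
qed

context
  fixes t :: real
  assumes t: "0 < t" "t < T"
begin

lemma joint_density_nonneg:
  assumes "i \<in> {1..l}"
  shows "0 \<le> joint_density t i r x"
proof -
  have "0 \<le> t * (late t r - t) / late t r"
    using late_bounds(1)[OF t(2), of r] t by simp
  then show ?thesis using cond_density_nonneg[OF assms]
    unfolding joint_density_def bridge_density_def by (intro mult_nonneg_nonneg gauss_kernel_nonneg) auto
qed

text \<open>Expectations are computed value by value of \<open>Z\<close>. A bridge event enters only
  as the factor \<open>prob (bridge_event t J A)\<close>, which is how the irrelevance of the past
  bridge is used later. A null bridge event is treated separately because it cannot be conditioned
  on.\<close>

lemma
  assumes J: "finite J" "J \<subseteq> {0..t}" and A: "\<And>s. A s \<in> sets borel"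
    and h[measurable]: "h \<in> borel_measurable (borel \<Otimes>\<^sub>M borel)"
    and int: "\<And>i. i \<in> {1..l} \<Longrightarrow> integrable (lborel \<Otimes>\<^sub>M lborel) (\<lambda>q. joint_density t i (fst q) (snd q) * h q)"
  shows integrable_tau_info: "integrable M (\<lambda>\<omega>. indicator (bridge_event t J A) \<omega> * h (\<tau> \<omega>, info t \<omega>))"
    and integral_tau_info: "(\<integral>\<omega>. indicator (bridge_event t J A) \<omega> * h (\<tau> \<omega>, info t \<omega>) \<partial>M) =
      prob (bridge_event t J A) * (\<Sum>i=1..l. p i * (\<integral>q. joint_density t i (fst q) (snd q) * h q \<partial>(lborel \<Otimes>\<^sub>M lborel)))"
proof -
  let ?E = "bridge_event t J A"
  note [measurable] = bridge_event_measurable[OF t J A] info_measurable[OF t]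
  let ?I = "\<lambda>i. \<integral>q. joint_density t i (fst q) (snd q) * h q \<partial>(lborel \<Otimes>\<^sub>M lborel)"
  let ?F = "\<lambda>\<omega>. h (\<tau> \<omega>, info t \<omega>)"
  have "integrable M (\<lambda>\<omega>. indicator ?E \<omega> * ?F \<omega>) \<and> (\<integral>\<omega>. indicator ?E \<omega> * ?F \<omega> \<partial>M) = prob ?E * (\<Sum>i=1..l. p i * ?I i)"
  proof (cases "prob ?E = 0")
    case True
    then have "?E \<in> null_sets M" by (auto simp: null_sets_def emeasure_eq_measure)
    then have "AE \<omega> in M. \<omega> \<notin> ?E" by (rule AE_not_in)
    then have *: "AE \<omega> in M. indicator ?E \<omega> * ?F \<omega> = 0" by eventually_elim simp
    have "integrable M (\<lambda>\<omega>. indicator ?E \<omega> * ?F \<omega>) \<longleftrightarrow> integrable M (\<lambda>\<omega>. 0 :: real)"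
      using * by (intro integrable_cong_AE) auto
    moreover have "(\<integral>\<omega>. indicator ?E \<omega> * ?F \<omega> \<partial>M) = (\<integral>\<omega>. (0 :: real) \<partial>M)"
      using * by (intro integral_cong_AE) auto
    ultimately show ?thesis using True by simp
  next
    case False
    have part: "integrable M (\<lambda>\<omega>. indicator (?E \<inter> {\<omega> \<in> space M. Z \<omega> = z i}) \<omega> * ?F \<omega>) \<and>
      (\<integral>\<omega>. indicator (?E \<inter> {\<omega> \<in> space M. Z \<omega> = z i}) \<omega> * ?F \<omega> \<partial>M) = prob ?E * (p i * ?I i)" if i: "i \<in> {1..l}" for i
    proof -
      let ?EZ = "?E \<inter> {\<omega> \<in> space M. Z \<omega> = z i}"
      note pEZ = distributed_tau_info(1)[OF t i J A False] and D = distributed_tau_info(2)[OF t i J A False]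
      have p0: "prob ?EZ \<noteq> 0" using pEZ False p_pos[OF i] by simp
      have D': "distributed (uniform_measure M ?EZ) (lborel \<Otimes>\<^sub>M lborel) (\<lambda>\<omega>. (\<tau> \<omega>, info t \<omega>)) (\<lambda>q. ennreal (joint_density t i (fst q) (snd q)))"
        using D by (simp add: case_prod_beta')
      have nn: "0 \<le> joint_density t i (fst q) (snd q)" for q
        by (rule joint_density_nonneg[OF i])
      have hb: "h \<in> borel_measurable (lborel \<Otimes>\<^sub>M lborel)" using h by (simp cong: measurable_cong_sets sets_pair_measure_cong)
      have Fm: "?F \<in> borel_measurable M" by simp
      have "integrable M (\<lambda>\<omega>. indicator ?EZ \<omega> * ?F \<omega>)"
        using distributed_integrable[OF D' hb nn] int[OF i] integrable_uniform_measure[OF _ p0 Fm] by simp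
      moreover have "(\<integral>\<omega>. indicator ?EZ \<omega> * ?F \<omega> \<partial>M) = prob ?EZ * ?I i"
        using distributed_integral[OF D' hb nn] integral_uniform_measure[OF _ p0 Fm] p0 by simp
      ultimately show ?thesis by (simp add: pEZ)
    qed
    have eq: "indicator ?E \<omega> * ?F \<omega> = (\<Sum>i=1..l. indicator (?E \<inter> {\<omega> \<in> space M. Z \<omega> = z i}) \<omega> * ?F \<omega>)" if "\<omega> \<in> space M" for \<omega>
      by (subst indicator_sum_Z[OF that, symmetric]) (rule sum_distrib_right)
    have "integrable M (\<lambda>\<omega>. \<Sum>i=1..l. indicator (?E \<inter> {\<omega> \<in> space M. Z \<omega> = z i}) \<omega> * ?F \<omega>)"
      using part by (intro Bochner_Integration.integrable_sum) auto
    moreover have "(\<integral>\<omega>. indicator ?E \<omega> * ?F \<omega> \<partial>M) = (\<integral>\<omega>. (\<Sum>i=1..l. indicator (?E \<inter> {\<omega> \<in> space M. Z \<omega> = z i}) \<omega> * ?F \<omega>) \<partial>M)"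
      by (intro Bochner_Integration.integral_cong refl eq)
    moreover have "\<dots> = (\<Sum>i=1..l. prob ?E * (p i * ?I i))"
      using part by (subst Bochner_Integration.integral_sum) auto
    ultimately show ?thesis
      by (subst Bochner_Integration.integrable_cong[OF refl eq]) (auto simp: sum_distrib_left)
  qed
  then show "integrable M (\<lambda>\<omega>. indicator ?E \<omega> * ?F \<omega>)"
    "(\<integral>\<omega>. indicator ?E \<omega> * ?F \<omega> \<partial>M) = prob ?E * (\<Sum>i=1..l. p i * ?I i)" by auto
qed

lemma distributed_tau_info_Z:
  assumes i: "i \<in> {1..l}"
  shows "distributed (uniform_measure M {\<omega> \<in> space M. Z \<omega> = z i}) (lborel \<Otimes>\<^sub>M lborel)
      (\<lambda>\<omega>. (\<tau> \<omega>, info t \<omega>)) (\<lambda>q. ennreal (joint_density t i (fst q) (snd q)))"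
proof -
  have "space M \<inter> {\<omega> \<in> space M. Z \<omega> = z i} = {\<omega> \<in> space M. Z \<omega> = z i}" by auto
  then show ?thesis
    using distributed_tau_info(2)[OF t i, of "{}" "\<lambda>_. {}"] by (simp add: bridge_event_empty prob_space case_prod_beta')
qed

text \<open>This is the way back from \<open>M\<close> to Lebesgue measure: integrability survives
  restriction to \<open>Z = z i\<close>, an event of positive probability, and there the law of the
  pair has the given density.\<close>

lemma integrable_joint_density:
  assumes i: "i \<in> {1..l}" and h[measurable]: "h \<in> borel_measurable (borel \<Otimes>\<^sub>M borel)"
    and int: "integrable M (\<lambda>\<omega>. h (\<tau> \<omega>, info t \<omega>))"
  shows "integrable (lborel \<Otimes>\<^sub>M lborel) (\<lambda>q. joint_density t i (fst q) (snd q) * h q)"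
proof -
  note [measurable] = info_measurable[OF t]
  have hb: "h \<in> borel_measurable (lborel \<Otimes>\<^sub>M lborel)" using h by (simp cong: measurable_cong_sets sets_pair_measure_cong)
  have "integrable M (\<lambda>\<omega>. indicator {\<omega> \<in> space M. Z \<omega> = z i} \<omega> * h (\<tau> \<omega>, info t \<omega>))"
    using integrable_mult_indicator[OF _ int, of "{\<omega> \<in> space M. Z \<omega> = z i}"] by simp
  then show ?thesis
    using distributed_integrable[OF distributed_tau_info_Z[OF i] hb joint_density_nonneg[OF i]]
      integrable_uniform_measure[OF _ prob_Z_nonzero[OF i], of "\<lambda>\<omega>. h (\<tau> \<omega>, info t \<omega>)"] by simp
qed

lemma AE_tau_info:
  assumes [measurable]: "Measurable.pred (borel \<Otimes>\<^sub>M borel) P" and P: "AE q in lborel \<Otimes>\<^sub>M lborel. P q"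
  shows "AE \<omega> in M. P (\<tau> \<omega>, info t \<omega>)"
proof (rule AE_Z_cases)
  fix i assume i: "i \<in> {1..l}"
  interpret Q: prob_space "uniform_measure M {\<omega> \<in> space M. Z \<omega> = z i}"
    using prob_Z_nonzero[OF i] by (intro prob_space_uniform_measure) (auto simp: emeasure_eq_measure)
  have [measurable]: "Measurable.pred (lborel \<Otimes>\<^sub>M lborel) P"
    using assms(1) by (simp cong: measurable_cong_sets sets_pair_measure_cong)
  have "AE \<omega> in uniform_measure M {\<omega> \<in> space M. Z \<omega> = z i}. P (\<tau> \<omega>, info t \<omega>)"
    using P by (subst Q.distributed_AE2[OF distributed_tau_info_Z[OF i]]) auto
  then have "AE \<omega> in M. \<omega> \<in> {\<omega> \<in> space M. Z \<omega> = z i} \<longrightarrow> P (\<tau> \<omega>, info t \<omega>)"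
    using prob_Z_nonzero[OF i] by (subst (asm) AE_uniform_measure) (auto simp: emeasure_eq_measure less_top[symmetric])
  then show "AE \<omega> in M. Z \<omega> = z i \<longrightarrow> P (\<tau> \<omega>, info t \<omega>)"
    using AE_space by eventually_elim auto
qed

text \<open>The law of \<open>info t\<close> is absolutely continuous, so a property of
  Lebesgue-almost every x may be read at x = \<open>info t\<close>.\<close>

lemma AE_info:
  assumes P: "AE x in lborel. P x"
  shows "AE \<omega> in M. P (info t \<omega>)"
proof -
  \<comment> \<open>\<open>P\<close> need not be measurable, hence the detour through a measurable
    null cover \<open>K\<close> of its exceptional set.\<close>
  obtain K where K: "{x. \<not> P x} \<subseteq> K" "K \<in> null_sets lborel" using P unfolding eventually_ae_filter by auto
  then have [measurable]: "K \<in> sets borel" by auto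
  have "AE x in lborel. x \<notin> K" using K(2) by (rule AE_not_in)
  then have "AE r in lborel. AE x in (lborel :: real measure). snd (r :: real, x) \<notin> K" by simp
  moreover have "{q \<in> space (lborel \<Otimes>\<^sub>M lborel). snd (q :: real \<times> real) \<notin> K} \<in> sets (lborel \<Otimes>\<^sub>M lborel)"
    by measurable
  ultimately have "AE q in lborel \<Otimes>\<^sub>M lborel. snd (q :: real \<times> real) \<notin> K"
    by (intro lborel_pair.AE_pair_measure) auto
  then have "AE \<omega> in M. snd (\<tau> \<omega>, info t \<omega>) \<notin> K"
    by (intro AE_tau_info) auto
  then show ?thesis using K(1) by (auto elim!: eventually_mono)
qed

end

section \<open>Bayes' formula\<close>

text \<open>As a function of \<open>x\<close>, the Lebesgue density of the signed measure that maps
  \<open>B\<close> to the conditional expectation of \<open>k(nu)\<close> over {t < tau,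
  \<open>info t\<close> in \<open>B\<close>} given \<open>Z = z i\<close>;
  \<open>k (min r T)\<close> is \<open>k(nu)\<close> at tau = \<open>r\<close>.\<close>

definition slice :: "real \<Rightarrow> (real \<Rightarrow> real) \<Rightarrow> nat \<Rightarrow> real \<Rightarrow> real" where
  "slice t k i x = (\<integral>r. joint_density t i r x * (indicator {t<..} r * k (min r T)) \<partial>lborel)"

definition mixture :: "real \<Rightarrow> (real \<Rightarrow> real) \<Rightarrow> real \<Rightarrow> real" where
  "mixture t k x = (\<Sum>i=1..l. p i * slice t k i x)"

text \<open>The Bayes quotient: the density of \<open>info t\<close> weighted by
  \<open>k(nu)\<close> over the unweighted one, both restricted to {t < tau}.\<close>

definition posterior :: "real \<Rightarrow> (real \<Rightarrow> real) \<Rightarrow> real \<Rightarrow> real" where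
  "posterior t k x = mixture t k x / mixture t (\<lambda>_. 1) x"

context
  fixes t :: real and k :: "real \<Rightarrow> real"
  assumes t: "0 < t" "t < T"
    and k[measurable]: "k \<in> borel_measurable borel"
    and k_int: "integrable M (\<lambda>\<omega>. k (min (\<tau> \<omega>) T))"
begin

lemma slice_measurable: "i \<in> {1..l} \<Longrightarrow> slice t k i \<in> borel_measurable borel"
proof -
  assume i: "i \<in> {1..l}"
  note [measurable] = joint_density_measurable[OF i]
  show ?thesis unfolding slice_def by measurable
qed

lemma mixture_measurable: "mixture t k \<in> borel_measurable borel"
  unfolding mixture_def using slice_measurable by (intro borel_measurable_sum borel_measurable_times) auto

lemma integrable_joint_density_time:
  assumes i: "i \<in> {1..l}" and [measurable]: "B \<in> sets borel"
  shows "integrable (lborel \<Otimes>\<^sub>M lborel) (\<lambda>(r, x). joint_density t i r x * (indicator {t<..} r * k (min r T)) * indicator B x)"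
proof -
  note [measurable] = info_measurable[OF t]
  have "integrable M (\<lambda>\<omega>. indicator {\<omega> \<in> space M. t < \<tau> \<omega> \<and> info t \<omega> \<in> B} \<omega> *\<^sub>R k (min (\<tau> \<omega>) T))"
    by (rule integrable_mult_indicator[OF _ k_int]) measurable
  then have "integrable M (\<lambda>\<omega>. (\<lambda>q. (indicator {t<..} (fst q) * k (min (fst q) T)) * indicator B (snd q)) (\<tau> \<omega>, info t \<omega>))"
    by (rule Bochner_Integration.integrable_cong[THEN iffD1, OF refl, rotated]) (auto split: split_indicator)
  from integrable_joint_density[OF t i _ this] show ?thesis
    by (simp add: case_prod_beta' mult.assoc)
qed

lemma
  assumes i: "i \<in> {1..l}"
  shows AE_integrable_slice: "AE x in lborel. integrable lborel (\<lambda>r. joint_density t i r x * (indicator {t<..} r * k (min r T)))"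
    and integrable_slice: "integrable lborel (slice t k i)"
proof -
  have int: "integrable (lborel \<Otimes>\<^sub>M lborel) (\<lambda>(r, x). joint_density t i r x * (indicator {t<..} r * k (min r T)))"
    using integrable_joint_density_time[OF i, of UNIV] by simp
  show "AE x in lborel. integrable lborel (\<lambda>r. joint_density t i r x * (indicator {t<..} r * k (min r T)))"
    using lborel_pair.AE_integrable_snd[OF int] .
  show "integrable lborel (slice t k i)"
    unfolding slice_def using lborel_pair.integrable_snd[OF int] .
qed

lemma integral_slice:
  assumes i: "i \<in> {1..l}" and B: "B \<in> sets borel"
  shows "(\<integral>q. joint_density t i (fst q) (snd q) * ((indicator {t<..} (fst q) * k (min (fst q) T)) * indicator B (snd q)) \<partial>(lborel \<Otimes>\<^sub>M lborel)) =
    (\<integral>x. slice t k i x * indicator B x \<partial>lborel)"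
  using lborel_pair.integral_snd[OF integrable_joint_density_time[OF i B]]
  by (simp add: slice_def case_prod_beta' mult.assoc[symmetric])

lemma integrable_mixture: "integrable lborel (mixture t k)"
  unfolding mixture_def using integrable_slice by (intro Bochner_Integration.integrable_sum integrable_mult_right) auto

text \<open>The integral is split at \<open>T\<close>. Up to \<open>T\<close> the bridge ends at
  \<open>r\<close> itself; beyond it the bridge ends at \<open>T\<close>, so kernel and
  \<open>k\<close> are constants and the density of tau integrates to the tail mass. The endpoints
  \<open>t\<close> and \<open>T\<close> are changed by null sets. Integrability is a hypothesis
  because the Bochner integral is additive only for integrable functions.\<close>

lemma slice_eq:
  assumes i: "i \<in> {1..l}"
    and int: "integrable lborel (\<lambda>r. joint_density t i r x * (indicator {t<..} r * k (min r T)))"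
  shows "slice t k i x = (LBINT r:{t..T}. k r * bridge_density \<sigma> t r (z i) x * f r (z i))
    + tail_mass f T (z i) * k T * bridge_density \<sigma> t T (z i) x"
proof -
  let ?F = "\<lambda>r. joint_density t i r x * (indicator {t<..} r * k (min r T))"
  have [measurable]: "cond_density i \<in> borel_measurable borel" by (rule cond_density_measurable[OF i])
  have int1: "integrable lborel (\<lambda>r. indicator {..T} r * ?F r)" and int2: "integrable lborel (\<lambda>r. indicator {T<..} r * ?F r)"
    using integrable_mult_indicator[OF _ int, of "{..T}"] integrable_mult_indicator[OF _ int, of "{T<..}"] by simp_all
  have "slice t k i x = (\<integral>r. indicator {..T} r * ?F r + indicator {T<..} r * ?F r \<partial>lborel)"
    unfolding slice_def by (intro Bochner_Integration.integral_cong) (auto split: split_indicator)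
  also have "\<dots> = (\<integral>r. indicator {..T} r * ?F r \<partial>lborel) + (\<integral>r. indicator {T<..} r * ?F r \<partial>lborel)"
    using int1 int2 by (rule Bochner_Integration.integral_add)
  also have "(\<integral>r. indicator {..T} r * ?F r \<partial>lborel) = (LBINT r:{t..T}. k r * bridge_density \<sigma> t r (z i) x * f r (z i))"
  proof -
    have "(\<integral>r. indicator {..T} r * ?F r \<partial>lborel) = (\<integral>r. indicator {t..T} r * (k r * bridge_density \<sigma> t r (z i) x * cond_density i r) \<partial>lborel)"
    proof (rule integral_cong_AE)
      show "AE r in lborel. indicator {..T} r * ?F r = indicator {t..T} r * (k r * bridge_density \<sigma> t r (z i) x * cond_density i r)"
        using AE_lborel_singleton[of t] by eventually_elim (auto simp: joint_density_def late_def split: split_indicator)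
    next
      show "(\<lambda>r. indicator {..T} r * ?F r) \<in> borel_measurable lborel"
        by (intro borel_measurable_times joint_density_measurable[OF i]) measurable
      show "(\<lambda>r. indicator {t..T} r * (k r * bridge_density \<sigma> t r (z i) x * cond_density i r)) \<in> borel_measurable lborel"
        unfolding bridge_density_def gauss_kernel_def by measurable
    qed
    also have "\<dots> = (LBINT r:{t..T}. k r * bridge_density \<sigma> t r (z i) x * f r (z i))"
      unfolding set_lebesgue_integral_def
      using t by (intro Bochner_Integration.integral_cong) (auto simp: cond_density_def split: split_indicator)
    finally show ?thesis .
  qed
  also have "(\<integral>r. indicator {T<..} r * ?F r \<partial>lborel) = (\<integral>r. (k T * bridge_density \<sigma> t T (z i) x) * (indicator {T<..} r * cond_density i r) \<partial>lborel)"
    using t by (intro Bochner_Integration.integral_cong) (auto simp: joint_density_def late_def split: split_indicator)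
  also have "\<dots> = (k T * bridge_density \<sigma> t T (z i) x) * (\<integral>r. indicator {T<..} r * cond_density i r \<partial>lborel)"
    by simp
  also have "(\<integral>r. indicator {T<..} r * cond_density i r \<partial>lborel) = tail_mass f T (z i)"
  proof -
    have "(\<integral>r. indicator {T<..} r * cond_density i r \<partial>lborel) = (\<integral>r. indicator {T..} r * cond_density i r \<partial>lborel)"
    proof (rule integral_cong_AE)
      show "AE r in lborel. indicator {T<..} r * cond_density i r = indicator {T..} r * cond_density i r"
        using AE_lborel_singleton[of T] by eventually_elim (auto split: split_indicator)
    qed measurable
    also have "\<dots> = tail_mass f T (z i)"
      unfolding tail_mass_def set_lebesgue_integral_def
      using t by (intro Bochner_Integration.integral_cong) (auto simp: cond_density_def split: split_indicator)
    finally show ?thesis .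
  qed
  finally show ?thesis by (simp add: mult_ac)
qed

end

context
  fixes t :: real
  assumes t: "0 < t" "t < T"
begin

lemma bridge_density_T_pos: "0 < bridge_density \<sigma> t T y x"
  using t unfolding bridge_density_def by (subst gauss_kernel_eq_normal_density) (auto intro!: normal_density_pos)

text \<open>If the denominator vanished, all slices would vanish; their nonnegative integrands would
  then be zero almost everywhere, which forces tau \<le> T almost surely. Integrability excludes
  that a slice is 0 merely by the default value of the Bochner integral.\<close>

lemma mixture_one_pos:
  assumes int: "\<And>i. i \<in> {1..l} \<Longrightarrow> integrable lborel (\<lambda>r. joint_density t i r x * (indicator {t<..} r * 1))"
  shows "0 < mixture t (\<lambda>_. 1) x" "\<And>i. i \<in> {1..l} \<Longrightarrow> 0 \<le> slice t (\<lambda>_. 1) i x"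
proof -
  show nn: "0 \<le> slice t (\<lambda>_. 1) i x" if "i \<in> {1..l}" for i
    unfolding slice_def using joint_density_nonneg[OF t that] by (intro integral_nonneg_AE) auto
  show "0 < mixture t (\<lambda>_. 1) x"
  proof (rule ccontr)
    assume "\<not> ?thesis"
    moreover have pn: "0 \<le> p i * slice t (\<lambda>_. 1) i x" if "i \<in> {1..l}" for i
      using nn[OF that] p_pos[OF that] by simp
    ultimately have "(\<Sum>i=1..l. p i * slice t (\<lambda>_. 1) i x) = 0"
      unfolding mixture_def using sum_nonneg[of "{1..l}" "\<lambda>i. p i * slice t (\<lambda>_. 1) i x"] by fastforce
    then have "\<forall>i\<in>{1..l}. p i * slice t (\<lambda>_. 1) i x = 0"
      using pn by (subst (asm) sum_nonneg_eq_0_iff) auto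
    then have sl0: "slice t (\<lambda>_. 1) i x = 0" if "i \<in> {1..l}" for i
    proof -
      have "p i * slice t (\<lambda>_. 1) i x = 0" using \<open>\<forall>i\<in>{1..l}. p i * slice t (\<lambda>_. 1) i x = 0\<close> that by blast
      then show ?thesis using p_pos[OF that] by simp
    qed
    have "AE \<omega> in M. \<tau> \<omega> \<le> T"
    proof (rule AE_Z_cases)
      fix i assume i: "i \<in> {1..l}"
      have "AE r in lborel. joint_density t i r x * (indicator {t<..} r * 1) = 0"
        using sl0[OF i] integral_nonneg_eq_0_iff_AE[OF int[OF i]] joint_density_nonneg[OF t i]
        by (simp add: slice_def)
      \<comment> \<open>Only \<open>r > T\<close> is tested: there the kernel is the one ending at
        \<open>T\<close>, which is strictly positive, so the density of tau must vanish.\<close>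
      then have "AE r in lborel. 0 < ennreal (cond_density i r) \<longrightarrow> r \<le> T"
      proof eventually_elim
        case (elim r)
        then show ?case
          using bridge_density_T_pos[of "z i" x] t by (cases "r \<le> T") (auto simp: joint_density_def late_def)
      qed
      interpret Q: prob_space "uniform_measure M {\<omega> \<in> space M. Z \<omega> = z i}"
        using prob_Z_nonzero[OF i] by (intro prob_space_uniform_measure) (auto simp: emeasure_eq_measure)
      have "AE \<omega> in uniform_measure M {\<omega> \<in> space M. Z \<omega> = z i}. \<tau> \<omega> \<le> T"
        using \<open>AE r in lborel. 0 < ennreal (cond_density i r) \<longrightarrow> r \<le> T\<close>
        by (subst Q.distributed_AE2[OF cond_density_distributed[OF i]]) auto
      then have "AE \<omega> in M. \<omega> \<in> {\<omega> \<in> space M. Z \<omega> = z i} \<longrightarrow> \<tau> \<omega> \<le> T"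
        using prob_Z_nonzero[OF i] by (subst (asm) AE_uniform_measure) (auto simp: emeasure_eq_measure less_top[symmetric])
      then show "AE \<omega> in M. Z \<omega> = z i \<longrightarrow> \<tau> \<omega> \<le> T"
        using AE_space by eventually_elim auto
    qed
    then have "prob {\<omega> \<in> space M. \<tau> \<omega> \<le> T} = 1" by (subst prob_Collect_eq_1) auto
    with \<tau>_gt_T show False by simp
  qed
qed

lemma AE_mixture_one_pos:
  "AE x in lborel. 0 < mixture t (\<lambda>_. 1) x \<and> (\<forall>i\<in>{1..l}. 0 \<le> slice t (\<lambda>_. 1) i x \<and>
    integrable lborel (\<lambda>r. joint_density t i r x * (indicator {t<..} r * 1)))"
proof -
  have "AE x in lborel. \<forall>i\<in>{1..l}. integrable lborel (\<lambda>r. joint_density t i r x * (indicator {t<..} r * 1))"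
    by (intro AE_finite_allI AE_integrable_slice[OF t, of "\<lambda>_. 1"]) auto
  then show ?thesis by eventually_elim (use mixture_one_pos in blast)
qed

lemma posterior_measurable:
  "k \<in> borel_measurable borel \<Longrightarrow> integrable M (\<lambda>\<omega>. k (min (\<tau> \<omega>) T)) \<Longrightarrow> posterior t k \<in> borel_measurable borel"
  unfolding posterior_def by (intro borel_measurable_divide mixture_measurable[OF t]) auto

end

context
  fixes t :: real and k :: "real \<Rightarrow> real"
  assumes t: "0 < t" "t < T"
    and k[measurable]: "k \<in> borel_measurable borel"
    and k_int: "integrable M (\<lambda>\<omega>. k (min (\<tau> \<omega>) T))"
begin

text \<open>Each \<open>p i * slice t (\<lambda>_. 1) i x\<close> is at most the denominator
  \<open>mixture t (\<lambda>_. 1) x\<close>, which cancels. The bound is integrable in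
  \<open>x\<close>, so neither \<open>k\<close> nor the quotient has to be bounded.\<close>

lemma posterior_bound:
  assumes i: "i \<in> {1..l}"
  shows "AE x in lborel. \<bar>slice t (\<lambda>_. 1) i x * posterior t k x\<bar> \<le> \<bar>mixture t k x\<bar> / p i"
  using AE_mixture_one_pos[OF t]
proof eventually_elim
  case (elim x)
  have "p i * slice t (\<lambda>_. 1) i x \<le> mixture t (\<lambda>_. 1) x"
    unfolding mixture_def using i elim p_pos by (intro member_le_sum) (auto simp: less_imp_le)
  then have "p i * slice t (\<lambda>_. 1) i x * \<bar>posterior t k x\<bar> \<le> mixture t (\<lambda>_. 1) x * \<bar>posterior t k x\<bar>"
    by (rule mult_right_mono) simp
  also have "\<dots> = \<bar>mixture t k x\<bar>"
    using elim by (simp add: posterior_def abs_divide)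
  finally show ?case
    using p_pos[OF i] elim i by (simp add: abs_mult pos_le_divide_eq mult_ac)
qed

text \<open>Fubini is applied with \<open>r\<close> as the inner variable: integrating it out yields
  the slice times the absolute quotient, which \<open>posterior_bound\<close> dominates. A final
  swap restores the order of the coordinates.\<close>

lemma integrable_joint_density_posterior:
  assumes i: "i \<in> {1..l}" and [measurable]: "B \<in> sets borel"
  shows "integrable (lborel \<Otimes>\<^sub>M lborel) (\<lambda>(r, x). joint_density t i r x * (indicator {t<..} r * 1) * (posterior t k x * indicator B x))"
proof -
  note [measurable] = joint_density_measurable[OF i] posterior_measurable[OF t k k_int] mixture_measurable[OF t k k_int]
  have [measurable]: "slice t (\<lambda>_. 1) i \<in> borel_measurable borel"
    by (rule slice_measurable[OF t _ _ i]) auto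
  let ?f = "\<lambda>(r, x). joint_density t i r x * (indicator {t<..} r * 1) * (posterior t k x * indicator B x)"
  have "integrable (lborel \<Otimes>\<^sub>M lborel) (\<lambda>(x, r). ?f (r, x))"
  proof (rule lborel_pair.Fubini_integrable)
    show "(\<lambda>(x, r). ?f (r, x)) \<in> borel_measurable (lborel \<Otimes>\<^sub>M lborel)" by measurable
    have eq: "(\<integral>r. norm ((\<lambda>(x, r). ?f (r, x)) (x, r)) \<partial>lborel) = slice t (\<lambda>_. 1) i x * \<bar>posterior t k x * indicator B x\<bar>" for x
    proof -
      have "(\<integral>r. norm ((\<lambda>(x, r). ?f (r, x)) (x, r)) \<partial>lborel) = (\<integral>r. joint_density t i r x * (indicator {t<..} r * 1) * \<bar>posterior t k x * indicator B x\<bar> \<partial>lborel)"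
        using joint_density_nonneg[OF t i] by (intro Bochner_Integration.integral_cong) (auto simp: abs_mult)
      then show ?thesis by (simp add: slice_def)
    qed
    show "integrable lborel (\<lambda>x. \<integral>r. norm ((\<lambda>(x, r). ?f (r, x)) (x, r)) \<partial>lborel)"
      unfolding eq
    proof (rule Bochner_Integration.integrable_bound)
      show "integrable lborel (\<lambda>x. mixture t k x / p i)"
        using integrable_mixture[OF t k k_int] by simp
      show "AE x in lborel. norm (slice t (\<lambda>_. 1) i x * \<bar>posterior t k x * indicator B x\<bar>) \<le> norm (mixture t k x / p i)"
        using posterior_bound[OF i]
      proof eventually_elim
        case (elim x)
        then show ?case using p_pos[OF i] by (auto simp: abs_mult split: split_indicator)
      qed
    qed measurable
    show "AE x in lborel. integrable lborel (\<lambda>r. (\<lambda>(x, r). ?f (r, x)) (x, r))"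
      using AE_mixture_one_pos[OF t]
    proof eventually_elim
      case (elim x)
      then have "integrable lborel (\<lambda>r. joint_density t i r x * (indicator {t<..} r * 1))" using i by blast
      then show ?case by (simp del: mult_1_right)
    qed
  qed
  then show ?thesis
    using lborel_pair.integrable_product_swap_iff[of "?f"] by (simp add: case_prod_beta')
qed

lemma integral_posterior:
  assumes i: "i \<in> {1..l}" and B: "B \<in> sets borel"
  shows "(\<integral>q. joint_density t i (fst q) (snd q) * (indicator {t<..} (fst q) * (posterior t k (snd q) * indicator B (snd q))) \<partial>(lborel \<Otimes>\<^sub>M lborel)) =
    (\<integral>x. slice t (\<lambda>_. 1) i x * (posterior t k x * indicator B x) \<partial>lborel)"
    and "integrable lborel (\<lambda>x. slice t (\<lambda>_. 1) i x * (posterior t k x * indicator B x))"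
  using lborel_pair.integral_snd[OF integrable_joint_density_posterior[OF i B]]
    lborel_pair.integrable_snd[OF integrable_joint_density_posterior[OF i B]]
  by (simp_all add: slice_def case_prod_beta' mult.assoc[symmetric])

text \<open>After integrating out \<open>r\<close> and summing over the values of \<open>Z\<close>,
  the integrand in \<open>x\<close> is the indicator of \<open>B\<close> times \<open>mixture t k x
  - mixture t (\<lambda>_. 1) x * posterior t k x\<close>. This vanishes wherever the denominator is
  positive, that is, almost everywhere.\<close>

lemma bayes_rule:
  assumes J: "finite J" "J \<subseteq> {0..t}" and A: "\<And>s. A s \<in> sets borel" and B[measurable]: "B \<in> sets borel"
  shows "(\<integral>\<omega>. indicator (bridge_event t J A) \<omega> * (indicator {t<..} (\<tau> \<omega>) * (k (min (\<tau> \<omega>) T) - posterior t k (info t \<omega>)) * indicator B (info t \<omega>)) \<partial>M) = 0"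
proof -
  note [measurable] = posterior_measurable[OF t k k_int]
  let ?j = "\<lambda>i q. joint_density t i (fst q) (snd q)"
  let ?h1 = "\<lambda>q. (indicator {t<..} (fst q) * k (min (fst q) T)) * indicator B (snd q)"
  let ?h2 = "\<lambda>q. indicator {t<..} (fst q) * (posterior t k (snd q) * indicator B (snd q))"
  let ?h = "\<lambda>q. ?h1 q - ?h2 q"
  have i1: "integrable (lborel \<Otimes>\<^sub>M lborel) (\<lambda>q. ?j i q * ?h1 q)" if "i \<in> {1..l}" for i
    using integrable_joint_density_time[OF t k k_int that B] by (simp add: case_prod_beta' mult.assoc)
  have i2: "integrable (lborel \<Otimes>\<^sub>M lborel) (\<lambda>q. ?j i q * ?h2 q)" if "i \<in> {1..l}" for i
    using integrable_joint_density_posterior[OF that B] by (simp add: case_prod_beta' mult.assoc)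
  have int: "integrable (lborel \<Otimes>\<^sub>M lborel) (\<lambda>q. ?j i q * ?h q)" if "i \<in> {1..l}" for i
    using Bochner_Integration.integrable_diff[OF i1[OF that] i2[OF that]] by (simp add: right_diff_distrib)
  have "(\<integral>\<omega>. indicator (bridge_event t J A) \<omega> * ?h (\<tau> \<omega>, info t \<omega>) \<partial>M) =
    prob (bridge_event t J A) * (\<Sum>i=1..l. p i * (\<integral>q. ?j i q * ?h q \<partial>(lborel \<Otimes>\<^sub>M lborel)))"
    by (rule integral_tau_info[OF t J A _ int]) auto
  also have "(\<Sum>i=1..l. p i * (\<integral>q. ?j i q * ?h q \<partial>(lborel \<Otimes>\<^sub>M lborel))) =
     (\<Sum>i=1..l. p i * (\<integral>x. slice t k i x * indicator B x - slice t (\<lambda>_. 1) i x * (posterior t k x * indicator B x) \<partial>lborel))"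
  proof (intro sum.cong refl arg_cong2[where f="(*)"])
    fix i assume i: "i \<in> {1..l}"
    have "integrable lborel (\<lambda>x. slice t k i x * indicator B x)"
      using integrable_mult_indicator[OF _ integrable_slice[OF t k k_int i], of B] by (simp add: mult.commute)
    moreover have "(\<integral>q. ?j i q * ?h q \<partial>(lborel \<Otimes>\<^sub>M lborel)) = (\<integral>q. ?j i q * ?h1 q \<partial>(lborel \<Otimes>\<^sub>M lborel)) - (\<integral>q. ?j i q * ?h2 q \<partial>(lborel \<Otimes>\<^sub>M lborel))"
      using Bochner_Integration.integral_diff[OF i1[OF i] i2[OF i]] by (simp add: right_diff_distrib)
    ultimately show "(\<integral>q. ?j i q * ?h q \<partial>(lborel \<Otimes>\<^sub>M lborel)) = (\<integral>x. slice t k i x * indicator B x - slice t (\<lambda>_. 1) i x * (posterior t k x * indicator B x) \<partial>lborel)"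
      using integral_posterior[OF i B] integral_slice[OF t k k_int i B] by simp
  qed
  also have "\<dots> = (\<integral>x. (\<Sum>i=1..l. p i * (slice t k i x * indicator B x - slice t (\<lambda>_. 1) i x * (posterior t k x * indicator B x))) \<partial>lborel)"
  proof -
    have "integrable lborel (\<lambda>x. slice t k i x * indicator B x - slice t (\<lambda>_. 1) i x * (posterior t k x * indicator B x))" if i: "i \<in> {1..l}" for i
      using integrable_mult_indicator[OF _ integrable_slice[OF t k k_int i], of B] integral_posterior(2)[OF i B]
      by (intro Bochner_Integration.integrable_diff) (auto simp: mult.commute)
    then show ?thesis by (subst Bochner_Integration.integral_sum) auto
  qed
  also have "\<dots> = (\<integral>x. 0 \<partial>(lborel :: real measure))"
  proof (rule integral_cong_AE)
    show "AE x in lborel. (\<Sum>i=1..l. p i * (slice t k i x * indicator B x - slice t (\<lambda>_. 1) i x * (posterior t k x * indicator B x))) = 0"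
      using AE_mixture_one_pos[OF t]
    proof eventually_elim
      case (elim x)
      have "(\<Sum>i=1..l. p i * (slice t k i x * indicator B x - slice t (\<lambda>_. 1) i x * (posterior t k x * indicator B x))) =
        mixture t k x * indicator B x - mixture t (\<lambda>_. 1) x * (posterior t k x * indicator B x)"
        unfolding mixture_def sum_distrib_right sum_subtractf[symmetric]
        by (intro sum.cong refl) (simp add: right_diff_distrib mult.assoc)
      then show ?case using elim by (simp add: posterior_def)
    qed
  next
    show "(\<lambda>x. \<Sum>i=1..l. p i * (slice t k i x * indicator B x - slice t (\<lambda>_. 1) i x * (posterior t k x * indicator B x))) \<in> borel_measurable lborel"
    proof (rule borel_measurable_sum)
      fix i assume i: "i \<in> {1..l}"
      have [measurable]: "slice t (\<lambda>_. 1) i \<in> borel_measurable borel" "slice t k i \<in> borel_measurable borel"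
        using slice_measurable[OF t _ _ i] k_int by auto
      show "(\<lambda>x. p i * (slice t k i x * indicator B x - slice t (\<lambda>_. 1) i x * (posterior t k x * indicator B x))) \<in> borel_measurable lborel"
        by measurable
    qed
  qed simp
  finally show ?thesis
    by (simp add: algebra_simps)
qed

lemma integrable_posterior: "integrable M (\<lambda>\<omega>. indicator {t<..} (\<tau> \<omega>) * posterior t k (info t \<omega>))"
proof -
  note [measurable] = posterior_measurable[OF t k k_int]
  have "integrable M (\<lambda>\<omega>. indicator (bridge_event t {} (\<lambda>_. {})) \<omega> * (\<lambda>q. indicator {t<..} (fst q) * posterior t k (snd q)) (\<tau> \<omega>, info t \<omega>))"
  proof (rule integrable_tau_info[OF t])
    fix i assume i: "i \<in> {1..l}"
    show "integrable (lborel \<Otimes>\<^sub>M lborel) (\<lambda>q. joint_density t i (fst q) (snd q) * (indicator {t<..} (fst q) * posterior t k (snd q)))"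
      using integrable_joint_density_posterior[OF i, of UNIV] by (simp add: case_prod_beta' mult.assoc)
  qed auto
  then show ?thesis
    by (rule Bochner_Integration.integrable_cong[THEN iffD1, OF refl, rotated]) (simp add: bridge_event_empty)
qed

end

section \<open>The filtration of the information process\<close>

definition \<nu> :: "'a \<Rightarrow> real" where "\<nu> \<omega> = min (\<tau> \<omega>) T"

definition \<zeta> :: "real \<Rightarrow> 'a \<Rightarrow> real" where "\<zeta> = market_information \<sigma> W \<nu> Z"

definition info_filtration :: "real \<Rightarrow> 'a measure" where
  "info_filtration t = completed_natural_filtration M \<zeta> t"

lemma \<nu>_measurable[measurable]: "\<nu> \<in> borel_measurable M"
  unfolding \<nu>_def by measurable

lemma \<nu>_pos: "\<omega> \<in> space M \<Longrightarrow> 0 < \<nu> \<omega>"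
  using \<tau>_pos T_pos by (simp add: \<nu>_def)

lemma \<zeta>_measurable: "0 \<le> s \<Longrightarrow> \<zeta> s \<in> borel_measurable M"
proof -
  assume s: "0 \<le> s"
  have W: "0 \<le> u \<Longrightarrow> W u \<in> borel_measurable M" for u
    using brownian by (auto simp: std_brownian_motion_def)
  have c: "AE \<omega> in M. continuous_on {0..} (\<lambda>t. W t \<omega>)"
    using brownian unfolding std_brownian_motion_def by blast
  have [measurable]: "(\<lambda>\<omega>. W (\<nu> \<omega>) \<omega>) \<in> borel_measurable M"
    by (rule borel_measurable_path_at_random_time[OF complete W c]) (auto simp: less_imp_le \<nu>_pos)
  have [measurable]: "(\<lambda>\<omega>. W (min s (\<nu> \<omega>)) \<omega>) \<in> borel_measurable M"
    by (rule borel_measurable_path_at_random_time[OF complete W c]) (auto simp: less_imp_le \<nu>_pos s)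
  show ?thesis unfolding \<zeta>_def market_information_def by measurable
qed

lemma \<zeta>_late: "\<omega> \<in> space M \<Longrightarrow> \<nu> \<omega> \<le> s \<Longrightarrow> \<zeta> s \<omega> = \<sigma> * Z \<omega>"
  using \<nu>_pos[of \<omega>] by (simp add: \<zeta>_def market_information_def min_absorb2)

lemma AE_\<zeta>_bridge:
  assumes s: "0 \<le> s" "s \<le> t" and t: "0 < t" "t < T"
  shows "AE \<omega> in M. t < \<tau> \<omega> \<longrightarrow> \<zeta> s \<omega> = bridge t s \<omega> + s / t * info t \<omega>"
proof -
  \<comment> \<open>Where \<open>W 0 = 0\<close>, the bridges of \<open>V\<close> are those of
    \<open>W\<close>, in whose terms the market information is defined.\<close>
  have "AE \<omega> in M. W 0 \<omega> = 0" using brownian unfolding std_brownian_motion_def by blast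
  then show ?thesis
  proof eventually_elim
    case (elim \<omega>)
    show ?case
    proof
      assume \<tau>t: "t < \<tau> \<omega>"
      then have n: "\<nu> \<omega> = late t (\<tau> \<omega>)" "t < \<nu> \<omega>" using t by (auto simp: \<nu>_def late_def)
      then have "min s (\<nu> \<omega>) = s" using s by simp
      then have "\<zeta> s \<omega> = W s \<omega> - s / \<nu> \<omega> * W (\<nu> \<omega>) \<omega> + \<sigma> * (s / \<nu> \<omega>) * Z \<omega>"
        by (simp add: \<zeta>_def market_information_def)
      moreover have "info t \<omega> = W t \<omega> - t / \<nu> \<omega> * W (\<nu> \<omega>) \<omega> + \<sigma> * (t / \<nu> \<omega>) * Z \<omega>"
        using elim n by (simp add: info_def Let_def V_def)
      moreover have "bridge t s \<omega> = W s \<omega> - s / t * W t \<omega>"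
        using elim by (simp add: bridge_def V_def)
      ultimately show "\<zeta> s \<omega> = bridge t s \<omega> + s / t * info t \<omega>"
        using t n by (simp add: distrib_left right_diff_distrib)
    qed
  qed
qed

lemma AE_\<zeta>_info:
  assumes t: "0 < t" "t < T"
  shows "AE \<omega> in M. t < \<tau> \<omega> \<longrightarrow> \<zeta> t \<omega> = info t \<omega>"
  using AE_\<zeta>_bridge[OF _ _ t, of t] t by (auto simp: bridge_def)

lemma AE_\<nu>_le_iff:
  assumes t: "0 < t" "t < T"
  shows "AE \<omega> in M. \<nu> \<omega> \<le> t \<longleftrightarrow> \<zeta> t \<omega> \<in> (*) \<sigma> ` z ` {1..l}"
proof -
  have "AE \<omega> in M. \<forall>c\<in>(*) \<sigma> ` z ` {1..l}. info t \<omega> \<noteq> c"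
    by (intro AE_finite_allI AE_info[OF t] AE_lborel_singleton) auto
  then show ?thesis
    using AE_\<zeta>_info[OF t] AE_space
  proof eventually_elim
    case (elim \<omega>)
    show ?case
    proof (cases "\<nu> \<omega> \<le> t")
      case True
      then show ?thesis using \<zeta>_late[OF elim(3) True] Z_range[OF elim(3)] by auto
    next
      case False
      then have "t < \<tau> \<omega>" by (auto simp: \<nu>_def)
      then show ?thesis using elim False by auto
    qed
  qed
qed

lemma filtration_generators:
  "{\<zeta> s -` B \<inter> space M | s B. 0 \<le> s \<and> s \<le> t \<and> B \<in> sets borel} \<union> null_sets M \<subseteq> events"
  using measurable_sets[OF \<zeta>_measurable] by auto

lemma space_filtration: "space (info_filtration t) = space M"
  unfolding info_filtration_def completed_natural_filtration_def by (rule space_measure_of_conv)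

lemma sets_filtration:
  "sets (info_filtration t) = sigma_sets (space M)
    ({\<zeta> s -` B \<inter> space M | s B. 0 \<le> s \<and> s \<le> t \<and> B \<in> sets borel} \<union> null_sets M)"
  unfolding info_filtration_def completed_natural_filtration_def
  by (rule sets_measure_of) (use filtration_generators[of t] sets.space_closed[of M] in blast)

lemma subalgebra_filtration: "subalgebra M (info_filtration t)"
  unfolding subalgebra_def space_filtration sets_filtration
  using filtration_generators by (auto intro!: sets.sigma_sets_subset)

lemma \<zeta>_adapted: "0 \<le> s \<Longrightarrow> s \<le> t \<Longrightarrow> \<zeta> s \<in> borel_measurable (info_filtration t)"
  by (rule measurableI) (auto simp: space_filtration sets_filtration intro!: sigma_sets.Basic)

text \<open>The null sets are among the generators, so changing an event on a null set does not lead
  out of the completed sigma-algebra.\<close>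

lemma filtration_AE_closed:
  assumes A: "A \<in> sets (info_filtration t)" and B: "B \<in> events" and AB: "AE \<omega> in M. \<omega> \<in> A \<longleftrightarrow> \<omega> \<in> B"
  shows "B \<in> sets (info_filtration t)"
proof -
  have AM: "A \<in> events" using A subalgebra_filtration unfolding subalgebra_def by auto
  have "AE \<omega> in M. \<omega> \<notin> A - B" "AE \<omega> in M. \<omega> \<notin> B - A" using AB by (auto elim!: eventually_mono)
  then have "A - B \<in> null_sets M" "B - A \<in> null_sets M" using AM B by (auto simp: AE_iff_null_sets)
  then have "A - B \<in> sets (info_filtration t)" "B - A \<in> sets (info_filtration t)"
    unfolding sets_filtration by (auto intro: sigma_sets.Basic)
  then have "(A - (A - B)) \<union> (B - A) \<in> sets (info_filtration t)" using A by auto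
  moreover have "(A - (A - B)) \<union> (B - A) = B" by auto
  ultimately show ?thesis by simp
qed

text \<open>Up to a null set, nu \<le> s can be read off \<open>\<zeta> s\<close> alone, so
  completion turns nu into a stopping time below \<open>T\<close>.\<close>

lemma \<nu>_stopping:
  assumes s: "0 < s" "s \<le> t" "s < T"
  shows "{\<omega> \<in> space M. \<nu> \<omega> \<le> s} \<in> sets (info_filtration t)"
proof (rule filtration_AE_closed)
  have "(*) \<sigma> ` z ` {1..l} \<in> sets borel" by (intro borel_closed finite_imp_closed) auto
  then show "\<zeta> s -` ((*) \<sigma> ` z ` {1..l}) \<inter> space (info_filtration t) \<in> sets (info_filtration t)"
    using s by (intro measurable_sets[OF \<zeta>_adapted]) auto
  show "AE \<omega> in M. \<omega> \<in> \<zeta> s -` ((*) \<sigma> ` z ` {1..l}) \<inter> space (info_filtration t) \<longleftrightarrow> \<omega> \<in> {\<omega> \<in> space M. \<nu> \<omega> \<le> s}"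
    using AE_\<nu>_le_iff[OF s(1,3)] AE_space by eventually_elim (auto simp: space_filtration)
qed measurable

lemma stopped_function_adapted:
  fixes k :: "real \<Rightarrow> real"
  assumes t: "0 < t" "t < T" and [measurable]: "k \<in> borel_measurable borel"
  shows "(\<lambda>\<omega>. k (\<nu> \<omega>) * indicator {..t} (\<nu> \<omega>)) \<in> borel_measurable (info_filtration t)"
proof -
  \<comment> \<open>Off {nu \<le> t} the default \<open>T\<close> exceeds \<open>t\<close> and is
    erased by the indicator of \<open>{..t}\<close>, so the stopped function is a Borel function of
    \<open>\<eta>\<close>, whose sublevel sets below \<open>T\<close> concern nu up to time
    \<open>t\<close> only.\<close>
  define \<eta> where "\<eta> = (\<lambda>\<omega>. if \<nu> \<omega> \<le> t then \<nu> \<omega> else T)"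
  have [measurable]: "\<eta> \<in> borel_measurable (info_filtration t)"
    unfolding borel_measurable_iff_le
  proof
    fix a
    \<comment> \<open>The case \<open>a \<le> 0\<close> is separate because
      \<open>\<nu>_stopping\<close> needs a positive time; positivity of nu makes the event
      empty.\<close>
    have "{\<omega> \<in> space M. \<eta> \<omega> \<le> a} = (if T \<le> a then space M else if a \<le> 0 then {} else {\<omega> \<in> space M. \<nu> \<omega> \<le> min a t})"
    proof -
      have "\<eta> \<omega> \<le> a \<longleftrightarrow> (if T \<le> a then True else if a \<le> 0 then False else \<nu> \<omega> \<le> min a t)" if "\<omega> \<in> space M" for \<omega>
        using t \<nu>_pos[OF that] by (auto simp: \<eta>_def \<nu>_def)
      then show ?thesis by auto
    qed
    also have "\<dots> \<in> sets (info_filtration t)"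
      using \<nu>_stopping[of "min a t" t] t sets.top[of "info_filtration t"] by (auto simp: space_filtration)
    finally show "{\<omega> \<in> space (info_filtration t). \<eta> \<omega> \<le> a} \<in> sets (info_filtration t)" by (simp add: space_filtration)
  qed
  have "(\<lambda>\<omega>. k (\<nu> \<omega>) * indicator {..t} (\<nu> \<omega>)) = (\<lambda>\<omega>. (\<lambda>x. k x * indicator {..t} x) (\<eta> \<omega>))"
    by (rule ext) (use t in \<open>auto simp: \<eta>_def split: split_indicator\<close>)
  then show ?thesis by simp
qed

section \<open>The filtration on {t < nu} and the conditional expectation\<close>

text \<open>A pi-system that generates the sigma-algebra of \<open>info t\<close> and the bridge at
  all times in [0, t], made of exactly those events to which \<open>bayes_rule\<close>
  applies.\<close>

definition bridge_info_rectangles :: "real \<Rightarrow> 'a set set" where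
  "bridge_info_rectangles t = {bridge_event t J A \<inter> {\<omega> \<in> space M. info t \<omega> \<in> B} | J A B.
     finite J \<and> J \<subseteq> {0..t} \<and> (\<forall>s. A s \<in> sets borel) \<and> B \<in> sets borel}"

context
  fixes t :: real
  assumes t: "0 < t" "t < T"
begin

lemma bridge_info_rectanglesI:
  "finite J \<Longrightarrow> J \<subseteq> {0..t} \<Longrightarrow> (\<And>s. A s \<in> sets borel) \<Longrightarrow> B \<in> sets borel \<Longrightarrow>
    bridge_event t J A \<inter> {\<omega> \<in> space M. info t \<omega> \<in> B} \<in> bridge_info_rectangles t"
  unfolding bridge_info_rectangles_def by blast

lemma bridge_info_rectangles_events: "bridge_info_rectangles t \<subseteq> events"
  unfolding bridge_info_rectangles_def
  using bridge_event_measurable[OF t] measurable_sets_Collect[OF info_measurable[OF t]] by auto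

lemma Int_stable_bridge_info_rectangles: "Int_stable (bridge_info_rectangles t)"
proof (rule Int_stableI)
  fix X Y assume "X \<in> bridge_info_rectangles t" "Y \<in> bridge_info_rectangles t"
  then obtain J A B J' A' B' where X: "X = bridge_event t J A \<inter> {\<omega> \<in> space M. info t \<omega> \<in> B}"
    "finite J" "J \<subseteq> {0..t}" "\<And>s. A s \<in> sets borel" "B \<in> sets borel"
    and Y: "Y = bridge_event t J' A' \<inter> {\<omega> \<in> space M. info t \<omega> \<in> B'}"
    "finite J'" "J' \<subseteq> {0..t}" "\<And>s. A' s \<in> sets borel" "B' \<in> sets borel"
    unfolding bridge_info_rectangles_def by auto
  \<comment> \<open>A time in only one of \<open>J\<close>, \<open>J'\<close> is constrained by only
    one of the events; \<open>UNIV\<close> stands for the missing constraint.\<close>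
  have "X \<inter> Y = bridge_event t (J \<union> J') (\<lambda>s. (if s \<in> J then A s else UNIV) \<inter> (if s \<in> J' then A' s else UNIV)) \<inter>
    {\<omega> \<in> space M. info t \<omega> \<in> B \<inter> B'}"
    unfolding X(1) Y(1) bridge_event_def by (auto split: if_splits)
  also have "\<dots> \<in> bridge_info_rectangles t"
    using X Y by (intro bridge_info_rectanglesI) auto
  finally show "X \<inter> Y \<in> bridge_info_rectangles t" .
qed

text \<open>The events with such a counterpart form a sigma-algebra. It contains the generators: on
  {t < tau} each \<open>\<zeta> s\<close> is a combination of \<open>bridge t s\<close> and
  \<open>info t\<close> almost surely, and a null set has the counterpart \<open>{}\<close>.\<close>

lemma filtration_trace:
  assumes "A \<in> sets (info_filtration t)"
  shows "\<exists>A'\<in>sigma_sets (space M) (bridge_info_rectangles t). AE \<omega> in M. t < \<tau> \<omega> \<longrightarrow> (\<omega> \<in> A \<longleftrightarrow> \<omega> \<in> A')"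
  using assms unfolding sets_filtration
proof (induction rule: sigma_sets.induct)
  case (Basic A)
  then consider s B where "A = \<zeta> s -` B \<inter> space M" "0 \<le> s" "s \<le> t" "B \<in> sets borel" | "A \<in> null_sets M" by auto
  then show ?case
  proof cases
    case 1
    define H where "H = sigma (space M) (bridge_info_rectangles t)"
    have sub: "bridge_info_rectangles t \<subseteq> Pow (space M)"
      using bridge_info_rectangles_events sets.space_closed by blast
    have H: "sets H = sigma_sets (space M) (bridge_info_rectangles t)" "space H = space M"
      unfolding H_def using sub by (auto simp: space_measure_of_conv)
    have [measurable]: "bridge t s \<in> borel_measurable H"
    proof (rule measurableI)
      fix C :: "real set" assume "C \<in> sets borel"
      then have "bridge_event t {s} (\<lambda>_. C) \<inter> {\<omega> \<in> space M. info t \<omega> \<in> UNIV} \<in> bridge_info_rectangles t"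
        using 1 by (intro bridge_info_rectanglesI) auto
      moreover have "bridge_event t {s} (\<lambda>_. C) \<inter> {\<omega> \<in> space M. info t \<omega> \<in> UNIV} = bridge t s -` C \<inter> space H"
        by (auto simp: bridge_event_def H)
      ultimately show "bridge t s -` C \<inter> space H \<in> sets H" unfolding H(1) by auto
    qed simp
    have [measurable]: "info t \<in> borel_measurable H"
    proof (rule measurableI)
      fix C :: "real set" assume "C \<in> sets borel"
      then have "bridge_event t {} (\<lambda>_. UNIV) \<inter> {\<omega> \<in> space M. info t \<omega> \<in> C} \<in> bridge_info_rectangles t"
        by (intro bridge_info_rectanglesI) auto
      moreover have "bridge_event t {} (\<lambda>_. UNIV) \<inter> {\<omega> \<in> space M. info t \<omega> \<in> C} = info t -` C \<inter> space H"
        by (auto simp: bridge_event_def H)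
      ultimately show "info t -` C \<inter> space H \<in> sets H" unfolding H(1) by auto
    qed simp
    have [measurable]: "B \<in> sets borel" by (rule 1)
    have "{\<omega> \<in> space H. bridge t s \<omega> + s / t * info t \<omega> \<in> B} \<in> sets H" by measurable
    then show ?thesis
      unfolding H
    proof (rule bexI[rotated])
      show "AE \<omega> in M. t < \<tau> \<omega> \<longrightarrow> (\<omega> \<in> A \<longleftrightarrow> \<omega> \<in> {\<omega> \<in> space M. bridge t s \<omega> + s / t * info t \<omega> \<in> B})"
        using AE_\<zeta>_bridge[OF 1(2,3) t] AE_space by eventually_elim (auto simp: 1(1))
    qed
  next
    case 2
    then have "AE \<omega> in M. \<omega> \<notin> A" by (rule AE_not_in)
    then show ?thesis by (intro bexI[of _ "{}"]) (auto intro: sigma_sets.Empty elim!: eventually_mono)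
  qed
next
  case Empty
  show ?case by (intro bexI[of _ "{}"]) (auto intro: sigma_sets.Empty)
next
  case (Compl A)
  then obtain A' where A': "A' \<in> sigma_sets (space M) (bridge_info_rectangles t)" "AE \<omega> in M. t < \<tau> \<omega> \<longrightarrow> (\<omega> \<in> A \<longleftrightarrow> \<omega> \<in> A')" by auto
  show ?case
  proof (intro bexI)
    show "AE \<omega> in M. t < \<tau> \<omega> \<longrightarrow> (\<omega> \<in> space M - A \<longleftrightarrow> \<omega> \<in> space M - A')"
      using A'(2) by eventually_elim auto
  qed (rule sigma_sets.Compl[OF A'(1)])
next
  case (Union A)
  then have "\<forall>n. \<exists>A'. A' \<in> sigma_sets (space M) (bridge_info_rectangles t) \<and> (AE \<omega> in M. t < \<tau> \<omega> \<longrightarrow> (\<omega> \<in> A n \<longleftrightarrow> \<omega> \<in> A'))" by blast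
  then obtain A' where A': "\<And>n. A' n \<in> sigma_sets (space M) (bridge_info_rectangles t)"
    "\<And>n. AE \<omega> in M. t < \<tau> \<omega> \<longrightarrow> (\<omega> \<in> A n \<longleftrightarrow> \<omega> \<in> A' n)" by metis
  have "AE \<omega> in M. \<forall>n :: nat. t < \<tau> \<omega> \<longrightarrow> (\<omega> \<in> A n \<longleftrightarrow> \<omega> \<in> A' n)"
    unfolding AE_all_countable using A'(2) by blast
  then have "AE \<omega> in M. t < \<tau> \<omega> \<longrightarrow> (\<omega> \<in> (\<Union>n. A n) \<longleftrightarrow> \<omega> \<in> (\<Union>n. A' n))" by eventually_elim auto
  then show ?case using sigma_sets.Union[of A', OF A'(1)] by blast
qed

text \<open>The identity is known on a pi-system and is stable under complements and disjoint
  countable unions, so Dynkin's theorem extends it to the generated sigma-algebra.\<close>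

lemma set_integral_bayes_rule:
  fixes k :: "real \<Rightarrow> real"
  assumes k[measurable]: "k \<in> borel_measurable borel" and k_int: "integrable M (\<lambda>\<omega>. k (min (\<tau> \<omega>) T))"
    and A: "A \<in> sigma_sets (space M) (bridge_info_rectangles t)"
  shows "(LINT \<omega>:A|M. indicator {t<..} (\<tau> \<omega>) * (k (min (\<tau> \<omega>) T) - posterior t k (info t \<omega>))) = 0"
proof -
  let ?u = "\<lambda>\<omega>. indicator {t<..} (\<tau> \<omega>) * (k (min (\<tau> \<omega>) T) - posterior t k (info t \<omega>))"
  have "integrable M (\<lambda>\<omega>. indicator {\<omega> \<in> space M. t < \<tau> \<omega>} \<omega> *\<^sub>R k (min (\<tau> \<omega>) T) - indicator {t<..} (\<tau> \<omega>) * posterior t k (info t \<omega>))"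
    by (intro Bochner_Integration.integrable_diff integrable_mult_indicator k_int integrable_posterior[OF t k k_int]) measurable
  then have u: "integrable M ?u"
    by (rule Bochner_Integration.integrable_cong[THEN iffD1, OF refl, rotated]) (auto split: split_indicator)
  have sub: "bridge_info_rectangles t \<subseteq> Pow (space M)"
    using bridge_info_rectangles_events sets.space_closed by blast
  have sig: "X \<in> events" if "X \<in> sigma_sets (space M) (bridge_info_rectangles t)" for X
    using sets.sigma_sets_subset[OF bridge_info_rectangles_events] that by auto
  have si: "set_integrable M X ?u" if "X \<in> events" for X
    unfolding set_integrable_def by (rule integrable_mult_indicator[OF that u])
  have basic: "(LINT \<omega>:X|M. ?u \<omega>) = 0" if X: "X \<in> bridge_info_rectangles t" for X
  proof -
    obtain J A B where X: "X = bridge_event t J A \<inter> {\<omega> \<in> space M. info t \<omega> \<in> B}"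
      and *: "finite J" "J \<subseteq> {0..t}" "\<And>s. A s \<in> sets borel" "B \<in> sets borel"
      using X unfolding bridge_info_rectangles_def by auto
    have "(LINT \<omega>:X|M. ?u \<omega>) = (\<integral>\<omega>. indicator (bridge_event t J A) \<omega> * (?u \<omega> * indicator B (info t \<omega>)) \<partial>M)"
      unfolding set_lebesgue_integral_def X
      by (intro Bochner_Integration.integral_cong) (auto split: split_indicator)
    then show ?thesis using bayes_rule[OF t k k_int *] by simp
  qed
  \<comment> \<open>An empty set of times shows that the whole space is a rectangle; the complement
    step needs the integral over it to vanish.\<close>
  have "bridge_event t {} (\<lambda>_. UNIV) \<inter> {\<omega> \<in> space M. info t \<omega> \<in> UNIV} \<in> bridge_info_rectangles t"
    by (intro bridge_info_rectanglesI) auto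
  then have sp: "space M \<in> bridge_info_rectangles t" by (simp add: bridge_event_def)
  show ?thesis
    using Int_stable_bridge_info_rectangles sub A
  proof (induction rule: sigma_sets_induct_disjoint)
    case (basic A) then show ?case by (rule \<open>\<And>X. X \<in> bridge_info_rectangles t \<Longrightarrow> (LINT \<omega>:X|M. ?u \<omega>) = 0\<close>)
  next
    case empty show ?case by (simp add: set_lebesgue_integral_def)
  next
    case (compl A)
    have "(LINT \<omega>:A \<union> (space M - A)|M. ?u \<omega>) = (LINT \<omega>:A|M. ?u \<omega>) + (LINT \<omega>:space M - A|M. ?u \<omega>)"
      using sig[OF compl(1)] by (intro set_integral_Un si) auto
    moreover have "A \<union> (space M - A) = space M" using sets.sets_into_space[OF sig[OF compl(1)]] by auto
    ultimately show ?case using compl basic[OF sp] by simp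
  next
    case (union A)
    have "(LINT \<omega>:(\<Union>i. A i)|M. ?u \<omega>) = (\<Sum>i. LINT \<omega>:A i|M. ?u \<omega>)"
    proof -
      have "A i \<in> events" for i using union(2) sig by blast
      then show ?thesis
        using union(1) by (intro lebesgue_integral_countable_add si) (auto simp: disjoint_family_on_def)
    qed
    then show ?case using union by simp
  qed
qed

text \<open>The candidate is tested on an event \<open>A\<close> of the filtration. The difference
  from \<open>k(nu)\<close> vanishes almost surely off {t < tau}, so \<open>A\<close> may be
  replaced by its counterpart in the sigma-algebra of bridge and \<open>info t\<close>, where Bayes'
  rule holds.\<close>

lemma conditional_expectation_filtration:
  fixes k :: "real \<Rightarrow> real"
  assumes k[measurable]: "k \<in> borel_measurable borel" and k_int: "integrable M (\<lambda>\<omega>. k (\<nu> \<omega>))"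
  shows "AE \<omega> in M. real_cond_exp M (info_filtration t) (\<lambda>\<omega>. k (\<nu> \<omega>)) \<omega> =
    k (\<nu> \<omega>) * indicator {..t} (\<nu> \<omega>) + posterior t k (\<zeta> t \<omega>) * indicator {t<..} (\<nu> \<omega>)"
proof -
  interpret finite_measure_subalgebra M "info_filtration t"
    by unfold_locales (rule subalgebra_filtration)
  have k_int': "integrable M (\<lambda>\<omega>. k (min (\<tau> \<omega>) T))" using k_int by (simp add: \<nu>_def)
  let ?u = "\<lambda>\<omega>. indicator {t<..} (\<tau> \<omega>) * (k (min (\<tau> \<omega>) T) - posterior t k (info t \<omega>))"
  let ?R = "\<lambda>\<omega>. k (\<nu> \<omega>) * indicator {..t} (\<nu> \<omega>) + posterior t k (\<zeta> t \<omega>) * indicator {t<..} (\<nu> \<omega>)"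
  note [measurable] = posterior_measurable[OF t k k_int'] \<zeta>_measurable[of t] info_measurable[OF t]
  have [measurable]: "\<zeta> t \<in> borel_measurable (info_filtration t)" "\<zeta> t \<in> borel_measurable M"
    using t \<zeta>_adapted[of t t] \<zeta>_measurable[of t] by auto
  have AE_R: "AE \<omega> in M. ?R \<omega> = k (\<nu> \<omega>) * indicator {\<omega> \<in> space M. \<nu> \<omega> \<le> t} \<omega> + indicator {t<..} (\<tau> \<omega>) * posterior t k (info t \<omega>)"
    using AE_\<zeta>_info[OF t] AE_space by eventually_elim (use t in \<open>auto simp: \<nu>_def split: split_indicator\<close>)
  have R_int: "integrable M ?R"
  proof (subst integrable_cong_AE[OF _ _ AE_R])
    have "integrable M (\<lambda>\<omega>. indicator {\<omega> \<in> space M. \<nu> \<omega> \<le> t} \<omega> *\<^sub>R k (\<nu> \<omega>))"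
      by (intro integrable_mult_indicator k_int) measurable
    then show "integrable M (\<lambda>\<omega>. k (\<nu> \<omega>) * indicator {\<omega> \<in> space M. \<nu> \<omega> \<le> t} \<omega> + indicator {t<..} (\<tau> \<omega>) * posterior t k (info t \<omega>))"
      by (intro Bochner_Integration.integrable_add integrable_posterior[OF t k k_int']) (simp add: mult.commute)
  qed measurable
  show ?thesis
  proof (rule real_cond_exp_charact)
    have 1: "(\<lambda>\<omega>. k (\<nu> \<omega>) * indicator {..t} (\<nu> \<omega>)) \<in> borel_measurable (info_filtration t)"
      by (rule stopped_function_adapted[OF t k])
    have "(\<lambda>\<omega>. 1 - 1 * indicator {..t} (\<nu> \<omega>) :: real) \<in> borel_measurable (info_filtration t)"
      by (intro borel_measurable_diff borel_measurable_const stopped_function_adapted[OF t])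
    moreover have "(\<lambda>\<omega>. 1 - 1 * indicator {..t} (\<nu> \<omega>) :: real) = (\<lambda>\<omega>. indicator {t<..} (\<nu> \<omega>))"
      by (auto split: split_indicator)
    ultimately have 2: "(\<lambda>\<omega>. indicator {t<..} (\<nu> \<omega>) :: real) \<in> borel_measurable (info_filtration t)"
      by (simp only:)
    have 3: "(\<lambda>\<omega>. posterior t k (\<zeta> t \<omega>)) \<in> borel_measurable (info_filtration t)"
      using measurable_compose[OF \<zeta>_adapted posterior_measurable[OF t k k_int']] t by simp
    show "?R \<in> borel_measurable (info_filtration t)"
      by (rule borel_measurable_add[OF 1 borel_measurable_times[OF 3 2]])
  next
    fix A assume A: "A \<in> sets (info_filtration t)"
    then have AM[measurable]: "A \<in> events" using subalgebra_filtration unfolding subalgebra_def by auto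
    obtain A' where A': "A' \<in> sigma_sets (space M) (bridge_info_rectangles t)"
      and AA': "AE \<omega> in M. t < \<tau> \<omega> \<longrightarrow> (\<omega> \<in> A \<longleftrightarrow> \<omega> \<in> A')"
      using filtration_trace[OF A] by blast
    have A'M[measurable]: "A' \<in> events"
      using sets.sigma_sets_subset[OF bridge_info_rectangles_events] A' by auto
    have si: "set_integrable M A (\<lambda>\<omega>. k (\<nu> \<omega>))" "set_integrable M A ?R"
      unfolding set_integrable_def
      by (rule integrable_mult_indicator[OF AM k_int], rule integrable_mult_indicator[OF AM R_int])
    have "(LINT \<omega>:A|M. k (\<nu> \<omega>)) - (LINT \<omega>:A|M. ?R \<omega>) = (LINT \<omega>:A|M. k (\<nu> \<omega>) - ?R \<omega>)"
      using si by (rule set_integral_diff(2)[symmetric])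
    also have "\<dots> = (LINT \<omega>:A'|M. ?u \<omega>)"
      unfolding set_lebesgue_integral_def
    proof (rule integral_cong_AE)
      show "AE \<omega> in M. indicator A \<omega> *\<^sub>R (k (\<nu> \<omega>) - ?R \<omega>) = indicator A' \<omega> *\<^sub>R ?u \<omega>"
        using AE_R AA' AE_space
      proof eventually_elim
        case (elim \<omega>)
        then show ?case
          using t by (cases "t < \<tau> \<omega>") (auto simp: \<nu>_def split: split_indicator)
      qed
    qed measurable
    also have "\<dots> = 0" by (rule set_integral_bayes_rule[OF k k_int' A'])
    finally show "(LINT \<omega>:A|M. k (\<nu> \<omega>)) = (LINT \<omega>:A|M. ?R \<omega>)" by simp
  qed (rule k_int, rule R_int)
qed

text \<open>The equality is stated only for almost every \<open>x\<close> because the slice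
  integrals are known to converge only for such \<open>x\<close>.\<close>

lemma AE_posterior_eq:
  assumes k[measurable]: "k \<in> borel_measurable borel" and k_int: "integrable M (\<lambda>\<omega>. k (\<nu> \<omega>))"
  shows "AE x in lborel. posterior t k x =
    (\<Sum>i=1..l. ((LBINT r:{t..T}. k r * bridge_density \<sigma> t r (z i) x * f r (z i))
        + tail_mass f T (z i) * k T * bridge_density \<sigma> t T (z i) x)
      / (\<Sum>j=1..l. ((LBINT r:{t..T}. bridge_density \<sigma> t r (z j) x * f r (z j))
        + tail_mass f T (z j) * bridge_density \<sigma> t T (z j) x) * p j) * p i)"
proof -
  have k_int': "integrable M (\<lambda>\<omega>. k (min (\<tau> \<omega>) T))" using k_int by (simp add: \<nu>_def)
  have "AE x in lborel. \<forall>i\<in>{1..l}. slice t k i x = (LBINT r:{t..T}. k r * bridge_density \<sigma> t r (z i) x * f r (z i))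
        + tail_mass f T (z i) * k T * bridge_density \<sigma> t T (z i) x"
  proof (intro AE_finite_allI)
    fix i assume i: "i \<in> {1..l}"
    show "AE x in lborel. slice t k i x = (LBINT r:{t..T}. k r * bridge_density \<sigma> t r (z i) x * f r (z i))
        + tail_mass f T (z i) * k T * bridge_density \<sigma> t T (z i) x"
      using AE_integrable_slice[OF t k k_int' i] by eventually_elim (rule slice_eq[OF t k k_int' i])
  qed simp
  moreover have "AE x in lborel. \<forall>i\<in>{1..l}. slice t (\<lambda>_. 1) i x = (LBINT r:{t..T}. bridge_density \<sigma> t r (z i) x * f r (z i))
        + tail_mass f T (z i) * bridge_density \<sigma> t T (z i) x"
    using AE_mixture_one_pos[OF t]
  proof eventually_elim
    case (elim x)
    show ?case
    proof
      fix i assume i: "i \<in> {1..l}"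
      with elim have "integrable lborel (\<lambda>r. joint_density t i r x * (indicator {t<..} r * 1))" by blast
      from slice_eq[OF t _ _ i this] show "slice t (\<lambda>_. 1) i x = (LBINT r:{t..T}. bridge_density \<sigma> t r (z i) x * f r (z i))
        + tail_mass f T (z i) * bridge_density \<sigma> t T (z i) x"
        by (simp only: k measurable_const mult_1 mult_1_right borel_measurable_const integrable_const)
    qed
  qed
  ultimately show ?thesis
  proof eventually_elim
    case (elim x)
    have "posterior t k x = (\<Sum>i=1..l. slice t k i x / (\<Sum>j=1..l. slice t (\<lambda>_. 1) j x * p j) * p i)"
    proof -
      have "(\<Sum>j=1..l. p j * slice t (\<lambda>_. 1) j x) = (\<Sum>j=1..l. slice t (\<lambda>_. 1) j x * p j)"
        by (intro sum.cong refl mult.commute)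
      moreover have "p i * a / d = a / d * p i" for i a d by simp
      ultimately show ?thesis unfolding posterior_def mixture_def by (simp only: sum_divide_distrib)
    qed
    also have "(\<Sum>j=1..l. slice t (\<lambda>_. 1) j x * p j) = (\<Sum>j=1..l. ((LBINT r:{t..T}. bridge_density \<sigma> t r (z j) x * f r (z j))
        + tail_mass f T (z j) * bridge_density \<sigma> t T (z j) x) * p j)"
      by (intro sum.cong refl) (use elim(2) in \<open>simp only:\<close>)
    also have "(\<Sum>i=1..l. slice t k i x / (\<Sum>j=1..l. ((LBINT r:{t..T}. bridge_density \<sigma> t r (z j) x * f r (z j))
        + tail_mass f T (z j) * bridge_density \<sigma> t T (z j) x) * p j) * p i) =
      (\<Sum>i=1..l. ((LBINT r:{t..T}. k r * bridge_density \<sigma> t r (z i) x * f r (z i))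
        + tail_mass f T (z i) * k T * bridge_density \<sigma> t T (z i) x)
      / (\<Sum>j=1..l. ((LBINT r:{t..T}. bridge_density \<sigma> t r (z j) x * f r (z j))
        + tail_mass f T (z j) * bridge_density \<sigma> t T (z j) x) * p j) * p i)"
      by (intro sum.cong refl) (use elim(1) in \<open>simp only:\<close>)
    finally show ?case .
  qed
qed

end

end

theorem proposition3p2:
  fixes M :: "'a measure"
    and T \<sigma> t :: real
    and W \<zeta> :: "real \<Rightarrow> 'a \<Rightarrow> real"
    and \<tau> Z \<nu> :: "'a \<Rightarrow> real"
    and l :: nat
    and z p :: "nat \<Rightarrow> real"
    and f :: "real \<Rightarrow> real \<Rightarrow> real"
    and g :: "real \<Rightarrow> real"
  assumes "prob_space M" and "complete_measure M"
    and "0 < T" and "0 < \<sigma>"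
    and "std_brownian_motion M W"
    and "\<tau> \<in> borel_measurable M" and "\<And>\<omega>. \<omega> \<in> space M \<Longrightarrow> 0 < \<tau> \<omega>"
    and "Z \<in> borel_measurable M"
    and "prob_space.indep_set M
           (sets (vimage_algebra (space M) (\<lambda>\<omega>. \<lambda>s\<in>{0..}. W s \<omega>) (Pi\<^sub>M {0..} (\<lambda>_. borel))))
           (sets (vimage_algebra (space M) (\<lambda>\<omega>. (\<tau> \<omega>, Z \<omega>)) (borel \<Otimes>\<^sub>M borel)))"
    and "inj_on z {1..l}"
    and "\<And>\<omega>. \<omega> \<in> space M \<Longrightarrow> Z \<omega> \<in> z ` {1..l}"
    and "\<And>i. i \<in> {1..l} \<Longrightarrow> measure M {\<omega> \<in> space M. Z \<omega> = z i} = p i"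
    and "\<And>i. i \<in> {1..l} \<Longrightarrow> 0 < p i"
    and "(\<Sum>i=1..l. p i) = 1"
    and "measure M {\<omega> \<in> space M. \<tau> \<omega> \<le> T} < 1"
    and "\<And>i. i \<in> {1..l} \<Longrightarrow> continuous_on {0..} (\<lambda>r. f r (z i))"
    and "\<And>i. i \<in> {1..l} \<Longrightarrow> has_cond_density M \<tau> Z (z i) (\<lambda>r. f r (z i))"
    and "\<nu> = (\<lambda>\<omega>. min (\<tau> \<omega>) T)"
    and "\<zeta> = market_information \<sigma> W \<nu> Z"
    and "0 < t" and "t < T"
    and "g \<in> borel_measurable (restrict_space borel {0..T})"
    and "integrable M (\<lambda>\<omega>. g (\<nu> \<omega>))"
  shows "AE \<omega> in M.
    real_cond_exp M (completed_natural_filtration M \<zeta> t) (\<lambda>\<omega>. g (\<nu> \<omega>)) \<omega> =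
      g (\<nu> \<omega>) * indicator {..t} (\<nu> \<omega>)
      + (\<Sum>i=1..l.
          ((LBINT r:{t..T}. g r * bridge_density \<sigma> t r (z i) (\<zeta> t \<omega>) * f r (z i))
             + tail_mass f T (z i) * g T * bridge_density \<sigma> t T (z i) (\<zeta> t \<omega>))
          / (\<Sum>j=1..l.
              ((LBINT r:{t..T}. bridge_density \<sigma> t r (z j) (\<zeta> t \<omega>) * f r (z j))
                 + tail_mass f T (z j) * bridge_density \<sigma> t T (z j) (\<zeta> t \<omega>)) * p j)
          * p i * indicator {t<..} (\<nu> \<omega>))"
proof -
  interpret market_model M T \<sigma> W \<tau> Z l z p f
    using assms by (intro market_model.intro market_model_axioms.intro)
  note t = \<open>0 < t\<close> \<open>t < T\<close>
  have \<nu>: "market_model.\<nu> T \<tau> = \<nu>" using assms(18) by (auto simp: \<nu>_def)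
  have \<zeta>: "market_model.\<zeta> T \<sigma> W \<tau> Z = \<zeta>" using assms(19) by (simp add: \<zeta>_def \<nu>)
  \<comment> \<open>\<open>g\<close> is Borel on [0, \<open>T\<close>] only. Its extension by 0 is
    Borel on the line and agrees with \<open>g\<close> at every value of nu.\<close>
  define k where "k = (\<lambda>r. indicator {0..T} r *\<^sub>R g r)"
  have k[measurable]: "k \<in> borel_measurable borel"
    unfolding k_def using assms(22) by (subst (asm) borel_measurable_restrict_space_iff) auto
  have k_eq: "k r = g r" if "r \<in> {0..T}" for r using that by (simp add: k_def)
  have \<nu>_range: "\<nu> \<omega> \<in> {0..T}" if "\<omega> \<in> space M" for \<omega>
    using assms(7)[OF that] T_pos by (simp add: assms(18))
  have k_int: "integrable M (\<lambda>\<omega>. k (\<nu> \<omega>))"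
    using assms(23) k_eq[OF \<nu>_range] by (simp cong: Bochner_Integration.integrable_cong)
  let ?rhs = "\<lambda>g x. \<Sum>i=1..l. ((LBINT r:{t..T}. g r * bridge_density \<sigma> t r (z i) x * f r (z i))
        + tail_mass f T (z i) * g T * bridge_density \<sigma> t T (z i) x)
      / (\<Sum>j=1..l. ((LBINT r:{t..T}. bridge_density \<sigma> t r (z j) x * f r (z j))
        + tail_mass f T (z j) * bridge_density \<sigma> t T (z j) x) * p j) * p i"
  have rhs: "?rhs k x = ?rhs g x" for x
  proof -
    have "(LBINT r:{t..T}. k r * bridge_density \<sigma> t r y x * f r y) = (LBINT r:{t..T}. g r * bridge_density \<sigma> t r y x * f r y)" for y
      by (rule set_lebesgue_integral_cong) (use t in \<open>auto simp: k_eq\<close>)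
    then show ?thesis using T_pos by (simp add: k_eq)
  qed
  have "AE \<omega> in M. real_cond_exp M (completed_natural_filtration M \<zeta> t) (\<lambda>\<omega>. k (\<nu> \<omega>)) \<omega> =
    k (\<nu> \<omega>) * indicator {..t} (\<nu> \<omega>) + posterior t k (\<zeta> t \<omega>) * indicator {t<..} (\<nu> \<omega>)"
    using conditional_expectation_filtration[OF t k] k_int unfolding info_filtration_def \<nu> \<zeta> by blast
  moreover have "AE \<omega> in M. real_cond_exp M (completed_natural_filtration M \<zeta> t) (\<lambda>\<omega>. g (\<nu> \<omega>)) \<omega> =
    real_cond_exp M (completed_natural_filtration M \<zeta> t) (\<lambda>\<omega>. k (\<nu> \<omega>)) \<omega>"
  proof -
    interpret finite_measure_subalgebra M "completed_natural_filtration M \<zeta> t"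
      using subalgebra_filtration[of t] unfolding info_filtration_def \<zeta> by unfold_locales
    show ?thesis
      by (rule real_cond_exp_cong) (use assms(23) k_int k_eq[OF \<nu>_range] in auto)
  qed
  \<comment> \<open>The explicit formula is taken at \<open>info t\<close>, not at
    \<open>\<zeta> t\<close>: on {nu \<le> t} the latter sits at finitely many values, which a
    Lebesgue-almost-everywhere statement cannot reach. On {t < nu} the two agree almost surely, and
    elsewhere the indicator removes the term.\<close>
  moreover have "AE \<omega> in M. posterior t k (info t \<omega>) = ?rhs g (info t \<omega>)"
    using AE_info[OF t AE_posterior_eq[OF t k]] k_int unfolding rhs \<nu> by blast
  moreover have "AE \<omega> in M. t < \<tau> \<omega> \<longrightarrow> \<zeta> t \<omega> = info t \<omega>"
    using AE_\<zeta>_info[OF t] unfolding \<zeta> .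
  ultimately show ?thesis
    using AE_space
  proof eventually_elim
    case (elim \<omega>)
    show ?case
    proof (cases "t < \<nu> \<omega>")
      case True
      then have "\<zeta> t \<omega> = info t \<omega>" using elim(4) assms(18) by simp
      then show ?thesis using elim(1-3) True by simp
    next
      case False
      then show ?thesis using elim(1,2) k_eq[OF \<nu>_range[OF elim(5)]] by simp
    qed
  qed
qed

end
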